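(* The MSMFE-0 method has a unique solution: for every $f\in L^2(\Omega,\mathbb{R}^3)$ there exists exactly one triple $(\sigma_h,u_h,\gamma_h)\in \mathbb{X}_h\times V_h\times \mathbb{W}_h^0$ such that $$(A\sigma_h,\tau)_Q+(u_h,\operatorname{div}\tau)+(\gamma_h,\tau)=0\quad\forall \tau\in\mathbb{X}_h,$$ $$(\operatorname{div}\sigma_h,v)=(f,v)\quad\forall v\in V_h,$$ $$(\sigma_h,w)=0\quad\forall w\in\mathbb{W}_h^0.$$
   Context: **Setting.** $\Omega\subset\mathbb{R}^3$ is a simply connected bounded domain, $\partial\Omega=\Gamma_D\cup\Gamma_N$ with $\Gamma_D\neq\emptyset$. $\mathbb{M}$ and $\mathbb{N}$ denote the real $3\times3$ matrices and the skew-symmetric $3\times 3$ matrices. $\operatorname{div}$ and $\operatorname{curl}$ act row-wise on matrix fields. $(\cdot,\cdot)$, $\|\cdot\|$ are the $L^2(\Omega)$ inner product and norm (scalar, vector or matrix valued; $:$ is the Frobenius product). The compliance tensor $A=A(\mathbf{x})$ is a symmetric, bounded, uniformly positive definite linear operator $\mathbb{M}\to\mathbb{M}$, element-wise continuous on the mesh below. **Mesh.** $\mathcal{T}_h$ is a shape-regular, conforming (face-to-face) partition of $\Omega$ into cuboids (rectangular boxes); $\Gamma_D$ and $\Gamma_N$ are unions of element faces. $\hat E=[0,1]^3$ is the reference cube with vertices $\hat{\mathbf r}_1=(0,0,0)$, $\hat{\mathbf r}_2=(1,0,0)$, $\hat{\mathbf r}_3=(1,1,0)$, $\hat{\mathbf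 r}_4=(0,1,0)$, $\hat{\mathbf r}_5=(0,0,1)$, $\hat{\mathbf r}_6=(1,0,1)$, $\hat{\mathbf r}_7=(1,1,1)$, $\hat{\mathbf r}_8=(0,1,1)$. For an element $E$ with corresponding vertices $\mathbf r_1,\dots,\mathbf r_8$, $F_E:\hat E\to E$ is the affine bijection $F_E(\hat{\mathbf{x}})=\mathbf r_1+(\mathbf r_2-\mathbf r_1)\hat x+(\mathbf r_4-\mathbf r_1)\hat y+(\mathbf r_5-\mathbf r_1)\hat z$, with Jacobian matrix $DF_E$ and $J_E=|\det DF_E|$. **Enhanced Raviart-Thomas space.** $\mathcal{RT}_0(\hat E)=\{(\alpha_1+\beta_1\hat x,\alpha_2+\beta_2\hat y,\alpha_3+\beta_3\hat z)^T:\alpha_i,\beta_i\in\mathbb{R}\}$. $\mathcal B(\hat E)$ is the span of the vectors $(b,0,0)^T$ with $b\in\{\hat y,\hat z,\hat x\hat y,\hat x\hat z,\hat y\hat z,\hat x\hat y\hat z\}$, $(0,b,0)^T$ with $b\in\{\hat x,\hat z,\hat x\hat y,\hat x\hat z,\hat y\hat z,\hat x\hat y\hat z\}$, and $(0,0,b)^T$ with $b\in\{\hat x,\hat y,\hat x\hat y,\hat x\hat z,\hat y\hat z,\hat x\hat y\hat z\}$. Then $\mathcal{ERT}_0(\hat E)=\mathcal{RT}_0(\hat E)+\operatorname{curl}(\hat{\mathbf x}\times\mathcal B(\hat E))$, where $\hat{\mathbf x}=(\hat x,\hat y,\hat z)^T$ and $\times$ is the cross product. **Discrete spaces.** $\mathbb{X}_h$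 is the set of $\tau\in L^2(\Omega,\mathbb{M})$ with $\operatorname{div}\tau\in L^2(\Omega,\mathbb{R}^3)$, $\tau n=0$ on $\Gamma_N$, such that on each $E$, $\tau^T=\frac1{J_E}DF_E\,\hat\tau^T\circ F_E^{-1}$ for some $\hat\tau$ whose three rows belong to $\mathcal{ERT}_0(\hat E)$ (row-wise Piola transform). $V_h$ is the space of $\mathbb{R}^3$-valued functions constant on each element. $\mathbb{W}_h^0$ is the space of $\mathbb{N}$-valued functions constant on each element. **Vertex quadrature.** $(A\tau,\chi)_Q=\sum_{E\in\mathcal{T}_h}\frac{|E|}{8}\sum_{i=1}^8 A(\mathbf r_i)\tau(\mathbf r_i):\chi(\mathbf r_i)$, where for each $E$ the $\mathbf r_i$ are its vertices and all values are taken from within $E$. *)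

theory Defs
  imports "HOL-Analysis.Analysis"
begin

section \<open>Weak divergence\<close>

definition partial :: "3 \<Rightarrow> (real^3 \<Rightarrow> real) \<Rightarrow> real^3 \<Rightarrow> real" where
  "partial j g x = frechet_derivative g (at x) (axis j 1)"

definition grad :: "(real^3 \<Rightarrow> real) \<Rightarrow> real^3 \<Rightarrow> real^3" where
  "grad g x = (\<chi> j. partial j g x)"

definition curl :: "(real^3 \<Rightarrow> real^3) \<Rightarrow> real^3 \<Rightarrow> real^3" where
  "curl v x = vector
     [partial 2 (\<lambda>y. v y $ 3) x - partial 3 (\<lambda>y. v y $ 2) x,
      partial 3 (\<lambda>y. v y $ 1) x - partial 1 (\<lambda>y. v y $ 3) x,
      partial 1 (\<lambda>y. v y $ 2) x - partial 2 (\<lambda>y. v y $ 1) x]"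

primrec C_k :: "nat \<Rightarrow> (real^3 \<Rightarrow> real) \<Rightarrow> bool" where
  "C_k 0 g \<longleftrightarrow> continuous_on UNIV g"
| "C_k (Suc k) g \<longleftrightarrow> (\<forall>x. g differentiable (at x)) \<and> (\<forall>j. C_k k (partial j g))"

definition test_function :: "(real^3) set \<Rightarrow> (real^3 \<Rightarrow> real) \<Rightarrow> bool" where
  "test_function \<Omega> \<phi> \<longleftrightarrow> (\<forall>k. C_k k \<phi>) \<and>
     compact (closure {x. \<phi> x \<noteq> 0}) \<and> closure {x. \<phi> x \<noteq> 0} \<subseteq> \<Omega>"

text \<open>
  Elements of \<open>L\<^sup>2(\<Omega>)\<close> are represented by functions on the whole space; only their values
  almost everywhere in \<open>\<Omega>\<close> matter.  On \<^typ>\<open>real^3^3\<close> the library's \<open>\<bullet>\<close> and \<open>norm\<close> are the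
  Frobenius product and norm, and \<open>\<tau> x $ i\<close> is the \<open>i\<close>-th row of \<open>\<tau> x\<close>.
\<close>

definition L2_on :: "(real^3) set \<Rightarrow> (real^3 \<Rightarrow> 'b::euclidean_space) \<Rightarrow> bool" where
  "L2_on \<Omega> g \<longleftrightarrow> g \<in> borel_measurable (lebesgue_on \<Omega>) \<and>
     integrable (lebesgue_on \<Omega>) (\<lambda>x. (norm (g x))\<^sup>2)"

definition l2_inner ::
  "(real^3) set \<Rightarrow> (real^3 \<Rightarrow> 'b::euclidean_space) \<Rightarrow> (real^3 \<Rightarrow> 'b) \<Rightarrow> real" where
  "l2_inner \<Omega> g h = (\<integral>x. g x \<bullet> h x \<partial>lebesgue_on \<Omega>)"

text \<open>\<open>g\<close> is the row-wise distributional divergence of \<open>\<tau>\<close> in \<open>\<Omega>\<close>, and is square integrable.\<close>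

definition has_L2_div ::
  "(real^3) set \<Rightarrow> (real^3 \<Rightarrow> real^3^3) \<Rightarrow> (real^3 \<Rightarrow> real^3) \<Rightarrow> bool" where
  "has_L2_div \<Omega> \<tau> g \<longleftrightarrow> L2_on \<Omega> g \<and>
     (\<forall>i \<phi>. test_function \<Omega> \<phi> \<longrightarrow>
        (\<integral>x. g x $ i * \<phi> x \<partial>lebesgue_on \<Omega>) =
        - (\<integral>x. \<tau> x $ i \<bullet> grad \<phi> x \<partial>lebesgue_on \<Omega>))"

text \<open>A representative; it is determined up to a null set.\<close>

definition wdiv :: "(real^3) set \<Rightarrow> (real^3 \<Rightarrow> real^3^3) \<Rightarrow> real^3 \<Rightarrow> real^3" where
  "wdiv \<Omega> \<tau> = (SOME g. has_L2_div \<Omega> \<tau> g)"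


section \<open>Cuboid meshes\<close>

text \<open>The vertices of a cell are numbered from 1 to 8.\<close>

definition rhat :: "nat \<Rightarrow> real^3" where
  "rhat i = [vector [0,0,0], vector [1,0,0], vector [1,1,0], vector [0,1,0],
             vector [0,0,1], vector [1,0,1], vector [1,1,1], vector [0,1,1]] ! (i - 1)"

definition Ehat :: "(real^3) set" where
  "Ehat = {x. \<forall>i. 0 \<le> x $ i \<and> x $ i \<le> 1}"

definition cell_map :: "(nat \<Rightarrow> real^3) \<Rightarrow> real^3 \<Rightarrow> real^3" where
  "cell_map v x = v 1 + x $ 1 *\<^sub>R (v 2 - v 1) + x $ 2 *\<^sub>R (v 4 - v 1) + x $ 3 *\<^sub>R (v 5 - v 1)"

definition cuboid :: "(real^3) set \<Rightarrow> (nat \<Rightarrow> real^3) \<Rightarrow> bool" where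
  "cuboid E v \<longleftrightarrow>
     v 2 \<noteq> v 1 \<and> v 4 \<noteq> v 1 \<and> v 5 \<noteq> v 1 \<and>
     orthogonal (v 2 - v 1) (v 4 - v 1) \<and>
     orthogonal (v 2 - v 1) (v 5 - v 1) \<and>
     orthogonal (v 4 - v 1) (v 5 - v 1) \<and>
     (\<forall>i\<in>{1..8}. v i = cell_map v (rhat i)) \<and>
     E = cell_map v ` Ehat"

text \<open>
  \<open>r E\<close> lists the vertices of the cell \<open>E\<close>.  The constant \<open>\<kappa>\<close> is the shape-regularity constant:
  every cell contains a ball of diameter at least \<open>diameter E / \<kappa>\<close>.  Conformity: two cells meet
  in a common (possibly empty) face, edge or vertex; this includes disjointness of interiors.
\<close>

definition cuboid_mesh ::
  "(real^3) set \<Rightarrow> (real^3) set set \<Rightarrow> ((real^3) set \<Rightarrow> nat \<Rightarrow> real^3) \<Rightarrow> real \<Rightarrow> bool" where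
  "cuboid_mesh \<Omega> T r \<kappa> \<longleftrightarrow>
     finite T \<and> (\<forall>E\<in>T. cuboid E (r E)) \<and>
     \<Union>T = closure \<Omega> \<and>
     (\<forall>E\<in>T. \<forall>E'\<in>T. (E \<inter> E') face_of E \<and> (E \<inter> E') face_of E') \<and>
     (\<forall>E\<in>T. \<exists>c \<rho>. 0 < \<rho> \<and> cball c \<rho> \<subseteq> E \<and> diameter E \<le> \<kappa> * (2 * \<rho>))"

definition mesh_faces :: "(real^3) set set \<Rightarrow> (real^3) set set" where
  "mesh_faces T = {e. \<exists>E\<in>T. e facet_of E}"

text \<open>
  The two boundary parts are unions of closed element faces and share no face (they may meet
  along edges).
\<close>

definition boundary_partition ::
  "(real^3) set \<Rightarrow> (real^3) set set \<Rightarrow> (real^3) set \<Rightarrow> (real^3) set \<Rightarrow> bool" where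
  "boundary_partition \<Omega> T \<Gamma>D \<Gamma>N \<longleftrightarrow>
     frontier \<Omega> = \<Gamma>D \<union> \<Gamma>N \<and>
     (\<exists>FD FN. FD \<subseteq> mesh_faces T \<and> FN \<subseteq> mesh_faces T \<and> FD \<inter> FN = {} \<and>
        \<Gamma>D = \<Union>FD \<and> \<Gamma>N = \<Union>FN)"

text \<open>The value at a point of the closed cell \<open>E\<close>, taken from within \<open>E\<close>.\<close>

definition trace_from :: "(real^3) set \<Rightarrow> (real^3 \<Rightarrow> 'b::t2_space) \<Rightarrow> real^3 \<Rightarrow> 'b" where
  "trace_from E g x = Lim (at x within interior E) g"

definition outward_unit_normal :: "(real^3) set \<Rightarrow> (real^3) set \<Rightarrow> real^3 \<Rightarrow> bool" where
  "outward_unit_normal E e n \<longleftrightarrow> norm n = 1 \<and> (\<forall>x\<in>e. \<forall>y\<in>E. n \<bullet> (y - x) \<le> 0)"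

definition compliance ::
  "(real^3) set \<Rightarrow> (real^3) set set \<Rightarrow> (real^3 \<Rightarrow> (real^3^3) \<Rightarrow>\<^sub>L (real^3^3)) \<Rightarrow> bool" where
  "compliance \<Omega> T A \<longleftrightarrow>
     (\<forall>x\<in>\<Omega>. \<forall>\<tau> \<eta>. blinfun_apply (A x) \<tau> \<bullet> \<eta> = \<tau> \<bullet> blinfun_apply (A x) \<eta>) \<and>
     bounded (A ` \<Omega>) \<and>
     (\<exists>c>0. \<forall>x\<in>\<Omega>. \<forall>\<tau>. c * (norm \<tau>)\<^sup>2 \<le> blinfun_apply (A x) \<tau> \<bullet> \<tau>) \<and>
     (\<forall>E\<in>T. \<exists>g. continuous_on E g \<and> (\<forall>x\<in>interior E. g x = A x))"


section \<open>The discrete spaces\<close>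

definition RT0 :: "(real^3 \<Rightarrow> real^3) set" where
  "RT0 = {(\<lambda>x. vector [a 1 + b 1 * x $ 1, a 2 + b 2 * x $ 2, a 3 + b 3 * x $ 3]) 
    | (a :: nat \<Rightarrow> real) (b :: nat \<Rightarrow> real). True}"

definition Bhat :: "(real^3 \<Rightarrow> real^3) set" where
  "Bhat = {(\<lambda>x. vector
     [a 1 * x $ 2 + a 2 * x $ 3 + a 3 * (x $ 1 * x $ 2) + a 4 * (x $ 1 * x $ 3)
        + a 5 * (x $ 2 * x $ 3) + a 6 * (x $ 1 * x $ 2 * x $ 3),
      b 1 * x $ 1 + b 2 * x $ 3 + b 3 * (x $ 1 * x $ 2) + b 4 * (x $ 1 * x $ 3)
        + b 5 * (x $ 2 * x $ 3) + b 6 * (x $ 1 * x $ 2 * x $ 3),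
      c 1 * x $ 1 + c 2 * x $ 2 + c 3 * (x $ 1 * x $ 2) + c 4 * (x $ 1 * x $ 3)
        + c 5 * (x $ 2 * x $ 3) + c 6 * (x $ 1 * x $ 2 * x $ 3)]) 
    | (a :: nat \<Rightarrow> real) (b :: nat \<Rightarrow> real) (c :: nat \<Rightarrow> real). True}"

definition ERT0 :: "(real^3 \<Rightarrow> real^3) set" where
  "ERT0 = {(\<lambda>x. p x + curl (\<lambda>y. cross3 y (q y)) x) | p q. p \<in> RT0 \<and> q \<in> Bhat}"

text \<open>\<open>\<tau>\<close> is, at the point \<open>x\<close>, the row-wise Piola transform of \<open>\<tau>h\<close> under \<open>F\<close>.\<close>

definition piola_at ::
  "(real^3 \<Rightarrow> real^3) \<Rightarrow> (real^3 \<Rightarrow> real^3^3) \<Rightarrow> (real^3 \<Rightarrow> real^3^3) \<Rightarrow> real^3 \<Rightarrow> bool" where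
  "piola_at F \<tau>h \<tau> x \<longleftrightarrow>
     (let xh = inv F x; DF = jacobian F (at xh) in
        transpose (\<tau> x) = (1 / \<bar>det DF\<bar>) *\<^sub>R (DF ** transpose (\<tau>h xh)))"

text \<open>
  Elementwise conditions are imposed on the interior of each cell, so that the fields may jump
  across faces; the values on the mesh skeleton, a null set, are irrelevant.
\<close>

definition Xh ::
  "(real^3) set \<Rightarrow> (real^3) set set \<Rightarrow> ((real^3) set \<Rightarrow> nat \<Rightarrow> real^3) \<Rightarrow> (real^3) set
     \<Rightarrow> (real^3 \<Rightarrow> real^3^3) set" where
  "Xh \<Omega> T r \<Gamma>N = {\<tau>.
     L2_on \<Omega> \<tau> \<and> (\<exists>g. has_L2_div \<Omega> \<tau> g) \<and>
     (\<forall>E\<in>T. \<exists>\<tau>h. (\<forall>i. (\<lambda>x. \<tau>h x $ i) \<in> ERT0) \<and>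
        (\<forall>x\<in>interior E. piola_at (cell_map (r E)) \<tau>h \<tau> x)) \<and>
     (\<forall>E\<in>T. \<forall>e n. e facet_of E \<and> e \<subseteq> \<Gamma>N \<and> outward_unit_normal E e n \<longrightarrow>
        (\<forall>x\<in>e. trace_from E \<tau> x *v n = 0))}"

definition Vh :: "(real^3) set set \<Rightarrow> (real^3 \<Rightarrow> real^3) set" where
  "Vh T = {v. \<forall>E\<in>T. v constant_on interior E}"

definition Wh0 :: "(real^3) set set \<Rightarrow> (real^3 \<Rightarrow> real^3^3) set" where
  "Wh0 T = {w. \<forall>E\<in>T. w constant_on interior E \<and> (\<forall>x\<in>interior E. transpose (w x) = - w x)}"

definition quad_inner ::
  "(real^3) set set \<Rightarrow> ((real^3) set \<Rightarrow> nat \<Rightarrow> real^3) \<Rightarrow>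
   (real^3 \<Rightarrow> (real^3^3) \<Rightarrow>\<^sub>L (real^3^3)) \<Rightarrow> (real^3 \<Rightarrow> real^3^3) \<Rightarrow> (real^3 \<Rightarrow> real^3^3) \<Rightarrow> real" where
  "quad_inner T r A \<tau> \<eta> =
     (\<Sum>E\<in>T. measure lebesgue E / 8 *
        (\<Sum>i = 1..8. blinfun_apply (trace_from E A (r E i)) (trace_from E \<tau> (r E i))
                      \<bullet> trace_from E \<eta> (r E i)))"

definition msmfe0_solution ::
  "(real^3) set \<Rightarrow> (real^3) set set \<Rightarrow> ((real^3) set \<Rightarrow> nat \<Rightarrow> real^3) \<Rightarrow> (real^3) set \<Rightarrow>
   (real^3 \<Rightarrow> (real^3^3) \<Rightarrow>\<^sub>L (real^3^3)) \<Rightarrow> (real^3 \<Rightarrow> real^3) \<Rightarrow>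
   (real^3 \<Rightarrow> real^3^3) \<Rightarrow> (real^3 \<Rightarrow> real^3) \<Rightarrow> (real^3 \<Rightarrow> real^3^3) \<Rightarrow> bool" where
  "msmfe0_solution \<Omega> T r \<Gamma>N A f \<sigma> u \<gamma> \<longleftrightarrow>
     \<sigma> \<in> Xh \<Omega> T r \<Gamma>N \<and> u \<in> Vh T \<and> \<gamma> \<in> Wh0 T \<and>
     (\<forall>\<tau>\<in>Xh \<Omega> T r \<Gamma>N.
        quad_inner T r A \<sigma> \<tau> + l2_inner \<Omega> u (wdiv \<Omega> \<tau>) + l2_inner \<Omega> \<gamma> \<tau> = 0) \<and>
     (\<forall>v\<in>Vh T. l2_inner \<Omega> (wdiv \<Omega> \<sigma>) v = l2_inner \<Omega> f v) \<and>
     (\<forall>w\<in>Wh0 T. l2_inner \<Omega> \<sigma> w = 0)"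

end

theory Submission
  imports Defs "HOL-Computational_Algebra.Polynomial"
begin

text \<open>
  The discrete problem is a square linear system, so uniqueness gives existence.  Testing the
  homogeneous system with \<open>(\<sigma>, -u, -\<gamma>)\<close> leaves the quadrature form of \<open>\<sigma>\<close>, which is definite because
  an \<open>ERT\<^sub>0\<close> field is determined by its vertex values.  It remains to see that
  \<open>(u, div \<tau>) + (\<gamma>, \<tau>) = 0\<close> for all \<open>\<tau>\<close> forces \<open>u = 0\<close> and \<open>\<gamma> = 0\<close>.  On each cell \<open>E\<close> put
  \<open>\<rho>\<^sub>E(x) = u + \<gamma> (x - b\<^sub>E)\<close>, with \<open>b\<^sub>E\<close> the barycentre.  Since \<open>div \<tau>\<close> is constant on \<open>E\<close>, integration by
  parts turns the pairing into the integral of the normal stress against the jumps of the piecewise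
  rigid motion \<open>\<rho>\<close>.  A row of \<open>ERT\<^sub>0\<close> can have any affine normal trace on a single face and
  vanishing normal trace on the others; choosing the jump of \<open>\<rho>\<close> itself shows that \<open>\<rho>\<close> does not jump across interior
  faces and vanishes on the faces of \<open>\<Gamma>\<^sub>D\<close>.  A rigid motion that vanishes on a face is zero, so \<open>\<rho>\<close>
  vanishes in all cells that can be reached from \<open>\<Gamma>\<^sub>D\<close> through faces, which are all cells because
  \<open>\<Omega>\<close> is connected.

  No surface integrals are needed: the integral of a function over a face is represented by the volume integral over an
  adjacent cell of its constant extension in the normal direction, and every identity reduces to the
  fact that a compactly supported function that is Lipschitz continuous in one direction has a
  derivative of mean zero in that direction.
\<close>

text \<open>The trial space consists of functions on the whole space whose values on the mesh
  skeleton are arbitrary, so as a set of functions it is not finite-dimensional. Solvability is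
  therefore phrased through finitely many coordinate functionals: vertex traces of the stress and
  cell-centre values of the two multipliers. A triple with vanishing coordinates is zero on all cell
  interiors, which is why uniqueness holds almost everywhere. The barycentre makes \<gamma> (x - b)
  a function of mean zero, so replacing u by \<rho> does not change the pairing with a divergence
  that is constant on the cell. Affine normal traces suffice because the components of a rigid
  motion are affine on a face, and hence the jump itself is an admissible datum. Skew symmetry is
  essential when \<rho> is recovered from one face: a general matrix that annihilates the tangential
  directions may still act on the normal one. The volume representation of a face integral carries
  the thickness of the cell as a factor; this is the origin of the ratio \<mu> between two
  neighbouring cells.\<close>

section \<open>Solvability of finite-dimensional variational problems\<close>

text \<open>Gaussian elimination, by induction on the equations: an equation with a nonzero
  coefficient at \<open>p\<close> is solved for the unknown \<open>p\<close>, which removes one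
  equation and one unknown and keeps the strict inequality between their numbers.\<close>

lemma underdetermined_nontrivial:
  fixes M :: "'k \<Rightarrow> 'l \<Rightarrow> real"
  assumes "finite K" "finite L" "card K < card L"
  shows "\<exists>x. (\<exists>l\<in>L. x l \<noteq> 0) \<and> (\<forall>k\<in>K. (\<Sum>l\<in>L. M k l * x l) = 0)"
  using assms
proof (induction K arbitrary: L M rule: finite_induct)
  case empty
  then obtain l where "l \<in> L" by (metis card.empty card_gt_0_iff ex_in_conv)
  then show ?case by (intro exI[of _ "\<lambda>_. 1"]) auto
next
  case (insert k K)
  show ?case
  proof (cases "\<forall>l\<in>L. M k l = 0")
    case True
    from insert.IH[of L M] insert.prems insert.hyps
    obtain x where "\<exists>l\<in>L. x l \<noteq> 0" "\<forall>k\<in>K. (\<Sum>l\<in>L. M k l * x l) = 0" by auto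
    with True show ?thesis by (intro exI[of _ x]) auto
  next
    case False
    then obtain p where p: "p \<in> L" "M k p \<noteq> 0" by auto
    \<comment> \<open>The system after subtracting the multiple of row \<open>k\<close> that clears
      column \<open>p\<close>; the vector \<open>y\<close> below recovers the eliminated unknown by
      back substitution.\<close>
    define M' where "M' = (\<lambda>q l. M q l - M q p * M k l / M k p)"
    have "card K < card (L - {p})" using insert p by simp
    from insert.IH[OF _ this, of M'] insert.prems
    obtain x where x: "\<exists>l\<in>L-{p}. x l \<noteq> 0" "\<And>q. q \<in> K \<Longrightarrow> (\<Sum>l\<in>L-{p}. M' q l * x l) = 0"
      by auto
    define y where "y = x(p := - (\<Sum>l\<in>L-{p}. M k l * x l) / M k p)"
    have sum_y: "(\<Sum>l\<in>L. M q l * y l) = M q p * y p + (\<Sum>l\<in>L-{p}. M q l * x l)" for q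
      using p insert.prems by (subst sum.remove[of _ p]) (auto simp: y_def intro!: sum.cong)
    have "(\<Sum>l\<in>L. M q l * y l) = 0" if "q \<in> K" for q
    proof -
      have "(\<Sum>l\<in>L-{p}. M q l * x l) - M q p / M k p * (\<Sum>l\<in>L-{p}. M k l * x l) = 0"
        using x(2)[OF that] by (simp add: M'_def left_diff_distrib sum_subtractf sum_distrib_left algebra_simps)
      then show ?thesis unfolding sum_y by (simp add: y_def algebra_simps)
    qed
    moreover have "(\<Sum>l\<in>L. M k l * y l) = 0"
      unfolding sum_y using p by (simp add: y_def)
    moreover have "\<exists>l\<in>L. y l \<noteq> 0" using x(1) by (auto simp: y_def)
    ultimately show ?thesis by (intro exI[of _ y]) auto
  qed
qed

text \<open>Extracts a basis of a family of functions that is inspected on a finite set only. Adding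
  the index \<open>i\<close> adds at most one vector: the functions vanishing at \<open>i\<close>
  have a basis by induction, and one \<open>p\<close> with \<open>p i \<noteq> 0\<close> reduces
  every other function to them.\<close>

lemma coordinate_basis_exists:
  fixes S :: "('j \<Rightarrow> real) set"
  assumes "finite J" "\<And>s t a. s \<in> S \<Longrightarrow> t \<in> S \<Longrightarrow> (\<lambda>j. s j + a * t j) \<in> S"
  shows "\<exists>(n::nat) b. (\<forall>k<n. b k \<in> S) \<and>
    (\<forall>s\<in>S. \<exists>x. \<forall>j\<in>J. s j = (\<Sum>k<n. x k * b k j)) \<and>
    (\<forall>x. (\<forall>j\<in>J. (\<Sum>k<n. x k * b k j) = 0) \<longrightarrow> (\<forall>k<n. x k = 0))"
  using assms
proof (induction J arbitrary: S rule: finite_induct)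
  case empty
  then show ?case by (intro exI[of _ 0]) auto
next
  case (insert i J)
  define S0 where "S0 = {s \<in> S. s i = 0}"
  have cl: "(\<lambda>j. s j + a * t j) \<in> S0" if "s \<in> S0" "t \<in> S0" for s t a
    using that insert.prems by (auto simp: S0_def)
  from insert.IH[of S0, OF cl] obtain n :: nat and b where b:
    "\<forall>k<n. b k \<in> S0"
    "\<forall>s\<in>S0. \<exists>x. \<forall>j\<in>J. s j = (\<Sum>k<n. x k * b k j)"
    "\<forall>x. (\<forall>j\<in>J. (\<Sum>k<n. x k * b k j) = 0) \<longrightarrow> (\<forall>k<n. x k = 0)"
    by blast
  have b0: "b k i = 0" if "k < n" for k using b(1) that by (auto simp: S0_def)
  show ?case
  proof (cases "\<forall>s\<in>S. s i = 0")
    case True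
    then have "S0 = S" by (auto simp: S0_def)
    have "\<exists>x. \<forall>j\<in>insert i J. s j = (\<Sum>k<n. x k * b k j)" if s: "s \<in> S" for s
    proof -
      obtain x where "\<forall>j\<in>J. s j = (\<Sum>k<n. x k * b k j)" using b(2) s \<open>S0 = S\<close> by blast
      then show ?thesis using True s b0 by (intro exI[of _ x]) auto
    qed
    then show ?thesis using b(1,3) \<open>S0 = S\<close> by (intro exI[of _ n] exI[of _ b]) auto
  next
    case False
    then obtain p where p: "p \<in> S" "p i \<noteq> 0" by auto
    define c where "c = b(n := p)"
    have sum_c: "(\<Sum>k<Suc n. x k * c k j) = (\<Sum>k<n. x k * b k j) + x n * p j" for x j
      by (simp add: c_def)
    have "\<forall>k<Suc n. c k \<in> S" using b(1) p by (auto simp: c_def S0_def less_Suc_eq)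
    moreover have "\<exists>x. \<forall>j\<in>insert i J. s j = (\<Sum>k<Suc n. x k * c k j)" if "s \<in> S" for s
    proof -
      define a where "a = s i / p i"
      have "(\<lambda>j. s j + (-a) * p j) \<in> S0"
        using insert.prems[OF that p(1), of "-a"] p(2) by (auto simp: S0_def a_def)
      then obtain x where x: "\<forall>j\<in>J. s j + (-a) * p j = (\<Sum>k<n. x k * b k j)"
        using bspec[OF b(2)] by blast
      have e: "(\<Sum>k<n. (x(n:=a)) k * b k j) = (\<Sum>k<n. x k * b k j)" for j
        by (intro sum.cong) auto
      have "s j = (\<Sum>k<Suc n. (x(n:=a)) k * c k j)" if "j \<in> insert i J" for j
        using that x p b0 unfolding sum_c e by (auto simp: a_def algebra_simps)
      then show ?thesis by blast
    qed
    moreover have "\<forall>k<Suc n. x k = 0"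
      if "\<forall>j\<in>insert i J. (\<Sum>k<Suc n. x k * c k j) = 0" for x
    proof -
      have "(\<Sum>k<n. x k * b k i) + x n * p i = 0" using that unfolding sum_c by blast
      then have "x n = 0" using b0 p(2) by simp
      then have "\<forall>j\<in>J. (\<Sum>k<n. x k * b k j) = 0" using that unfolding sum_c by simp
      then show ?thesis using b(3) \<open>x n = 0\<close> by (auto simp: less_Suc_eq)
    qed
    ultimately show ?thesis by (intro exI[of _ "Suc n"] exI[of _ c]) auto
  qed
qed

text \<open>Uniqueness implies existence, for objects that are equal only up to their coordinates
  \<open>c\<close>. Here \<open>comb z a y\<close> stands for z + a y, \<open>nondeg\<close> is
  uniqueness, and \<open>null\<close> allows a test object to be replaced by any other one with the
  same coordinates.\<close>

lemma nondegenerate_form_solvable: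
  fixes comb :: "'z \<Rightarrow> real \<Rightarrow> 'z \<Rightarrow> 'z" and c :: "'j \<Rightarrow> 'z \<Rightarrow> real"
    and B :: "'z \<Rightarrow> 'z \<Rightarrow> real" and l :: "'z \<Rightarrow> real"
  assumes J: "finite J" and ne: "Z \<noteq> {}"
    and cl: "\<And>z y a. z \<in> Z \<Longrightarrow> y \<in> Z \<Longrightarrow> comb z a y \<in> Z"
    and c: "\<And>j z y a. j \<in> J \<Longrightarrow> z \<in> Z \<Longrightarrow> y \<in> Z \<Longrightarrow> c j (comb z a y) = c j z + a * c j y"
    and B1: "\<And>w z y a. w \<in> Z \<Longrightarrow> z \<in> Z \<Longrightarrow> y \<in> Z \<Longrightarrow> B (comb z a y) w = B z w + a * B y w"
    and B2: "\<And>w z y a. w \<in> Z \<Longrightarrow> z \<in> Z \<Longrightarrow> y \<in> Z \<Longrightarrow> B w (comb z a y) = B w z + a * B w y"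
    and l: "\<And>z y a. z \<in> Z \<Longrightarrow> y \<in> Z \<Longrightarrow> l (comb z a y) = l z + a * l y"
    and nondeg: "\<And>z. z \<in> Z \<Longrightarrow> (\<And>y. y \<in> Z \<Longrightarrow> B z y = 0) \<Longrightarrow> \<forall>j\<in>J. c j z = 0"
    and null: "\<And>y. y \<in> Z \<Longrightarrow> \<forall>j\<in>J. c j y = 0 \<Longrightarrow> (\<forall>z\<in>Z. B z y = 0) \<and> l y = 0"
  shows "\<exists>z\<in>Z. \<forall>y\<in>Z. B z y = l y"
proof -
  let ?S = "(\<lambda>z j. if j \<in> J then c j z else 0) ` Z"
  have "(\<lambda>j. s j + a * t j) \<in> ?S" if st: "s \<in> ?S" "t \<in> ?S" for s t a
  proof -
    from st obtain z y where zy: "z \<in> Z" "y \<in> Z"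
      and e: "s = (\<lambda>j. if j \<in> J then c j z else 0)" "t = (\<lambda>j. if j \<in> J then c j y else 0)" by auto
    have "(\<lambda>j. s j + a * t j) = (\<lambda>j. if j \<in> J then c j (comb z a y) else 0)"
      unfolding e using c zy by auto
    then show ?thesis using cl zy by blast
  qed
  from coordinate_basis_exists[of J ?S, OF J this]
  obtain n :: nat and b' where b':
    "\<forall>k<n. b' k \<in> ?S"
    "\<forall>s\<in>?S. \<exists>x. \<forall>j\<in>J. s j = (\<Sum>k<n. x k * b' k j)"
    "\<forall>x. (\<forall>j\<in>J. (\<Sum>k<n. x k * b' k j) = 0) \<longrightarrow> (\<forall>k<n. x k = 0)"
    by blast
  have "\<forall>k. \<exists>z. k < n \<longrightarrow> z \<in> Z \<and> (\<forall>j\<in>J. b' k j = c j z)" using b'(1) by force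
  then obtain b where b: "\<And>k. k < n \<Longrightarrow> b k \<in> Z" "\<And>k j. k < n \<Longrightarrow> j \<in> J \<Longrightarrow> b' k j = c j (b k)"
    by metis
  obtain z0 where z0: "z0 \<in> Z" using ne by auto
  \<comment> \<open>Linear combinations are built by iterating \<open>comb\<close>. The start value
    z0 - z0 serves as zero: coordinates, form and load vanish on it by linearity.\<close>
  define lc where "lc x m = rec_nat (comb z0 (-1) z0) (\<lambda>k z. comb z (x k) (b k)) m" for x m
  have lc0: "lc x 0 = comb z0 (-1) z0" and lcS: "lc x (Suc m) = comb (lc x m) (x m) (b m)" for x m
    by (auto simp: lc_def)
  have lcZ: "lc x m \<in> Z" if "m \<le> n" for x m
    using that by (induction m) (auto simp: lc0 lcS z0 b(1) intro!: cl)
  have lc_c: "c j (lc x m) = (\<Sum>k<m. x k * c j (b k))" if "m \<le> n" "j \<in> J" for x m j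
    using that by (induction m) (auto simp: lc0 lcS c z0 b(1) lcZ)
  have lc_B1: "B (lc x m) w = (\<Sum>k<m. x k * B (b k) w)" if "m \<le> n" "w \<in> Z" for x m w
    using that by (induction m) (auto simp: lc0 lcS B1 z0 b(1) lcZ)
  have lc_B2: "B w (lc x m) = (\<Sum>k<m. x k * B w (b k))" if "m \<le> n" "w \<in> Z" for x m w
    using that by (induction m) (auto simp: lc0 lcS B2 z0 b(1) lcZ)
  have lc_l: "l (lc x m) = (\<Sum>k<m. x k * l (b k))" if "m \<le> n" for x m
    using that by (induction m) (auto simp: lc0 lcS l z0 b(1) lcZ)
  have span: "\<exists>x. (\<forall>z\<in>Z. B z y = (\<Sum>k<n. x k * B z (b k))) \<and> l y = (\<Sum>k<n. x k * l (b k))"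
    if y: "y \<in> Z" for y
  proof -
    obtain x where x: "\<forall>j\<in>J. c j y = (\<Sum>k<n. x k * b' k j)" using b'(2) y by force
    let ?d = "comb y (-1) (lc x n)"
    have d: "?d \<in> Z" by (intro cl y lcZ) simp
    have "\<forall>j\<in>J. c j ?d = 0" using x y lcZ b(2) by (simp add: c lc_c)
    from null[OF d this] have "\<And>z. z \<in> Z \<Longrightarrow> B z y = B z (lc x n)" "l y = l (lc x n)"
      using y lcZ by (simp_all add: B2 l)
    then show ?thesis by (intro exI[of _ x]) (simp add: lc_B2 lc_l)
  qed
  \<comment> \<open>The load is appended as a last column, which gives \<open>n\<close> equations in
    \<open>n\<close> + 1 unknowns. In a nontrivial solution the coefficient of the load is nonzero,
    for otherwise nondegeneracy would make all coefficients vanish; dividing by its negative yields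
    the solution.\<close>
  define M where "M k i = (if i < n then B (b i) (b k) else l (b k))" for k i
  obtain x where x: "\<exists>i\<in>{..n}. x i \<noteq> 0" "\<forall>k\<in>{..<n}. (\<Sum>i\<le>n. M k i * x i) = 0"
    using underdetermined_nontrivial[of "{..<n}" "{..n}" M] by auto
  have M: "(\<Sum>i<n. x i * B (b i) (b k)) + x n * l (b k) = 0" if "k < n" for k
  proof -
    have "(\<Sum>i\<le>n. M k i * x i) = (\<Sum>i<n. M k i * x i) + M k n * x n"
      by (simp add: lessThan_Suc_atMost[symmetric])
    also have "(\<Sum>i<n. M k i * x i) = (\<Sum>i<n. x i * B (b i) (b k))"
      by (intro sum.cong) (auto simp: M_def)
    finally show ?thesis using x(2) that by (simp add: M_def mult.commute)
  qed
  have xn: "x n \<noteq> 0"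
  proof
    assume n0: "x n = 0"
    let ?z = "lc x n"
    have "B ?z (b k) = 0" if "k < n" for k using M[OF that] n0 b(1) that by (simp add: lc_B1)
    then have "B ?z y = 0" if "y \<in> Z" for y using span[OF that] lcZ by auto
    from nondeg[OF lcZ this] have "\<forall>j\<in>J. (\<Sum>k<n. x k * b' k j) = 0"
      using b(2) by (simp add: lc_c)
    then have "\<forall>k<n. x k = 0" using b'(3) by blast
    with n0 x(1) show False by (auto simp: le_less)
  qed
  let ?z = "lc (\<lambda>k. - x k / x n) n"
  have Bl: "B ?z (b k) = l (b k)" if "k < n" for k
  proof -
    have "B ?z (b k) = (\<Sum>i<n. - x i / x n * B (b i) (b k))" using b(1) that by (simp add: lc_B1)
    also have "\<dots> = - (\<Sum>i<n. x i * B (b i) (b k)) / x n"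
      by (simp add: sum_divide_distrib sum_negf)
    also have "\<dots> = l (b k)" using M[OF that] xn by (simp add: field_simps eq_neg_iff_add_eq_0)
    finally show ?thesis .
  qed
  have "B ?z y = l y" if y: "y \<in> Z" for y
  proof -
    obtain t where t: "\<forall>z\<in>Z. B z y = (\<Sum>k<n. t k * B z (b k))" "l y = (\<Sum>k<n. t k * l (b k))"
      using span[OF y] by blast
    have "B ?z y = (\<Sum>k<n. t k * B ?z (b k))" using t(1) lcZ by blast
    also have "\<dots> = l y" unfolding t(2) by (intro sum.cong refl) (simp only: lessThan_iff Bl)
    finally show ?thesis .
  qed
  then show ?thesis using lcZ by blast
qed

section \<open>Geometry of cuboid cells\<close>

definition edge :: "(nat \<Rightarrow> real^3) \<Rightarrow> 3 \<Rightarrow> real^3" where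
  "edge v k = (if k = 1 then v 2 - v 1 else if k = 2 then v 4 - v 1 else v 5 - v 1)"

text \<open>The k-th reference coordinate: since the edges of a cuboid are orthogonal, the inverse
  of the cell map is a projection onto each edge (\<open>inv_cell_map\<close>).\<close>

definition loc :: "(nat \<Rightarrow> real^3) \<Rightarrow> 3 \<Rightarrow> real^3 \<Rightarrow> real" where
  "loc v k x = (x - v 1) \<bullet> edge v k / (edge v k \<bullet> edge v k)"

lemma edge_simps: "edge v 1 = v 2 - v 1" "edge v 2 = v 4 - v 1" "edge v 3 = v 5 - v 1"
  by (simp_all add: edge_def)

lemma cell_map_eq: "cell_map v x = v 1 + (\<Sum>k\<in>UNIV. x $ k *\<^sub>R edge v k)"
  unfolding cell_map_def sum_3 edge_simps by (simp only: add.assoc)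

lemma cuboidD:
  assumes "cuboid E v"
  shows "v 2 \<noteq> v 1" "v 4 \<noteq> v 1" "v 5 \<noteq> v 1"
    "(v 2 - v 1) \<bullet> (v 4 - v 1) = 0" "(v 2 - v 1) \<bullet> (v 5 - v 1) = 0" "(v 4 - v 1) \<bullet> (v 5 - v 1) = 0"
    "i \<in> {1..8} \<Longrightarrow> v i = cell_map v (rhat i)" "E = cell_map v ` Ehat"
proof -
  note c = assms[unfolded cuboid_def orthogonal_def]
  show "v 2 \<noteq> v 1" by (rule c[THEN conjunct1])
  show "v 4 \<noteq> v 1" by (rule c[THEN conjunct2, THEN conjunct1])
  show "v 5 \<noteq> v 1" by (rule c[THEN conjunct2, THEN conjunct2, THEN conjunct1])
  show "(v 2 - v 1) \<bullet> (v 4 - v 1) = 0" by (rule c[THEN conjunct2, THEN conjunct2, THEN conjunct2, THEN conjunct1])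
  show "(v 2 - v 1) \<bullet> (v 5 - v 1) = 0" by (rule c[THEN conjunct2, THEN conjunct2, THEN conjunct2, THEN conjunct2, THEN conjunct1])
  show "(v 4 - v 1) \<bullet> (v 5 - v 1) = 0" by (rule c[THEN conjunct2, THEN conjunct2, THEN conjunct2, THEN conjunct2, THEN conjunct2, THEN conjunct1])
  show "v i = cell_map v (rhat i)" if "i \<in> {1..8}" by (rule c[THEN conjunct2, THEN conjunct2, THEN conjunct2, THEN conjunct2, THEN conjunct2, THEN conjunct2, THEN conjunct1, THEN bspec, OF that])
  show "E = cell_map v ` Ehat" by (rule c[THEN conjunct2, THEN conjunct2, THEN conjunct2, THEN conjunct2, THEN conjunct2, THEN conjunct2, THEN conjunct2])
qed

lemma edge_orthogonal:
  assumes "cuboid E v" "j \<noteq> k" shows "edge v j \<bullet> edge v k = 0"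
proof -
  have "edge v 1 \<bullet> edge v 2 = 0" "edge v 1 \<bullet> edge v 3 = 0" "edge v 2 \<bullet> edge v 3 = 0"
    using cuboidD(4-6)[OF assms(1)] by (simp_all add: edge_def)
  then have "edge v 2 \<bullet> edge v 1 = 0" "edge v 3 \<bullet> edge v 1 = 0" "edge v 3 \<bullet> edge v 2 = 0"
    by (simp_all add: inner_commute)
  with \<open>edge v 1 \<bullet> edge v 2 = 0\<close> \<open>edge v 1 \<bullet> edge v 3 = 0\<close> \<open>edge v 2 \<bullet> edge v 3 = 0\<close>
  show ?thesis using assms(2) exhaust_3[of j] exhaust_3[of k] by (elim disjE) simp_all
qed

lemma edge_nonzero: "cuboid E v \<Longrightarrow> edge v k \<noteq> 0"
  using cuboidD(1-3)[of E v] by (simp add: edge_def)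

lemma edge_inner_pos: "cuboid E v \<Longrightarrow> edge v k \<bullet> edge v k > 0"
  using edge_nonzero by auto

lemma loc_add_edge:
  assumes "cuboid E v"
  shows "loc v j (x + t *\<^sub>R edge v k) = loc v j x + (if j = k then t else 0)"
proof -
  have "loc v j (x + t *\<^sub>R edge v k) = loc v j x + t * (edge v k \<bullet> edge v j) / (edge v j \<bullet> edge v j)"
    unfolding loc_def by (simp add: inner_diff_left inner_add_left diff_divide_distrib add_divide_distrib)
  then show ?thesis
    using edge_orthogonal[OF assms, of k j] edge_inner_pos[OF assms, of j] by auto
qed

lemma loc_cell_map:
  assumes "cuboid E v" shows "loc v k (cell_map v x) = x $ k"
proof -
  have "(\<Sum>i\<in>UNIV. x $ i *\<^sub>R edge v i) \<bullet> edge v k = (\<Sum>i\<in>UNIV. if i = k then x $ k * (edge v k \<bullet> edge v k) else 0)"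
    unfolding inner_sum_left using edge_orthogonal[OF assms] by (intro sum.cong) auto
  also have "\<dots> = x $ k * (edge v k \<bullet> edge v k)" by simp
  finally have "(cell_map v x - v 1) \<bullet> edge v k = x $ k * (edge v k \<bullet> edge v k)"
    unfolding cell_map_eq by simp
  then show ?thesis using edge_inner_pos[OF assms, of k]
    unfolding loc_def by simp
qed

text \<open>Three nonzero orthogonal vectors span the space, so inner products with the edges detect
  every vector.\<close>

lemma orthogonal_to_edges_zero:
  assumes "cuboid E v" "\<And>k. w \<bullet> edge v k = 0" shows "w = 0"
proof -
  have inj: "inj (edge v)"
  proof (rule injI)
    fix j k assume "edge v j = edge v k"
    then show "j = k" using edge_orthogonal[OF assms(1), of j k] edge_nonzero[OF assms(1), of k] by auto
  qed
  have "pairwise orthogonal (range (edge v))"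
    unfolding pairwise_def orthogonal_def using edge_orthogonal[OF assms(1)] by (metis rangeE)
  then have "independent (range (edge v))"
    using edge_nonzero[OF assms(1)] by (intro pairwise_orthogonal_independent) auto
  moreover have "card (range (edge v)) = DIM(real^3)" using inj by (simp add: card_image)
  ultimately have "span (range (edge v)) = UNIV"
    using card_eq_dim[of "range (edge v)" UNIV] by (auto simp: dim_UNIV)
  then have "w \<in> span (range (edge v))" by simp
  moreover have "\<And>x. x \<in> range (edge v) \<Longrightarrow> orthogonal w x" using assms(2) by (auto simp: orthogonal_def)
  ultimately have "orthogonal w w" using orthogonal_to_span by blast
  then show ?thesis by (simp add: orthogonal_def)
qed

lemma edge_expansion:
  assumes "cuboid E v"
  shows "x = v 1 + (\<Sum>k\<in>UNIV. loc v k x *\<^sub>R edge v k)"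
proof -
  let ?y = "cell_map v (\<chi> k. loc v k x)"
  have "(x - ?y) \<bullet> edge v k = 0" for k
  proof -
    have "loc v k ?y = loc v k x" by (simp add: loc_cell_map[OF assms])
    then show ?thesis using edge_nonzero[OF assms, of k]
      by (simp add: loc_def inner_diff_left)
  qed
  then have "x - ?y = 0" using orthogonal_to_edges_zero[OF assms] by blast
  then show ?thesis by (simp add: cell_map_eq)
qed

lemma cell_map_loc: "cuboid E v \<Longrightarrow> cell_map v (\<chi> k. loc v k x) = x"
  using edge_expansion[of E v x] by (simp add: cell_map_eq)

lemma bij_cell_map: "cuboid E v \<Longrightarrow> bij (cell_map v)"
  by (rule o_bij[of "\<lambda>x. \<chi> k. loc v k x"]) (auto simp: fun_eq_iff loc_cell_map cell_map_loc vec_eq_iff)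

lemma inv_cell_map: "cuboid E v \<Longrightarrow> inv (cell_map v) x = (\<chi> k. loc v k x)"
  by (intro inv_f_eq) (simp_all add: bij_is_inj bij_cell_map cell_map_loc)

lemma cuboid_eq: "cuboid E v \<Longrightarrow> E = {x. \<forall>k. 0 \<le> loc v k x \<and> loc v k x \<le> 1}"
proof (intro set_eqI iffI)
  fix x assume c: "cuboid E v"
  then have E: "E = cell_map v ` Ehat" by (rule cuboidD(8))
  show "x \<in> {x. \<forall>k. 0 \<le> loc v k x \<and> loc v k x \<le> 1}" if "x \<in> E"
    using that unfolding E by (auto simp: loc_cell_map[OF c] Ehat_def)
  show "x \<in> E" if "x \<in> {x. \<forall>k. 0 \<le> loc v k x \<and> loc v k x \<le> 1}"
    unfolding E using that
    by (intro image_eqI[where x = "\<chi> k. loc v k x"]) (auto simp: Ehat_def cell_map_loc[OF c])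
qed

lemma mem_cuboid_iff: "cuboid E v \<Longrightarrow> x \<in> E \<longleftrightarrow> (\<forall>k. 0 \<le> loc v k x \<and> loc v k x \<le> 1)"
  using cuboid_eq[of E v] by auto

lemma continuous_loc [continuous_intros]:
  "continuous_on S g \<Longrightarrow> continuous_on S (\<lambda>x. loc v k (g x))"
  unfolding loc_def by (cases "edge v k = 0") (auto intro!: continuous_intros)

text \<open>From an interior point one can move a little in both directions along each edge. Such a
  move changes a single reference coordinate, so no coordinate can be 0 or 1.\<close>

lemma interior_cuboid:
  assumes "cuboid E v" shows "interior E = {x. \<forall>k. 0 < loc v k x \<and> loc v k x < 1}" (is "_ = ?I")
proof
  have "open ?I"
    unfolding forall_3 by (intro open_Collect_conj open_Collect_less continuous_intros)
  then show "?I \<subseteq> interior E"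
    using cuboid_eq[OF assms] by (intro interior_maximal) (auto intro: less_imp_le)
  show "interior E \<subseteq> ?I"
  proof
    fix x assume x: "x \<in> interior E"
    then obtain e where e: "e > 0" "ball x e \<subseteq> E" by (meson mem_interior)
    have "0 < loc v k x \<and> loc v k x < 1" for k
    proof -
      define t where "t = e / (2 * norm (edge v k))"
      have n: "norm (edge v k) > 0" using edge_nonzero[OF assms] by simp
      then have t: "t > 0" using e by (simp add: t_def)
      have "norm (t *\<^sub>R edge v k) < e" using n e by (simp add: t_def field_simps)
      then have "x + t *\<^sub>R edge v k \<in> E" "x + (-t) *\<^sub>R edge v k \<in> E"
        using e by (auto simp: dist_norm subset_iff)
      then have "loc v k (x + t *\<^sub>R edge v k) \<le> 1" "0 \<le> loc v k (x + (-t) *\<^sub>R edge v k)"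
        using cuboid_eq[OF assms] by blast+
      then show ?thesis unfolding loc_add_edge[OF assms] using t by simp
    qed
    then show "x \<in> ?I" by simp
  qed
qed

lemma mem_interior_cuboid_iff: "cuboid E v \<Longrightarrow> x \<in> interior E \<longleftrightarrow> (\<forall>k. 0 < loc v k x \<and> loc v k x < 1)"
  using interior_cuboid[of E v] by auto

lemma cuboid_compact_convex:
  assumes "cuboid E v" shows "compact E" "convex E" "closed E" "bounded E"
proof -
  have E: "E = cell_map v ` Ehat" by (rule cuboidD(8)[OF assms])
  have Eh: "Ehat = cbox 0 1" by (auto simp: Ehat_def mem_box_cart)
  have co: "continuous_on UNIV (cell_map v)" unfolding cell_map_def by (intro continuous_intros)
  show "compact E" unfolding E Eh by (intro compact_continuous_image continuous_on_subset[OF co]) auto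
  then show "closed E" "bounded E" by (simp_all add: compact_imp_closed compact_imp_bounded)
  have lin: "linear (\<lambda>x. \<Sum>k\<in>UNIV. x $ k *\<^sub>R edge v k)"
    by (auto intro!: linearI simp: sum.distrib scaleR_left_distrib scaleR_sum_right)
  have *: "E = (\<lambda>x. v 1 + x) ` (\<lambda>x. \<Sum>k\<in>UNIV. x $ k *\<^sub>R edge v k) ` cbox 0 1"
    unfolding E Eh cell_map_eq image_image ..
  show "convex E" unfolding * by (intro convex_translation convex_linear_image lin convex_box)
qed

lemma cuboid_center: 
  assumes "cuboid E v" shows "cell_map v (\<chi> k. 1/2) \<in> interior E"
  by (simp add: interior_cuboid[OF assms] loc_cell_map[OF assms])

lemma closure_interior_cuboid: "cuboid E v \<Longrightarrow> closure (interior E) = E"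
  using cuboid_compact_convex[of E v] cuboid_center[of E v]
  by (metis closure_closed convex_closure_interior empty_iff)

lemma cuboid_measure_pos:
  assumes "cuboid E v" shows "measure lebesgue E > 0"
proof -
  have "\<not> negligible (interior E)"
    using cuboid_center[OF assms] by (intro open_not_negligible) auto
  then have "\<not> negligible E" using interior_subset negligible_subset by blast
  then show ?thesis
    using lmeasurable_compact[OF cuboid_compact_convex(1)[OF assms]]
    by (simp add: negligible_iff_measure zero_less_measure_iff)
qed

lemma jacobian_cell_map:
  "jacobian (cell_map v) (at x) *v y = (\<Sum>k\<in>UNIV. y $ k *\<^sub>R edge v k)"
proof -
  have lin: "linear (\<lambda>x. \<Sum>k\<in>UNIV. x $ k *\<^sub>R edge v k)"
    by (auto intro!: linearI simp: sum.distrib scaleR_left_distrib scaleR_sum_right)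
  have cm: "cell_map v = (\<lambda>x. v 1 + (\<Sum>k\<in>UNIV. x $ k *\<^sub>R edge v k))"
    by (rule ext) (rule cell_map_eq)
  have "(cell_map v has_derivative (\<lambda>x. \<Sum>k\<in>UNIV. x $ k *\<^sub>R edge v k)) (at x)"
    unfolding cm
    by (rule has_derivative_eq_rhs[OF has_derivative_add[OF has_derivative_const linear_imp_has_derivative[OF lin]]]) simp
  then have "frechet_derivative (cell_map v) (at x) = (\<lambda>x. \<Sum>k\<in>UNIV. x $ k *\<^sub>R edge v k)"
    by (rule frechet_derivative_at[symmetric])
  then show ?thesis unfolding jacobian_def by (simp add: matrix_works lin)
qed

lemma det_jacobian_cell_map:
  assumes "cuboid E v" shows "det (jacobian (cell_map v) (at x)) \<noteq> 0"
proof -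
  have "y = 0" if "jacobian (cell_map v) (at x) *v y = 0" for y
  proof -
    have "cell_map v y = cell_map v 0" using that by (simp add: cell_map_eq jacobian_cell_map)
    then show ?thesis using bij_cell_map[OF assms] by (metis bij_is_inj injD)
  qed
  then show ?thesis
    by (metis invertible_det_nz invertible_left_inverse matrix_left_invertible_ker)
qed

definition cell_jac :: "(nat \<Rightarrow> real^3) \<Rightarrow> real" where
  "cell_jac v = \<bar>det (jacobian (cell_map v) (at 0))\<bar>"

lemma jacobian_cell_map_const: "jacobian (cell_map v) (at x) = jacobian (cell_map v) (at 0)"
  unfolding matrix_eq by (simp add: jacobian_cell_map)

lemma cell_jac_pos: "cuboid E v \<Longrightarrow> cell_jac v > 0"
  using det_jacobian_cell_map[of E v 0] by (simp add: cell_jac_def)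

text \<open>The columns of the Jacobian matrix are the edges, and the two transpositions in the
  definition make the transform act row by row: each row becomes a combination of edges with the
  reference components as coefficients.\<close>

lemma piola_at_iff:
  assumes "cuboid E v"
  shows "piola_at (cell_map v) \<tau>h \<tau> x \<longleftrightarrow>
    (\<forall>i. \<tau> x $ i = (1 / cell_jac v) *\<^sub>R (\<Sum>k\<in>UNIV. \<tau>h (\<chi> k. loc v k x) $ i $ k *\<^sub>R edge v k))"
proof -
  let ?xh = "\<chi> k. loc v k x"
  let ?D = "jacobian (cell_map v) (at 0)"
  have 1: "piola_at (cell_map v) \<tau>h \<tau> x \<longleftrightarrow> transpose (\<tau> x) = (1 / cell_jac v) *\<^sub>R (?D ** transpose (\<tau>h ?xh))"
    unfolding piola_at_def inv_cell_map[OF assms] Let_def jacobian_cell_map_const[of v ?xh] cell_jac_def ..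
  have 2: "M = (1 / cell_jac v) *\<^sub>R (?D ** N) \<longleftrightarrow> (\<forall>i. column i M = (1 / cell_jac v) *\<^sub>R (?D *v column i N))" for M N :: "real^3^3"
    by (auto simp: vec_eq_iff column_def matrix_matrix_mult_def matrix_vector_mult_def)
  show ?thesis unfolding 1 2 jacobian_cell_map
    by (simp add: column_transpose row_def vec_eq_iff column_def transpose_def)
qed

section \<open>Integration by parts on cells\<close>

text \<open>The difference quotients of \<open>F\<close> along \<open>d\<close> have integral zero
  by translation invariance. The Lipschitz bound keeps them below \<open>L\<close> on a fixed ball,
  and dominated convergence carries the mean value over to the derivative.\<close>

lemma integral_directional_derivative_zero:
  fixes F f :: "'a::euclidean_space \<Rightarrow> real" and d :: 'a
  assumes F: "F \<in> borel_measurable borel" and f: "f \<in> borel_measurable borel"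
    and supp: "\<And>x. norm x > R \<Longrightarrow> F x = 0" and bd: "\<And>x. \<bar>F x\<bar> \<le> K"
    and lip: "\<And>x t. \<bar>F (x + t *\<^sub>R d) - F x\<bar> \<le> L * \<bar>t\<bar>"
    and der: "AE x in lborel. ((\<lambda>t. F (x + t *\<^sub>R d)) has_real_derivative f x) (at 0)"
  shows "integrable lborel f" "integral\<^sup>L lborel f = 0"
proof -
  define t where "t n = inverse (real (Suc n))" for n
  have t: "t n > 0" "t n \<le> 1" for n by (auto simp: t_def inverse_le_1_iff)
  define q where "q n x = (F (x + t n *\<^sub>R d) - F x) / t n" for n x
  \<comment> \<open>The radius is enlarged by the norm of \<open>d\<close> because the steps
    \<open>t n\<close> are at most 1: for \<open>x\<close> outside \<open>B\<close> both
    \<open>x\<close> and its translate are farther out than \<open>R\<close>.\<close>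
  define B where "B = cball (0::'a) (\<bar>R\<bar> + norm d)"
  define w where "w x = L * indicator B x" for x
  have fin: "emeasure lborel B < \<infinity>" unfolding B_def by (rule emeasure_lborel_cball_finite)
  have Bm: "B \<in> sets borel" by (simp add: B_def)
  have w: "integrable lborel w" unfolding w_def
    using fin Bm by (intro integrable_mult_right integrable_real_indicator) auto
  have K: "0 \<le> K" using bd[of 0] by linarith
  have intF: "integrable lborel F"
  proof (rule Bochner_Integration.integrable_bound[where f = "\<lambda>x. K * indicator B x :: real"])
    show "integrable lborel (\<lambda>x. K * indicator B x :: real)"
      using fin Bm by (intro integrable_mult_right integrable_real_indicator) auto
    have "\<bar>F x\<bar> \<le> K * indicator B x" for x
    proof (cases "x \<in> B")
      case False
      then have "norm x > R" unfolding B_def mem_cball dist_0_norm by (smt (verit) norm_ge_zero)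
      then show ?thesis using supp False by simp
    qed (use bd in simp)
    then show "AE x in lborel. norm (F x) \<le> norm (K * indicator B x :: real)"
      using K by (intro AE_I2) (simp add: abs_mult)
  qed (use F in simp)
  have shift: "integrable lborel (\<lambda>x. F (x + c))" "(\<integral>x. F (x + c) \<partial>lborel) = integral\<^sup>L lborel F" for c
  proof -
    have "integrable (distr lborel borel ((+) c)) F" using intF by (simp add: lborel_distr_plus)
    then show "integrable lborel (\<lambda>x. F (x + c))"
      using F by (simp add: integrable_distr_eq add.commute)
    have "integral\<^sup>L lborel F = integral\<^sup>L (distr lborel borel ((+) c)) F" by (simp add: lborel_distr_plus)
    also have "\<dots> = (\<integral>x. F (c + x) \<partial>lborel)" using F by (intro integral_distr) auto
    finally show "(\<integral>x. F (x + c) \<partial>lborel) = integral\<^sup>L lborel F" by (simp add: add.commute)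
  qed
  have q0: "integral\<^sup>L lborel (q n) = 0" for n
    unfolding q_def using shift[of "t n *\<^sub>R d"] intF by simp
  have L: "0 \<le> L" using order_trans[OF abs_ge_zero lip[of 0 1]] by simp
  have qw: "norm (q n x) \<le> w x" for n x
  proof (cases "x \<in> B")
    case True
    then show ?thesis using lip[of x "t n"] t[of n] by (simp add: q_def w_def field_simps)
  next
    case False
    then have "norm x > \<bar>R\<bar> + norm d" by (simp add: B_def)
    moreover have "norm (t n *\<^sub>R d) \<le> norm d" using t[of n] by (simp add: mult_left_le_one_le)
    moreover have "norm x - norm (t n *\<^sub>R d) \<le> norm (x + t n *\<^sub>R d)" by (rule norm_diff_ineq)
    ultimately have "norm (x + t n *\<^sub>R d) > R" "norm x > R"
      using norm_ge_zero[of d] abs_ge_self[of R] by linarith+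
    then show ?thesis using supp L by (simp add: q_def w_def)
  qed
  have lim: "AE x in lborel. (\<lambda>n. q n x) \<longlonglongrightarrow> f x"
    using der
  proof eventually_elim
    case (elim x)
    then have "((\<lambda>h. (F (x + h *\<^sub>R d) - F x) / h) \<longlongrightarrow> f x) (at 0)"
      by (simp add: DERIV_def)
    moreover have "filterlim t (at 0) sequentially"
      unfolding filterlim_at using LIMSEQ_inverse_real_of_nat t(1)
      by (auto simp: t_def[abs_def] intro!: always_eventually)
    ultimately show ?case unfolding q_def by (rule filterlim_compose)
  qed
  have qm: "q n \<in> borel_measurable lborel" for n unfolding q_def using F by measurable
  have fm: "f \<in> borel_measurable lborel" using f by simp
  show "integrable lborel f"
    by (rule integrable_dominated_convergence[OF fm qm w lim]) (intro AE_I2 qw)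
  have "(\<lambda>n. integral\<^sup>L lborel (q n)) \<longlonglongrightarrow> integral\<^sup>L lborel f"
    by (rule integral_dominated_convergence[OF fm qm w lim]) (intro AE_I2 qw)
  then show "integral\<^sup>L lborel f = 0" unfolding q0 by (simp add: LIMSEQ_const_iff)
qed

definition cell_int :: "(real^3) set \<Rightarrow> (real^3 \<Rightarrow> real) \<Rightarrow> real" where
  "cell_int E f = integral\<^sup>L (lebesgue_on (interior E)) f"

lemma cell_int_lborel:
  assumes "f \<in> borel_measurable borel"
  shows "cell_int E f = (\<integral>x. indicator (interior E) x * f x \<partial>lborel)"
  unfolding cell_int_def using assms
  by (subst integral_restrict_space) (auto intro!: integral_completion)

lemma integrable_on_cell:
  assumes "cuboid E v" "continuous_on UNIV f"
  shows "integrable (lebesgue_on (interior E)) (f :: real^3 \<Rightarrow> real)"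
proof -
  have "compact (f ` E)" using cuboid_compact_convex(1)[OF assms(1)] assms(2)
    by (intro compact_continuous_image continuous_on_subset[OF assms(2)]) auto
  then obtain K where K: "\<And>x. x \<in> E \<Longrightarrow> norm (f x) \<le> K"
    using compact_imp_bounded[of "f ` E"] by (auto simp: bounded_iff)
  have m: "f \<in> borel_measurable borel" using assms(2) by (rule borel_measurable_continuous_onI)
  have lm: "interior E \<in> lmeasurable"
    using cuboid_compact_convex(4)[OF assms(1)] bounded_interior by (intro lmeasurable_open) auto
  interpret finite_measure "lebesgue_on (interior E)"
    using lm by (intro finite_measure_lebesgue_on)
  have "f \<in> borel_measurable (lebesgue_on (interior E))"
    using m by (intro measurable_restrict_space1 measurable_completion) simp
  then show ?thesis
  proof (rule integrable_const_bound[of _ K, rotated])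
    show "AE x in lebesgue_on (interior E). norm (f x) \<le> K"
      using K interior_subset by (intro AE_I2) auto
  qed
qed

lemma AE_not_frontier_cuboid:
  assumes "cuboid E v" shows "AE x in lborel. x \<notin> frontier E"
proof -
  have "frontier E \<in> null_sets lebesgue"
    using negligible_convex_frontier[OF cuboid_compact_convex(2)[OF assms]]
    by (simp add: negligible_iff_null_sets)
  then have "frontier E \<in> null_sets lborel" by (subst (asm) null_sets_completion_iff) auto
  then show ?thesis by (rule AE_not_in)
qed

lemma has_real_derivative_shift:
  fixes x d :: "'a::real_vector"
  assumes "\<And>x. ((\<lambda>t. \<Phi> (x + t *\<^sub>R d)) has_real_derivative D x) (at 0)"
  shows "((\<lambda>t. \<Phi> (x + t *\<^sub>R d)) has_real_derivative D (x + s *\<^sub>R d)) (at s within S)"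
proof -
  have "((\<lambda>t. \<Phi> ((x + s *\<^sub>R d) + (t - s) *\<^sub>R d)) has_real_derivative D (x + s *\<^sub>R d) * 1) (at s)"
    by (rule DERIV_chain2[where g = "\<lambda>t. t - s"]) (use assms[of "x + s *\<^sub>R d"] in \<open>auto intro!: derivative_eq_intros\<close>)
  moreover have "(\<lambda>t. \<Phi> ((x + s *\<^sub>R d) + (t - s) *\<^sub>R d)) = (\<lambda>t. \<Phi> (x + t *\<^sub>R d))"
    by (intro ext arg_cong[where f = \<Phi>]) (simp add: scaleR_diff_left)
  ultimately show ?thesis by (auto intro: has_field_derivative_at_within)
qed

lemma has_real_derivative_line_cong:
  fixes x d :: "'a::real_normed_vector" and F G :: "'a \<Rightarrow> real"
  assumes "open S" "x \<in> S" "\<And>y. y \<in> S \<Longrightarrow> F y = G y"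
    and "((\<lambda>t. G (x + t *\<^sub>R d)) has_real_derivative y) (at 0)"
  shows "((\<lambda>t. F (x + t *\<^sub>R d)) has_real_derivative y) (at 0)"
proof -
  have lim: "((\<lambda>t::real. x + t *\<^sub>R d) \<longlongrightarrow> x) (at 0)" by (rule tendsto_eq_intros refl | simp)+
  have "\<forall>\<^sub>F t in at 0. x + t *\<^sub>R d \<in> S" using topological_tendstoD[OF lim assms(1,2)] .
  then have "\<forall>\<^sub>F t in at 0. F (x + t *\<^sub>R d) = G (x + t *\<^sub>R d)"
    by (rule eventually_mono) (use assms(3) in auto)
  then have "\<forall>\<^sub>F t in nhds 0. F (x + t *\<^sub>R d) = G (x + t *\<^sub>R d)"
    using assms(2,3) by (auto simp: eventually_nhds_conv_at)
  from DERIV_cong_ev[OF refl this refl] show ?thesis using assms(4) by blast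
qed

text \<open>The extension of \<Phi> by zero is Lipschitz in the direction of edge \<open>k\<close>,
  since \<Phi> vanishes on the two faces which that direction crosses; the jumps across the other
  faces are not seen by lines parallel to the edge. Its directional derivative is almost everywhere
  \<open>D\<close> inside the cell and 0 outside.\<close>

lemma cell_int_edge_derivative_zero:
  assumes c: "cuboid E v" and co: "continuous_on UNIV \<Phi>" "continuous_on UNIV D"
    and der: "\<And>x. ((\<lambda>t. \<Phi> (x + t *\<^sub>R edge v k)) has_real_derivative D x) (at 0)"
    and zero: "\<And>x. x \<in> E \<Longrightarrow> loc v k x = 0 \<or> loc v k x = 1 \<Longrightarrow> \<Phi> x = 0"
  shows "cell_int E D = 0"
proof -
  let ?d = "edge v k"
  define F where "F x = indicator E x * \<Phi> x" for x
  have E: "E = {x. \<forall>k. 0 \<le> loc v k x \<and> loc v k x \<le> 1}" by (rule cuboid_eq[OF c])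
  have bdd: "\<exists>K. \<forall>x\<in>E. \<bar>g x\<bar> \<le> K" if "continuous_on UNIV g" for g :: "real^3 \<Rightarrow> real"
  proof -
    have "compact (g ` E)" using cuboid_compact_convex(1)[OF c]
      by (intro compact_continuous_image continuous_on_subset[OF that]) auto
    then have "bounded (g ` E)" by (rule compact_imp_bounded)
    then show ?thesis by (auto simp: bounded_iff)
  qed
  obtain K0 where K0: "\<And>x. x \<in> E \<Longrightarrow> \<bar>\<Phi> x\<bar> \<le> K0" using bdd[OF co(1)] by blast
  obtain L0 where L0: "\<And>x. x \<in> E \<Longrightarrow> \<bar>D x\<bar> \<le> L0" using bdd[OF co(2)] by blast
  define L where "L = max L0 0"
  have L: "\<And>x. x \<in> E \<Longrightarrow> \<bar>D x\<bar> \<le> L" "0 \<le> L" using L0 unfolding L_def by force+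
  obtain R where R: "\<And>x. x \<in> E \<Longrightarrow> norm x \<le> R"
    using cuboid_compact_convex(4)[OF c] by (auto simp: bounded_iff)
  have Em: "E \<in> sets borel" using cuboid_compact_convex(3)[OF c] by simp
  have Pm: "\<Phi> \<in> borel_measurable borel" "D \<in> borel_measurable borel"
    using co by (simp_all add: borel_measurable_continuous_onI)
  \<comment> \<open>On a line through the cell, the extension by zero is \<Phi> at the clamped
    parameter, because \<Phi> vanishes at both ends. As clamping does not increase distances, the
    bound on \<open>D\<close> becomes a Lipschitz bound along the whole line.\<close>
  define clamp :: "real \<Rightarrow> real" where "clamp s = max 0 (min 1 s)" for s
  have clamp: "\<bar>clamp a - clamp b\<bar> \<le> \<bar>a - b\<bar>" "0 \<le> clamp a" "clamp a \<le> 1" for a b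
    by (auto simp: clamp_def)
  have lip: "\<bar>F (x + t *\<^sub>R ?d) - F x\<bar> \<le> L * \<bar>t\<bar>" for x t
  proof (cases "\<forall>i. i \<noteq> k \<longrightarrow> 0 \<le> loc v i x \<and> loc v i x \<le> 1")
    case False
    then have "x \<notin> E" "x + t *\<^sub>R ?d \<notin> E" unfolding E mem_Collect_eq loc_add_edge[OF c] by auto
    then show ?thesis using L(2) by (simp add: F_def)
  next
    case True
    \<comment> \<open>The point of the line at which coordinate \<open>k\<close> vanishes, so that
      the parameter along the line is this coordinate.\<close>
    define y where "y = x + (- loc v k x) *\<^sub>R ?d"
    have yE: "y + s *\<^sub>R ?d \<in> E \<longleftrightarrow> 0 \<le> s \<and> s \<le> 1" for s
      using True unfolding E mem_Collect_eq y_def loc_add_edge[OF c] by auto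
    have ly: "loc v k (y + s *\<^sub>R ?d) = s" for s unfolding y_def loc_add_edge[OF c] by simp
    have F: "F (y + s *\<^sub>R ?d) = \<Phi> (y + clamp s *\<^sub>R ?d)" for s
    proof (cases "0 \<le> s \<and> s \<le> 1")
      case True then show ?thesis using yE[of s] by (simp add: F_def clamp_def)
    next
      case False
      then have "clamp s = 0 \<or> clamp s = 1" by (auto simp: clamp_def)
      then have "\<Phi> (y + clamp s *\<^sub>R ?d) = 0"
        using zero[of "y + clamp s *\<^sub>R ?d"] yE[of "clamp s"] ly[of "clamp s"] by auto
      then show ?thesis using False yE[of s] by (simp add: F_def)
    qed
    have "norm (\<Phi> (y + a *\<^sub>R ?d) - \<Phi> (y + b *\<^sub>R ?d)) \<le> L * norm (a - b)" if "a \<in> {0..1}" "b \<in> {0..1}" for a b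
      using that by (intro field_differentiable_bound[OF convex_real_interval(5)
            has_real_derivative_shift[OF der]]) (use L(1) yE in auto)
    from this[of "clamp (loc v k x + t)" "clamp (loc v k x)"]
    have "\<bar>F (y + (loc v k x + t) *\<^sub>R ?d) - F (y + loc v k x *\<^sub>R ?d)\<bar> \<le> L * \<bar>clamp (loc v k x + t) - clamp (loc v k x)\<bar>"
      unfolding F using clamp by simp
    also have "\<dots> \<le> L * \<bar>t\<bar>" using clamp(1)[of "loc v k x + t" "loc v k x"] L(2) by (intro mult_left_mono) auto
    finally have "\<bar>F (y + (loc v k x + t) *\<^sub>R ?d) - F (y + loc v k x *\<^sub>R ?d)\<bar> \<le> L * \<bar>t\<bar>" .
    moreover have "y + (loc v k x + t) *\<^sub>R ?d = x + t *\<^sub>R ?d" "y + loc v k x *\<^sub>R ?d = x"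
      unfolding y_def by (simp_all add: scaleR_add_left)
    ultimately show ?thesis by simp
  qed
  have "AE x in lborel. ((\<lambda>t. F (x + t *\<^sub>R ?d)) has_real_derivative indicator (interior E) x * D x) (at 0)"
    using AE_not_frontier_cuboid[OF c]
  proof eventually_elim
    case (elim x)
    show ?case
    proof (cases "x \<in> E")
      case True
      then have xi: "x \<in> interior E"
        using elim cuboid_compact_convex(3)[OF c] by (auto simp: frontier_def)
      show ?thesis
        by (rule has_real_derivative_line_cong[where S = "interior E" and G = \<Phi>])
           (use xi der[of x] in \<open>auto simp: F_def dest: subsetD[OF interior_subset]\<close>)
    next
      case False
      then have 0: "indicator (interior E) x * D x = 0" using interior_subset[of E] by (auto simp: indicator_def)
      show ?thesis unfolding 0
        by (rule has_real_derivative_line_cong[where S = "- E" and G = "\<lambda>_. 0"])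
           (use False cuboid_compact_convex(3)[OF c] in \<open>auto simp: F_def\<close>)
    qed
  qed
  note der' = this
  have 1: "F \<in> borel_measurable borel" unfolding F_def[abs_def] using Em Pm(1) by measurable
  have 2: "(\<lambda>x. indicator (interior E) x * D x) \<in> borel_measurable borel" using Pm(2) by measurable
  have 3: "F x = 0" if "norm x > R" for x
  proof -
    have "x \<notin> E" using R[of x] that by auto
    then show ?thesis by (simp add: F_def)
  qed
  have 4: "\<bar>F x\<bar> \<le> max K0 0" for x
    using K0[of x] by (cases "x \<in> E") (simp_all add: F_def le_max_iff_disj)
  have "(\<integral>x. indicator (interior E) x * D x \<partial>lborel) = 0"
    by (rule integral_directional_derivative_zero(2)[OF 1 2 3 4 lip der'])
  then show ?thesis using Pm by (simp add: cell_int_lborel)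
qed

section \<open>Coordinates adapted to one face of a cell\<close>

definition outward :: "(nat \<Rightarrow> real^3) \<Rightarrow> 3 \<Rightarrow> real \<Rightarrow> real^3" where
  "outward v j s = (2 * s - 1) *\<^sub>R edge v j"

text \<open>Signed distance from the face in units of the thickness of the cell: 0 on the face and
  -1 on the opposite one. For \<open>s\<close> in {0, 1} the factor 2 s - 1 is the sign that makes
  the direction of increase point outwards.\<close>

definition height :: "(nat \<Rightarrow> real^3) \<Rightarrow> 3 \<Rightarrow> real \<Rightarrow> real^3 \<Rightarrow> real" where
  "height v j s x = (2 * s - 1) * (loc v j x - s)"

definition face_proj :: "(nat \<Rightarrow> real^3) \<Rightarrow> 3 \<Rightarrow> real \<Rightarrow> real^3 \<Rightarrow> real^3" where
  "face_proj v j s x = x - height v j s x *\<^sub>R outward v j s"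

lemma continuous_height [continuous_intros]:
  "continuous_on S g \<Longrightarrow> continuous_on S (\<lambda>x. height v j s (g x))"
  unfolding height_def by (intro continuous_intros)

lemma continuous_face_proj [continuous_intros]:
  "continuous_on S g \<Longrightarrow> continuous_on S (\<lambda>x. face_proj v j s (g x))"
  unfolding face_proj_def by (intro continuous_intros)

context
  fixes E v s and j :: 3 assumes c: "cuboid E v" and s: "s \<in> {0, 1::real}"
begin

lemma outward_nonzero: "outward v j s \<noteq> 0"
  using edge_nonzero[OF c, of j] s by (auto simp: outward_def)

lemma edge_outward: "edge v j = (2 * s - 1) *\<^sub>R outward v j s"
  using s by (auto simp: outward_def)

lemma height_add_outward: "height v j s (x + t *\<^sub>R outward v j s) = height v j s x + t"
  using s loc_add_edge[OF c, of j x "t * (2 * s - 1)" j] by (auto simp: height_def outward_def)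

lemma height_face_proj: "height v j s (face_proj v j s x) = 0"
  using height_add_outward[of x "- height v j s x"] by (simp add: face_proj_def)

lemma face_proj_add_outward: "face_proj v j s (x + t *\<^sub>R outward v j s) = face_proj v j s x"
  unfolding face_proj_def height_add_outward by (simp add: algebra_simps)

lemma loc_face_proj: "loc v k (face_proj v j s x) = (if k = j then s else loc v k x)"
proof -
  have "loc v k (face_proj v j s x) = loc v k x + (if k = j then - height v j s x * (2 * s - 1) else 0)"
    using loc_add_edge[OF c, of k x "- height v j s x * (2 * s - 1)" j]
    unfolding face_proj_def outward_def by simp
  then show ?thesis using s by (auto simp: height_def)
qed

lemma mem_cuboid_iff_height:
  "x \<in> E \<longleftrightarrow> face_proj v j s x \<in> E \<and> - 1 \<le> height v j s x \<and> height v j s x \<le> 0"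
proof -
  have "0 \<le> loc v j x \<and> loc v j x \<le> 1 \<longleftrightarrow> - 1 \<le> height v j s x \<and> height v j s x \<le> 0"
    using s by (auto simp: height_def)
  moreover have split: "(\<forall>k. P k) \<longleftrightarrow> (\<forall>k. k \<noteq> j \<longrightarrow> P k) \<and> P j" for P by metis
  have "x \<in> E \<longleftrightarrow> (\<forall>k. k \<noteq> j \<longrightarrow> 0 \<le> loc v k x \<and> loc v k x \<le> 1) \<and> (0 \<le> loc v j x \<and> loc v j x \<le> 1)" for x
    by (subst mem_cuboid_iff[OF c], subst split) (rule refl)
  moreover have "0 \<le> s" "s \<le> 1" using s by auto
  ultimately show ?thesis by (simp only: loc_face_proj if_False if_True refl simp_thms cong: conj_cong imp_cong)
qed

lemma mem_interior_height: "x \<in> interior E \<Longrightarrow> - 1 < height v j s x \<and> height v j s x < 0"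
  using s mem_interior_cuboid_iff[OF c, of x] by (auto simp: height_def)

lemma height_inner:
  assumes "height v j s p = 0"
  shows "height v j s x = (x - p) \<bullet> outward v j s / (outward v j s \<bullet> outward v j s)"
proof -
  have "loc v j x - loc v j p = (x - p) \<bullet> edge v j / (edge v j \<bullet> edge v j)"
    by (simp add: loc_def inner_diff_left diff_divide_distrib)
  moreover have "loc v j p = s" using assms s by (auto simp: height_def)
  ultimately show ?thesis using s by (auto simp: height_def outward_def)
qed

text \<open>A divergence theorem in one direction for the flux (1 + height) \<Phi>: the left
  integrand is its derivative along the outward vector, the factor kills the contribution of the
  opposite face, and the right side represents the contribution of the face itself.\<close>

lemma cell_int_flux:
  assumes co: "continuous_on UNIV \<Phi>" "continuous_on UNIV D"
    and der: "\<And>x. ((\<lambda>t. \<Phi> (x + t *\<^sub>R outward v j s)) has_real_derivative D x) (at 0)"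
  shows "cell_int E (\<lambda>x. \<Phi> x + (1 + height v j s x) * D x) = cell_int E (\<lambda>x. \<Phi> (face_proj v j s x))"
proof -
  \<comment> \<open>Vanishes on both faces normal to the direction: on the face because \<Phi>
    agrees there with its projected version, on the opposite face because of the factor 1 +
    height.\<close>
  define \<Psi> where "\<Psi> x = (1 + height v j s x) * (\<Phi> x - \<Phi> (face_proj v j s x))" for x
  define P where "P x = (2 * s - 1) * (\<Phi> x - \<Phi> (face_proj v j s x) + (1 + height v j s x) * D x)" for x
  have cp: "continuous_on UNIV (\<lambda>x. \<Phi> (face_proj v j s x))"
    by (rule continuous_on_compose2[OF co(1)]) (auto intro!: continuous_intros)
  have "((\<lambda>t. \<Psi> (x + t *\<^sub>R outward v j s)) has_real_derivative
     (\<Phi> x - \<Phi> (face_proj v j s x) + (1 + height v j s x) * D x)) (at 0)" for x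
    unfolding \<Psi>_def height_add_outward face_proj_add_outward
    by (rule derivative_eq_intros refl der | simp)+
  note d = this
  have der\<Psi>: "((\<lambda>t. \<Psi> (x + t *\<^sub>R edge v j)) has_real_derivative P x) (at 0)" for x
  proof -
    have "((\<lambda>t. \<Psi> (x + (t * (2 * s - 1)) *\<^sub>R outward v j s)) has_real_derivative
       (\<Phi> x - \<Phi> (face_proj v j s x) + (1 + height v j s x) * D x) * (2 * s - 1)) (at 0)"
      by (rule DERIV_chain2[where g = "\<lambda>t. t * (2 * s - 1)" and f = "\<lambda>t. \<Psi> (x + t *\<^sub>R outward v j s)"])
        (use d[of x] in \<open>auto intro!: derivative_eq_intros\<close>)
    then show ?thesis unfolding edge_outward P_def by (simp only: scaleR_scaleR mult.commute)
  qed
  have "cell_int E P = 0"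
  proof (rule cell_int_edge_derivative_zero[OF c _ _ der\<Psi>])
    show "continuous_on UNIV \<Psi>" unfolding \<Psi>_def by (intro continuous_intros co cp)
    show "continuous_on UNIV P" unfolding P_def by (intro continuous_intros co cp)
    fix x assume "loc v j x = 0 \<or> loc v j x = 1"
    then have "height v j s x = 0 \<or> height v j s x = - 1" using s by (auto simp: height_def)
    then show "\<Psi> x = 0" by (auto simp: \<Psi>_def face_proj_def)
  qed
  moreover have "cell_int E P = (2 * s - 1) * (cell_int E (\<lambda>x. \<Phi> x + (1 + height v j s x) * D x) - cell_int E (\<lambda>x. \<Phi> (face_proj v j s x)))"
  proof -
    have 1: "integrable (lebesgue_on (interior E)) (\<lambda>x. \<Phi> x + (1 + height v j s x) * D x)"
      by (rule integrable_on_cell[OF c]) (intro continuous_intros co)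
    have 2: "integrable (lebesgue_on (interior E)) (\<lambda>x. \<Phi> (face_proj v j s x))"
      by (rule integrable_on_cell[OF c]) (rule cp)
    have "P = (\<lambda>x. (2 * s - 1) * ((\<Phi> x + (1 + height v j s x) * D x) - \<Phi> (face_proj v j s x)))"
      by (rule ext) (simp add: P_def algebra_simps)
    then show ?thesis unfolding cell_int_def using Bochner_Integration.integral_diff[OF 1 2] by simp
  qed
  ultimately show ?thesis using s by auto
qed

end

text \<open>Both outward vectors are orthogonal to the common face, hence parallel. They point in
  opposite directions, since otherwise the cells would lie on the same side of the face and overlap.
  The number \<open>\<mu>\<close> is the thickness of \<open>E'\<close> divided by that of
  \<open>E\<close>.\<close>

lemma adjacent_cells:
  assumes c: "cuboid E v" and c': "cuboid E' v'" and s: "s \<in> {0, 1}" and s': "s' \<in> {0, 1}"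
    and e: "E \<inter> E' = {x \<in> E. height v j s x = 0}" and e': "E \<inter> E' = {x \<in> E'. height v' j' s' x = 0}"
  obtains \<mu> where "\<mu> > 0" "outward v' j' s' = - \<mu> *\<^sub>R outward v j s"
    "\<And>x. height v' j' s' x = - height v j s x / \<mu>"
    "\<And>x. face_proj v' j' s' x = face_proj v j s x"
proof -
  let ?o = "outward v j s" and ?o' = "outward v' j' s'"
  \<comment> \<open>A corner of the common face. The neighbouring corners along the edges other than
    \<open>j\<close> lie in the face too, so \<open>?o'\<close> is orthogonal to these
    edges.\<close>
  define p where "p = cell_map v (\<chi> k. if k = j then s else 0)"
  have lp: "loc v k p = (if k = j then s else 0)" for k by (simp add: p_def loc_cell_map[OF c])
  have pe: "p \<in> E \<inter> E'" unfolding e using s by (auto simp: mem_cuboid_iff[OF c] lp height_def)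
  have h'p: "height v' j' s' p = 0" and hp: "height v j s p = 0" using pe e e' by blast+
  have orth: "?o' \<bullet> edge v k = 0" if "k \<noteq> j" for k
  proof -
    have "loc v i (p + 1 *\<^sub>R edge v k) = (if i = j then s else if i = k then 1 else 0)" for i
      unfolding loc_add_edge[OF c] lp using that by auto
    then have "p + 1 *\<^sub>R edge v k \<in> E \<inter> E'"
      unfolding e using s by (auto simp: mem_cuboid_iff[OF c] height_def)
    then have "height v' j' s' (p + 1 *\<^sub>R edge v k) = 0" using e' by blast
    then show ?thesis using outward_nonzero[OF c' s', of j']
      unfolding height_inner[OF c' s' h'p] by (simp add: inner_commute)
  qed
  define r where "r = (?o' \<bullet> ?o) / (?o \<bullet> ?o)"
  have oo: "?o \<bullet> ?o > 0" "?o' \<bullet> ?o' > 0" using outward_nonzero[OF c s, of j] outward_nonzero[OF c' s', of j'] by auto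
  have "?o' - r *\<^sub>R ?o = 0"
  proof (rule orthogonal_to_edges_zero[OF c])
    fix k show "(?o' - r *\<^sub>R ?o) \<bullet> edge v k = 0"
    proof (cases "k = j")
      case True
      have "(?o' - r *\<^sub>R ?o) \<bullet> ?o = 0" using oo by (simp add: r_def inner_diff_left)
      then show ?thesis using True edge_outward[OF c s, of j] by simp
    next
      case False
      then show ?thesis using orth[OF False] edge_orthogonal[OF c, of j k] by (simp add: inner_diff_left outward_def)
    qed
  qed
  then have o': "?o' = r *\<^sub>R ?o" by simp
  have r0: "r \<noteq> 0" using o' outward_nonzero[OF c' s', of j'] by auto
  have h': "height v' j' s' x = height v j s x / r" for x
    unfolding height_inner[OF c' s' h'p] height_inner[OF c s hp] o' using r0 oo by (simp add: field_simps)
  have pr: "face_proj v' j' s' x = face_proj v j s x" for x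
    unfolding face_proj_def h' o' using r0 by simp
  have "r < 0"
  proof (rule ccontr)
    assume "\<not> r < 0"
    then have r: "r > 0" using r0 by simp
    \<comment> \<open>The point at depth \<open>q\<close> below \<open>p\<close> stays in
      \<open>E\<close> because \<open>q \<le> 1\<close>, and would stay in \<open>E'\<close> because
      \<open>q \<le> r\<close>, although it is off the common face.\<close>
    define q where "q = min 1 r"
    have q: "0 < q" "q \<le> 1" "q \<le> r" using r by (auto simp: q_def)
    define y where "y = p + (- q) *\<^sub>R ?o"
    have hy: "height v j s y = - q" unfolding y_def height_add_outward[OF c s] hp by simp
    have py: "face_proj v j s y = p" unfolding y_def face_proj_add_outward[OF c s] by (simp add: face_proj_def hp)
    have "y \<in> E" using pe q mem_cuboid_iff_height[OF c s, of y j] by (simp add: hy py)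
    moreover have "y \<in> E'" using pe q r mem_cuboid_iff_height[OF c' s', of y j'] by (simp add: h' pr hy py field_simps)
    ultimately have "height v j s y = 0" using e by blast
    then show False using hy q by simp
  qed
  then show ?thesis using that[of "- r"] o' h' pr by simp
qed

text \<open>Both sides represent the same face integral, multiplied by the thickness of the
  respective cell. A tent function along the normal, times \<open>h\<close>, has derivative
  \<open>h\<close> on \<open>E\<close> and \<open>- h / \<mu>\<close> on \<open>E'\<close>; the
  equality says that this derivative has mean zero.\<close>

lemma adjacent_cell_int:
  assumes c: "cuboid E v" and c': "cuboid E' v'" and s: "s \<in> {0, 1}" and s': "s' \<in> {0, 1}"
    and e: "E \<inter> E' = {x \<in> E. height v j s x = 0}" and e': "E \<inter> E' = {x \<in> E'. height v' j' s' x = 0}"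
    and mu: "\<mu> > 0" and h': "\<And>x. height v' j' s' x = - height v j s x / \<mu>"
    and pr: "\<And>x. face_proj v' j' s' x = face_proj v j s x"
    and h: "continuous_on UNIV h" "\<And>x. h (face_proj v j s x) = h x"
  shows "\<mu> * cell_int E h = cell_int E' h"
proof -
  let ?o = "outward v j s"
  let ?H = "height v j s"
  \<comment> \<open>\<open>C\<close> is the unbounded cylinder over the common face. The function
    \<open>hat\<close> rises from 0 on the far face of \<open>E\<close> to 1 on the common face and
    falls to 0 at height \<open>\<mu>\<close>, which is the far face of \<open>E'\<close>.\<close>
  define C where "C = {x. face_proj v j s x \<in> E}"
  define hat where "hat x = max 0 (min (1 + ?H x) (1 - ?H x / \<mu>))" for x
  define F where "F x = indicator C x * h x * hat x" for x
  define f where "f x = indicator (interior E) x * h x - indicator (interior E') x * h x / \<mu>" for x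
  have hshift: "h (x + t *\<^sub>R ?o) = h x" for x t
    using h(2)[of "x + t *\<^sub>R ?o"] h(2)[of x] by (simp add: face_proj_add_outward[OF c s])
  have CE: "x \<in> E \<longleftrightarrow> x \<in> C \<and> - 1 \<le> ?H x \<and> ?H x \<le> 0" for x
    using mem_cuboid_iff_height[OF c s, of x j] by (simp add: C_def)
  have "face_proj v j s x \<in> E \<longleftrightarrow> face_proj v j s x \<in> E'" for x
    using e e' height_face_proj[OF c s, of j x] height_face_proj[OF c' s', of j' x] unfolding pr by blast
  then have CE': "x \<in> E' \<longleftrightarrow> x \<in> C \<and> 0 \<le> ?H x \<and> ?H x \<le> \<mu>" for x
    using mem_cuboid_iff_height[OF c' s', of x j'] mu unfolding pr h' C_def mem_Collect_eq
    by (auto simp: field_simps)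
  have hat0: "hat x = 0" if "\<not> (- 1 \<le> ?H x \<and> ?H x \<le> \<mu>)" for x
  proof (cases "- 1 \<le> ?H x")
    case True
    then have "1 - ?H x / \<mu> < 0" using that mu by (simp add: field_simps)
    then show ?thesis unfolding hat_def by linarith
  next
    case False
    then show ?thesis unfolding hat_def by linarith
  qed
  have F0: "F x = 0" if "x \<notin> E" "x \<notin> E'" for x
    using that CE[of x] CE'[of x] hat0[of x] unfolding F_def by (auto simp: indicator_def)
  have H_mu: "?H x \<le> 0 \<longleftrightarrow> ?H x / \<mu> \<le> 0" for x using mu by (simp add: divide_le_0_iff)
  have hatE: "hat x = 1 + ?H x" if "x \<in> interior E" for x
    using mem_interior_height[OF c s that, of j] H_mu[of x] unfolding hat_def by linarith
  have hatE': "hat x = 1 - ?H x / \<mu>" if "x \<in> interior E'" for x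
    using mem_interior_height[OF c' s' that, of j'] H_mu[of x] unfolding hat_def h' by linarith
  have hat_bd: "0 \<le> hat x" "hat x \<le> 1" for x using H_mu[of x] unfolding hat_def by linarith+
  have disj: "interior E \<inter> interior E' = {}"
    using mem_interior_height[OF c s, of _ j] mem_interior_height[OF c' s', of _ j'] mu unfolding h'
    by (fastforce simp: field_simps)
  have "compact (h ` E)" using cuboid_compact_convex(1)[OF c]
    by (intro compact_continuous_image continuous_on_subset[OF h(1)]) auto
  then obtain K where K: "\<And>x. x \<in> E \<Longrightarrow> \<bar>h x\<bar> \<le> K"
    using compact_imp_bounded[of "h ` E"] by (auto simp: bounded_iff)
  have KC: "\<bar>h x\<bar> \<le> K" if "x \<in> C" for x using K[of "face_proj v j s x"] that h(2) by (auto simp: C_def)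
  have K0: "0 \<le> K" using K[of "cell_map v (\<chi> k. 1/2)"] cuboid_center[OF c] interior_subset[of E] by force
  obtain R where R: "\<And>x. x \<in> E \<Longrightarrow> norm x \<le> R"
    using cuboid_compact_convex(4)[OF c] by (auto simp: bounded_iff)
  obtain R' where R': "\<And>x. x \<in> E' \<Longrightarrow> norm x \<le> R'"
    using cuboid_compact_convex(4)[OF c'] by (auto simp: bounded_iff)
  \<comment> \<open>The larger of the two slopes of the tent in absolute value.\<close>
  define M where "M = max 1 (1 / \<mu>)"
  have hat_lip: "\<bar>hat (x + t *\<^sub>R ?o) - hat x\<bar> \<le> M * \<bar>t\<bar>" for x t
  proof -
    have ne: "\<bar>max 0 (min a b) - max 0 (min a' b')\<bar> \<le> m" if "\<bar>a - a'\<bar> \<le> m" "\<bar>b - b'\<bar> \<le> m" for a a' b b' m :: real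
      using that by (smt (verit))
    have "1 * \<bar>t\<bar> \<le> M * \<bar>t\<bar>" "(1 / \<mu>) * \<bar>t\<bar> \<le> M * \<bar>t\<bar>"
      unfolding M_def by (intro mult_right_mono; simp)+
    then have "\<bar>t\<bar> \<le> M * \<bar>t\<bar>" "\<bar>t / \<mu>\<bar> \<le> M * \<bar>t\<bar>" using mu by (simp_all add: abs_divide)
    then show ?thesis unfolding hat_def height_add_outward[OF c s]
      by (intro ne) (simp_all add: add_divide_distrib)
  qed
  have lip: "\<bar>F (x + t *\<^sub>R ?o) - F x\<bar> \<le> (K * M) * \<bar>t\<bar>" for x t
  proof -
    have "x + t *\<^sub>R ?o \<in> C \<longleftrightarrow> x \<in> C" by (simp add: C_def face_proj_add_outward[OF c s])
    then have "F (x + t *\<^sub>R ?o) - F x = indicator C x * h x * (hat (x + t *\<^sub>R ?o) - hat x)"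
      by (simp add: F_def hshift indicator_def algebra_simps)
    then have "\<bar>F (x + t *\<^sub>R ?o) - F x\<bar> = (indicator C x * \<bar>h x\<bar>) * \<bar>hat (x + t *\<^sub>R ?o) - hat x\<bar>"
      by (simp add: abs_mult)
    also have "\<dots> \<le> K * (M * \<bar>t\<bar>)"
      using KC[of x] K0 hat_lip[of x t] by (intro mult_mono) (auto simp: indicator_def)
    finally show ?thesis by (simp add: mult.assoc)
  qed
  note loceq = has_real_derivative_line_cong[of _ _ F _ ?o]
  have "AE x in lborel. ((\<lambda>t. F (x + t *\<^sub>R ?o)) has_real_derivative f x) (at 0)"
    using AE_not_frontier_cuboid[OF c] AE_not_frontier_cuboid[OF c']
  proof eventually_elim
    case (elim x)
    then consider "x \<in> interior E" | "x \<in> interior E'" | "x \<in> - (E \<union> E')"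
      using cuboid_compact_convex(3)[OF c] cuboid_compact_convex(3)[OF c'] by (auto simp: frontier_def)
    then show ?case
    proof cases
      case 1
      have Fy: "F y = h y * (1 + ?H y)" if "y \<in> interior E" for y
        using that hatE[OF that] CE[of y] interior_subset[of E] by (auto simp: F_def)
      have fx: "f x = h x" using 1 disj by (auto simp: f_def indicator_def)
      have d: "((\<lambda>t. h (x + t *\<^sub>R ?o) * (1 + ?H (x + t *\<^sub>R ?o))) has_real_derivative h x) (at 0)"
        unfolding hshift height_add_outward[OF c s] by (auto intro!: derivative_eq_intros)
      show ?thesis unfolding fx by (rule loceq[OF open_interior 1 Fy d])
    next
      case 2
      have Fy: "F y = h y * (1 - ?H y / \<mu>)" if "y \<in> interior E'" for y
        using that hatE'[OF that] CE'[of y] interior_subset[of E'] by (auto simp: F_def)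
      have fx: "f x = - h x / \<mu>" using 2 disj by (auto simp: f_def indicator_def)
      have d: "((\<lambda>t. h (x + t *\<^sub>R ?o) * (1 - ?H (x + t *\<^sub>R ?o) / \<mu>)) has_real_derivative - h x / \<mu>) (at 0)"
        unfolding hshift height_add_outward[OF c s] using mu by (auto intro!: derivative_eq_intros)
      show ?thesis unfolding fx by (rule loceq[OF open_interior 2 Fy d])
    next
      case 3
      have f0: "f x = 0" using 3 interior_subset[of E] interior_subset[of E'] by (auto simp: f_def indicator_def)
      have "open (- (E \<union> E'))"
        using cuboid_compact_convex(3)[OF c] cuboid_compact_convex(3)[OF c'] by auto
      then show ?thesis unfolding f0
        by (rule loceq[where G = "\<lambda>_. 0"]) (use 3 F0 in auto)
    qed
  qed
  note der = this
  have hm: "h \<in> borel_measurable borel" using h(1) by (rule borel_measurable_continuous_onI)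
  have "closed C" unfolding C_def
    using continuous_closed_vimage[OF cuboid_compact_convex(3)[OF c], of "face_proj v j s"]
      continuous_face_proj[of UNIV "\<lambda>x. x" v j s]
    by (simp add: vimage_def continuous_on_eq_continuous_at)
  then have Cm: "C \<in> sets borel" by simp
  have hatm: "hat \<in> borel_measurable borel" unfolding hat_def[abs_def]
    by (intro borel_measurable_continuous_onI continuous_intros) (use mu in auto)
  have 1: "F \<in> borel_measurable borel" unfolding F_def[abs_def] using hm Cm hatm by measurable
  have 2: "f \<in> borel_measurable borel" unfolding f_def[abs_def] using hm by measurable
  have 3: "F x = 0" if "norm x > max R R'" for x using that R[of x] R'[of x] by (intro F0) force+
  have 4: "\<bar>F x\<bar> \<le> K" for x
    using KC[of x] K0 hat_bd[of x] unfolding F_def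
    by (auto simp: indicator_def abs_mult intro: order_trans[OF mult_left_le])
  have "(\<integral>x. f x \<partial>lborel) = 0"
    by (rule integral_directional_derivative_zero(2)[OF 1 2 3 4 lip der])
  moreover have i: "integrable lborel (\<lambda>x. indicator (interior E) x * h x)" if "cuboid E v" for E v
    using integrable_on_cell[OF that h(1)] hm
    by (subst (asm) integrable_restrict_space) (auto simp: integrable_completion)
  moreover have "(\<integral>x. f x \<partial>lborel) = (\<integral>x. indicator (interior E) x * h x \<partial>lborel) - (\<integral>x. indicator (interior E') x * h x \<partial>lborel) / \<mu>"
    unfolding f_def using i[OF c] i[OF c'] by simp
  ultimately show ?thesis using mu hm by (simp add: cell_int_lborel field_simps)
qed

section \<open>Smooth cut-off functions of cells\<close>

text \<open>A family that contains the standard flat function (\<open>p\<close> = 1) and is closed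
  under differentiation, so that smoothness of all orders follows from a single computation of a
  derivative.\<close>

definition flat_exp :: "real poly \<Rightarrow> real \<Rightarrow> real" where
  "flat_exp p t = (if t \<le> 0 then 0 else poly p (1 / t) * exp (- (1 / t)))"

lemma poly_times_exp_minus_tendsto_0:
  "((\<lambda>u::real. poly p u * exp (- u)) \<longlongrightarrow> 0) at_top"
proof (induction p)
  case (pCons a p)
  have "((\<lambda>u::real. u ^ n * exp (- u)) \<longlongrightarrow> 0) at_top" for n
    using tendsto_power_div_exp_0[of n] by (simp add: exp_minus divide_inverse)
  then have "((\<lambda>u::real. (\<Sum>i\<le>degree (pCons a p). coeff (pCons a p) i * (u ^ i * exp (- u)))) \<longlongrightarrow> (\<Sum>i\<le>degree (pCons a p). coeff (pCons a p) i * 0)) at_top"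
    by (intro tendsto_intros)
  then show ?case by (simp add: poly_altdef sum_distrib_right mult.assoc)
qed simp

text \<open>With u = 1 / t one has du / dt = - u^2, whence the polynomial u^2 (p - p'). At t = 0 the
  right difference quotient is u p(u) exp (- u), which tends to 0 as u grows.\<close>

lemma flat_exp_deriv:
  "(flat_exp p has_real_derivative flat_exp ([:0, 0, 1:] * (p - pderiv p)) t) (at t)"
proof -
  consider "t < 0" | "t > 0" | "t = 0" by linarith
  then show ?thesis
  proof cases
    case 1
    then have "\<forall>\<^sub>F x in nhds t. flat_exp p x = 0"
      by (intro eventually_nhds_in_open[of "{..<0}", THEN eventually_mono]) (auto simp: flat_exp_def)
    moreover have "flat_exp ([:0, 0, 1:] * (p - pderiv p)) t = 0" using 1 by (simp add: flat_exp_def)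
    ultimately show ?thesis using iffD2[OF DERIV_cong_ev[OF refl _ refl] DERIV_const] by metis
  next
    case 2
    then have ev: "\<forall>\<^sub>F x in nhds t. flat_exp p x = poly p (1 / x) * exp (- (1 / x))"
      by (intro eventually_nhds_in_open[of "{0<..}", THEN eventually_mono]) (auto simp: flat_exp_def)
    have "((\<lambda>x. poly p (1 / x) * exp (- (1 / x))) has_real_derivative
        poly (pderiv p) (1 / t) * (- 1 / (t * t)) * exp (- (1 / t)) + poly p (1 / t) * (exp (- (1 / t)) * (1 / (t * t)))) (at t)"
      using 2 by (auto intro!: derivative_eq_intros DERIV_chain2[OF poly_DERIV] simp: field_simps)
    moreover have "poly (pderiv p) (1 / t) * (- 1 / (t * t)) * exp (- (1 / t)) + poly p (1 / t) * (exp (- (1 / t)) * (1 / (t * t)))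
       = flat_exp ([:0, 0, 1:] * (p - pderiv p)) t"
      using 2 by (simp add: flat_exp_def field_simps)
    ultimately show ?thesis using DERIV_cong_ev[OF refl ev refl] by simp
  next
    case 3
    have "((\<lambda>h. flat_exp p h / h) \<longlongrightarrow> 0) (at_right 0)"
    proof (rule Lim_transform_eventually)
      show "((\<lambda>h. poly (pCons 0 p) (inverse h) * exp (- (inverse h))) \<longlongrightarrow> 0) (at_right (0::real))"
        by (rule filterlim_compose[OF poly_times_exp_minus_tendsto_0 filterlim_inverse_at_top_right])
      show "\<forall>\<^sub>F h in at_right 0. poly (pCons 0 p) (inverse h) * exp (- (inverse h)) = flat_exp p h / h"
        using eventually_at_right_less by (rule eventually_mono) (simp add: flat_exp_def divide_inverse)
    qed
    moreover have "((\<lambda>h. flat_exp p h / h) \<longlongrightarrow> 0) (at_left 0)"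
      by (rule tendsto_eventually) (auto simp: flat_exp_def eventually_at_filter)
    ultimately have "((\<lambda>h. flat_exp p h / h) \<longlongrightarrow> 0) (at 0)" by (simp add: filterlim_split_at)
    then show ?thesis using 3 by (simp add: DERIV_def flat_exp_def)
  qed
qed

text \<open>\<open>C_k\<close> recurses through partial derivatives, so smoothness is proved for a
  class that contains its own partial derivatives; the product rule is the reason for closing it
  under both sums and products.\<close>

inductive bump_like :: "(real^3 \<Rightarrow> real) \<Rightarrow> bool" where
  flat: "bump_like (\<lambda>x. flat_exp p (a \<bullet> x + b))"
| add: "bump_like g \<Longrightarrow> bump_like h \<Longrightarrow> bump_like (\<lambda>x. g x + h x)"
| mult: "bump_like g \<Longrightarrow> bump_like h \<Longrightarrow> bump_like (\<lambda>x. g x * h x)"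

lemma partial_eqI: "(g has_derivative g') (at x) \<Longrightarrow> partial j g x = g' (axis j 1)"
  unfolding partial_def by (metis frechet_derivative_at)

lemma flat_exp_smult: "flat_exp (smult c p) t = c * flat_exp p t"
  by (simp add: flat_exp_def)

lemma bump_like_step:
  "bump_like g \<Longrightarrow> (\<forall>x. g differentiable (at x)) \<and> (\<forall>j. bump_like (partial j g))"
proof (induction rule: bump_like.induct)
  case (flat p a b)
  let ?q = "[:0, 0, 1:] * (p - pderiv p)"
  have "((\<lambda>x. a \<bullet> x + b) has_derivative (\<lambda>h. a \<bullet> h)) (at x)" for x
    by (auto intro!: derivative_eq_intros)
  from has_derivative_compose[OF this flat_exp_deriv[unfolded has_field_derivative_def]]
  have d: "((\<lambda>x. flat_exp p (a \<bullet> x + b)) has_derivative (\<lambda>h. flat_exp ?q (a \<bullet> x + b) * (a \<bullet> h))) (at x)" for x .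
  have "partial j (\<lambda>x. flat_exp p (a \<bullet> x + b)) = (\<lambda>x. flat_exp (smult (a $ j) ?q) (a \<bullet> x + b))" for j
    unfolding flat_exp_smult using partial_eqI[OF d] by (intro ext) (simp add: inner_axis mult.commute)
  moreover have "(\<lambda>x. flat_exp p (a \<bullet> x + b)) differentiable (at x)" for x
    using d unfolding differentiable_def by blast
  ultimately show ?case using bump_like.flat by simp
next
  case (add g h)
  then have dg: "(g has_derivative frechet_derivative g (at x)) (at x)" and dh: "(h has_derivative frechet_derivative h (at x)) (at x)" for x
    using frechet_derivative_works by blast+
  have d: "((\<lambda>x. g x + h x) has_derivative (\<lambda>y. frechet_derivative g (at x) y + frechet_derivative h (at x) y)) (at x)" for x
    by (rule has_derivative_add[OF dg dh])
  have "partial j (\<lambda>x. g x + h x) = (\<lambda>x. partial j g x + partial j h x)" for j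
    by (rule ext) (simp add: partial_eqI[OF d] partial_def)
  moreover have "bump_like (\<lambda>x. partial j g x + partial j h x)" for j
    using add bump_like.add by blast
  moreover have "(\<lambda>x. g x + h x) differentiable (at x)" for x
    using d unfolding differentiable_def by blast
  ultimately show ?case by simp
next
  case (mult g h)
  then have dg: "(g has_derivative frechet_derivative g (at x)) (at x)" and dh: "(h has_derivative frechet_derivative h (at x)) (at x)" for x
    using frechet_derivative_works by blast+
  have d: "((\<lambda>x. g x * h x) has_derivative (\<lambda>y. g x * frechet_derivative h (at x) y + frechet_derivative g (at x) y * h x)) (at x)" for x
    by (rule has_derivative_mult[OF dg dh])
  have "partial j (\<lambda>x. g x * h x) = (\<lambda>x. g x * partial j h x + partial j g x * h x)" for j
    by (rule ext) (simp add: partial_eqI[OF d] partial_def)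
  moreover have "bump_like (\<lambda>x. g x * partial j h x + partial j g x * h x)" for j
    using mult bump_like.add bump_like.mult by blast
  moreover have "(\<lambda>x. g x * h x) differentiable (at x)" for x
    using d unfolding differentiable_def by blast
  ultimately show ?case by simp
qed

lemma bump_like_C_k: "bump_like g \<Longrightarrow> C_k k g"
proof (induction k arbitrary: g)
  case 0
  then show ?case using bump_like_step[of g]
    by (auto intro!: continuous_at_imp_continuous_on differentiable_imp_continuous_within)
qed (use bump_like_step in auto)

text \<open>The factors of index \<open>k\<close> are positive exactly where n loc > 1 and n (1 -
  loc) > 1. This keeps the support inside the open cell, and as n grows the functions tend to the
  indicator of the interior.\<close>

definition cell_bump :: "(nat \<Rightarrow> real^3) \<Rightarrow> nat \<Rightarrow> real^3 \<Rightarrow> real" where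
  "cell_bump v n x = (\<Prod>k\<in>UNIV. flat_exp 1 (real n * loc v k x - 1) * flat_exp 1 (real n * (1 - loc v k x) - 1))"

lemma flat_exp_1_bounds: "0 \<le> flat_exp 1 t" "flat_exp 1 t \<le> 1" "flat_exp 1 t = 0 \<longleftrightarrow> t \<le> 0"
  by (auto simp: flat_exp_def)

lemma loc_affine:
  "loc v k x = (edge v k \<bullet> x) / (edge v k \<bullet> edge v k) - (v 1 \<bullet> edge v k) / (edge v k \<bullet> edge v k)"
  unfolding loc_def inner_diff_left diff_divide_distrib inner_commute[of x "edge v k"] ..

lemma bump_like_cell_bump: "bump_like (cell_bump v n)"
proof -
  have 1: "bump_like (\<lambda>x. flat_exp 1 (real n * loc v k x - 1))" for k
  proof -
    let ?e = "edge v k \<bullet> edge v k"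
    have eq: "(\<lambda>x. flat_exp 1 (real n * loc v k x - 1)) =
        (\<lambda>x. flat_exp 1 (((real n / ?e) *\<^sub>R edge v k) \<bullet> x + (- real n * (v 1 \<bullet> edge v k) / ?e - 1)))"
      by (rule ext, rule arg_cong[where f = "flat_exp 1"])
         (simp add: loc_affine right_diff_distrib)
    show ?thesis unfolding eq by (rule bump_like.flat)
  qed
  have 2: "bump_like (\<lambda>x. flat_exp 1 (real n * (1 - loc v k x) - 1))" for k
  proof -
    let ?e = "edge v k \<bullet> edge v k"
    have eq: "(\<lambda>x. flat_exp 1 (real n * (1 - loc v k x) - 1)) =
        (\<lambda>x. flat_exp 1 (((- real n / ?e) *\<^sub>R edge v k) \<bullet> x + (real n * (v 1 \<bullet> edge v k) / ?e + real n - 1)))"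
      by (rule ext, rule arg_cong[where f = "flat_exp 1"])
         (simp add: loc_affine right_diff_distrib)
    show ?thesis unfolding eq by (rule bump_like.flat)
  qed
  have "cell_bump v n = (\<lambda>x. flat_exp 1 (real n * loc v 1 x - 1) * flat_exp 1 (real n * (1 - loc v 1 x) - 1) *
     (flat_exp 1 (real n * loc v 2 x - 1) * flat_exp 1 (real n * (1 - loc v 2 x) - 1) *
     (flat_exp 1 (real n * loc v 3 x - 1) * flat_exp 1 (real n * (1 - loc v 3 x) - 1))))"
    unfolding cell_bump_def UNIV_3 by (rule ext) simp
  then show ?thesis by (simp only:) (intro bump_like.mult 1 2)
qed

lemma cell_bump_bounds: "0 \<le> cell_bump v n x" "cell_bump v n x \<le> 1"
  unfolding cell_bump_def using flat_exp_1_bounds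
  by (auto intro!: prod_nonneg prod_le_1 mult_le_one)

lemma cell_bump_nonzero:
  "cell_bump v n x \<noteq> 0 \<longleftrightarrow> (\<forall>k. real n * loc v k x > 1 \<and> real n * (1 - loc v k x) > 1)"
  by (auto simp: cell_bump_def flat_exp_1_bounds not_le)

lemma test_function_cell_bump:
  assumes c: "cuboid E v" and sub: "interior E \<subseteq> \<Omega>"
  shows "test_function \<Omega> (cell_bump v n)"
proof -
  define S where "S = {x. \<forall>k. 1 \<le> real n * loc v k x \<and> 1 \<le> real n * (1 - loc v k x)}"
  have "closed S" unfolding S_def forall_3
    by (intro closed_Collect_conj closed_Collect_le continuous_intros)
  moreover have "{x. cell_bump v n x \<noteq> 0} \<subseteq> S"
    unfolding S_def cell_bump_nonzero by (auto intro: less_imp_le)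
  ultimately have cl: "closure {x. cell_bump v n x \<noteq> 0} \<subseteq> S" by (rule closure_minimal[rotated])
  have SE: "S \<subseteq> interior E"
  proof
    fix x assume x: "x \<in> S"
    have "0 < loc v k x \<and> loc v k x < 1" for k
    proof -
      have "1 \<le> real n * loc v k x" "1 \<le> real n * (1 - loc v k x)" using x by (auto simp: S_def)
      then have "0 < real n * loc v k x" "0 < real n * (1 - loc v k x)" by linarith+
      then show ?thesis by (auto simp: zero_less_mult_iff)
    qed
    then show "x \<in> interior E" by (simp add: mem_interior_cuboid_iff[OF c])
  qed
  have "bounded (closure {x. cell_bump v n x \<noteq> 0})"
    using cl SE cuboid_compact_convex(4)[OF c] interior_subset[of E] bounded_subset by (metis subset_trans)
  then show ?thesis unfolding test_function_def
    using bump_like_C_k[OF bump_like_cell_bump] cl SE sub by (auto simp: compact_eq_bounded_closed)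
qed

lemma flat_exp_1_tendsto:
  assumes "t > 0" shows "(\<lambda>n. flat_exp 1 (real n * t - 1)) \<longlonglongrightarrow> 1"
proof -
  have lim: "filterlim (\<lambda>n. real n * t - 1) at_top sequentially"
  proof -
    have "filterlim (\<lambda>n. t * real n) at_top sequentially"
      using filterlim_tendsto_pos_mult_at_top[OF tendsto_const assms filterlim_real_sequentially] .
    from filterlim_tendsto_add_at_top[OF tendsto_const[of "-1"] this] show ?thesis by (simp add: mult.commute)
  qed
  have "(\<lambda>n. exp (- (inverse (real n * t - 1)))) \<longlonglongrightarrow> exp (- 0)"
    by (intro tendsto_intros filterlim_compose[OF tendsto_inverse_0_at_top lim]) (rule filterlim_ident)
  moreover have "\<forall>\<^sub>F n in sequentially. exp (- (inverse (real n * t - 1))) = flat_exp 1 (real n * t - 1)"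
    using filterlim_at_top_dense[THEN iffD1, OF lim, rule_format, of 0]
    by (rule eventually_mono) (simp add: flat_exp_def divide_inverse)
  ultimately show ?thesis by (auto intro: Lim_transform_eventually)
qed

lemma cell_bump_tendsto:
  assumes c: "cuboid E v"
  shows "(\<lambda>n. cell_bump v n x) \<longlonglongrightarrow> indicator (interior E) x"
proof (cases "x \<in> interior E")
  case True
  then have "0 < loc v k x" "0 < 1 - loc v k x" for k by (simp_all add: mem_interior_cuboid_iff[OF c])
  then have "(\<lambda>n. cell_bump v n x) \<longlonglongrightarrow> (\<Prod>k\<in>(UNIV::3 set). 1 * 1)"
    unfolding cell_bump_def by (intro tendsto_prod tendsto_mult flat_exp_1_tendsto)
  then show ?thesis using True by simp
next
  case False
  then obtain k where k: "loc v k x \<le> 0 \<or> 1 - loc v k x \<le> 0"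
    by (auto simp: mem_interior_cuboid_iff[OF c] not_less)
  have "cell_bump v n x = 0" for n
  proof -
    have "real n * loc v k x \<le> 0 \<or> real n * (1 - loc v k x) \<le> 0"
      using k by (metis mult_nonneg_nonpos of_nat_0_le_iff)
    then have "\<not> (real n * loc v k x > 1 \<and> real n * (1 - loc v k x) > 1)" by linarith
    then show ?thesis using cell_bump_nonzero by blast
  qed
  then show ?thesis using False by simp
qed

lemma L2_on_integrable:
  fixes g :: "real^3 \<Rightarrow> 'b::euclidean_space"
  assumes g: "L2_on \<Omega> g" and \<Omega>: "\<Omega> \<in> lmeasurable"
  shows "integrable (lebesgue_on \<Omega>) g"
proof -
  interpret finite_measure "lebesgue_on \<Omega>" using \<Omega> by (rule finite_measure_lebesgue_on)
  have "integrable (lebesgue_on \<Omega>) (\<lambda>x. 1 + (norm (g x))\<^sup>2)" using g by (auto simp: L2_on_def)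
  then show ?thesis
  proof (rule Bochner_Integration.integrable_bound)
    show "g \<in> borel_measurable (lebesgue_on \<Omega>)" using g by (simp add: L2_on_def)
    have "norm (g x) \<le> 1 + (norm (g x))\<^sup>2" for x
    proof -
      have "2 * norm (g x) \<le> 1 + (norm (g x))\<^sup>2"
        using zero_le_power2[of "norm (g x) - 1"] by (simp add: power2_eq_square algebra_simps)
      then show ?thesis using norm_ge_zero[of "g x"] by linarith
    qed
    then show "AE x in lebesgue_on \<Omega>. norm (g x) \<le> norm (1 + (norm (g x))\<^sup>2)"
      by (intro AE_I2) (metis abs_ge_self order_trans real_norm_def)
  qed
qed

text \<open>\<open>wdiv\<close> is an arbitrary choice among the weak divergences. Testing with
  \<open>cell_bump\<close> and passing to the limit determines its integral over each cell, which is
  all that pairings with piecewise constant functions see.\<close>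

lemma weak_div_cell_int_unique:
  assumes \<Omega>: "\<Omega> \<in> lmeasurable" and c: "cuboid E v" and sub: "interior E \<subseteq> \<Omega>"
    and g: "has_L2_div \<Omega> \<tau> g" and h: "has_L2_div \<Omega> \<tau> h"
  shows "cell_int E (\<lambda>x. g x $ i) = cell_int E (\<lambda>x. h x $ i)"
proof -
  have lim: "(\<lambda>n. \<integral>x. f x $ i * cell_bump v n x \<partial>lebesgue_on \<Omega>) \<longlonglongrightarrow> cell_int E (\<lambda>x. f x $ i)"
    if "L2_on \<Omega> f" for f :: "real^3 \<Rightarrow> real^3"
  proof -
    have fi: "integrable (lebesgue_on \<Omega>) (\<lambda>x. f x $ i)"
      using integrable_bounded_linear[OF bounded_linear_vec_nth L2_on_integrable[OF that \<Omega>]] .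
    have bm: "(\<lambda>x. cell_bump v n x) \<in> borel_measurable (lebesgue_on \<Omega>)" for n
    proof -
      have "continuous_on UNIV (cell_bump v n)" using bump_like_C_k[OF bump_like_cell_bump, of 0] by simp
      then show ?thesis
        by (intro measurable_restrict_space1 measurable_completion) (simp add: borel_measurable_continuous_onI)
    qed
    have im: "interior E \<in> sets (lebesgue_on \<Omega>)" using \<Omega> sub by (auto simp: sets_restrict_space_iff)
    have "(\<lambda>n. \<integral>x. f x $ i * cell_bump v n x \<partial>lebesgue_on \<Omega>) \<longlonglongrightarrow> (\<integral>x. f x $ i * indicator (interior E) x \<partial>lebesgue_on \<Omega>)"
    proof (rule integral_dominated_convergence[where w = "\<lambda>x. norm (f x $ i)"])
      show "(\<lambda>x. f x $ i * indicator (interior E) x) \<in> borel_measurable (lebesgue_on \<Omega>)"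
        using fi im by (intro borel_measurable_times borel_measurable_indicator) auto
      show "(\<lambda>x. f x $ i * cell_bump v n x) \<in> borel_measurable (lebesgue_on \<Omega>)" for n
        using fi bm by (intro borel_measurable_times) auto
      show "integrable (lebesgue_on \<Omega>) (\<lambda>x. norm (f x $ i))" using fi by simp
      show "AE x in lebesgue_on \<Omega>. (\<lambda>n. f x $ i * cell_bump v n x) \<longlonglongrightarrow> f x $ i * indicator (interior E) x"
        by (intro AE_I2 tendsto_intros cell_bump_tendsto[OF c])
      show "AE x in lebesgue_on \<Omega>. norm (f x $ i * cell_bump v n x) \<le> norm (f x $ i)" for n
        using cell_bump_bounds[of v n] by (intro AE_I2) (simp add: abs_mult mult_left_le)
    qed
    also have "(\<integral>x. f x $ i * indicator (interior E) x \<partial>lebesgue_on \<Omega>) = cell_int E (\<lambda>x. f x $ i)"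
    proof -
      have "(\<integral>x. f x $ i * indicator (interior E) x \<partial>lebesgue_on \<Omega>) = (\<integral>x. indicator \<Omega> x *\<^sub>R (f x $ i * indicator (interior E) x) \<partial>lebesgue)"
        using \<Omega> by (intro integral_restrict_space) auto
      also have "\<dots> = (\<integral>x. indicator (interior E) x *\<^sub>R f x $ i \<partial>lebesgue)"
        using sub by (intro Bochner_Integration.integral_cong) (auto simp: indicator_def)
      also have "\<dots> = cell_int E (\<lambda>x. f x $ i)"
        unfolding cell_int_def by (intro integral_restrict_space[symmetric]) auto
      finally show ?thesis .
    qed
    finally show ?thesis .
  qed
  have "(\<integral>x. g x $ i * cell_bump v n x \<partial>lebesgue_on \<Omega>) = (\<integral>x. h x $ i * cell_bump v n x \<partial>lebesgue_on \<Omega>)" for n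
    using g h test_function_cell_bump[OF c sub, of n] unfolding has_L2_div_def by simp
  then show ?thesis
    using lim[of g] lim[of h] g h LIMSEQ_unique unfolding has_L2_div_def by auto
qed

section \<open>The enhanced Raviart-Thomas space\<close>

text \<open>For \<open>q\<close> homogeneous of degree \<open>d\<close>, \<open>curl (x \<times> q) = (div q) x - (d + 2) q\<close>; this gives the
  coefficients below.\<close>

definition ert :: "(nat \<Rightarrow> real) \<Rightarrow> (nat \<Rightarrow> real) \<Rightarrow> (nat \<Rightarrow> real) \<Rightarrow> (nat \<Rightarrow> real) \<Rightarrow> (nat \<Rightarrow> real) \<Rightarrow> real^3 \<Rightarrow> real^3"
  where "ert d e a b c x = vector
    [d 1 + e 1 * x$1 - 3 * a 1 * x$2 - 3 * a 2 * x$3 - 3 * a 3 * (x$1 * x$2) - 3 * a 4 * (x$1 * x$3)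
       - 4 * a 5 * (x$2 * x$3) - 4 * a 6 * (x$1 * x$2 * x$3)
       + b 3 * (x$1 * x$1) + b 5 * (x$1 * x$3) + b 6 * (x$1 * x$1 * x$3)
       + c 4 * (x$1 * x$1) + c 5 * (x$1 * x$2) + c 6 * (x$1 * x$1 * x$2),
     d 2 + e 2 * x$2 - 3 * b 1 * x$1 - 3 * b 2 * x$3 - 3 * b 3 * (x$1 * x$2) - 4 * b 4 * (x$1 * x$3)
       - 3 * b 5 * (x$2 * x$3) - 4 * b 6 * (x$1 * x$2 * x$3)
       + a 3 * (x$2 * x$2) + a 4 * (x$2 * x$3) + a 6 * (x$2 * x$2 * x$3)
       + c 4 * (x$1 * x$2) + c 5 * (x$2 * x$2) + c 6 * (x$1 * x$2 * x$2),
     d 3 + e 3 * x$3 - 3 * c 1 * x$1 - 3 * c 2 * x$2 - 4 * c 3 * (x$1 * x$2) - 3 * c 4 * (x$1 * x$3)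
       - 3 * c 5 * (x$2 * x$3) - 4 * c 6 * (x$1 * x$2 * x$3)
       + a 3 * (x$2 * x$3) + a 4 * (x$3 * x$3) + a 6 * (x$2 * x$3 * x$3)
       + b 3 * (x$1 * x$3) + b 5 * (x$3 * x$3) + b 6 * (x$1 * x$3 * x$3)]"

text \<open>The general trilinear polynomial, so that one derivative formula serves all three
  components of a field in \<open>Bhat\<close>.\<close>

definition bpoly :: "real \<Rightarrow> real \<Rightarrow> real \<Rightarrow> real \<Rightarrow> real \<Rightarrow> real \<Rightarrow> real \<Rightarrow> real \<Rightarrow> real^3 \<Rightarrow> real" where
  "bpoly c1 c2 c3 c12 c13 c23 c123 m x = c1 * x$1 + c2 * x$2 + c3 * x$3 + c12 * (x$1 * x$2) + c13 * (x$1 * x$3)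
     + c23 * (x$2 * x$3) + c123 * (x$1 * x$2 * x$3) + m"

lemma has_derivative_nth: "((\<lambda>x::real^3. x $ i) has_derivative (\<lambda>h. h $ i)) (at x)"
  by (rule bounded_linear_imp_has_derivative[OF bounded_linear_vec_nth])

lemma partial_linear_diff:
  assumes "(f has_derivative f') (at x)" "(g has_derivative g') (at x)"
  shows "partial j (\<lambda>y. y $ i * f y - y $ k * g y) x =
    x $ i * f' (axis j 1) + axis j 1 $ i * f x - (x $ k * g' (axis j 1) + axis j 1 $ k * g x)"
  by (rule partial_eqI[OF has_derivative_diff[OF has_derivative_mult[OF has_derivative_nth assms(1)]
        has_derivative_mult[OF has_derivative_nth assms(2)]]])

lemma has_derivative_bpoly:
  "((\<lambda>x. bpoly c1 c2 c3 c12 c13 c23 c123 m x) has_derivative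
    (\<lambda>h. c1 * h$1 + c2 * h$2 + c3 * h$3 + c12 * (x$1 * h$2 + h$1 * x$2) + c13 * (x$1 * h$3 + h$1 * x$3)
     + c23 * (x$2 * h$3 + h$2 * x$3) + c123 * (x$1 * x$2 * h$3 + (x$1 * h$2 + h$1 * x$2) * x$3))) (at x)"
  unfolding bpoly_def
  by (rule has_derivative_eq_rhs, (rule has_derivative_add has_derivative_mult has_derivative_nth has_derivative_const)+)
     (simp add: algebra_simps)

lemma curl_cross_bpoly:
  fixes q :: "real^3 \<Rightarrow> real^3"
  assumes q: "q = (\<lambda>x. vector
     [bpoly 0 (a 1) (a 2) (a 3) (a 4) (a 5) (a 6) 0 x,
      bpoly (b 1) 0 (b 2) (b 3) (b 4) (b 5) (b 6) 0 x,
      bpoly (c 1) (c 2) 0 (c 3) (c 4) (c 5) (c 6) 0 x])"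
  shows "curl (\<lambda>y. cross3 y (q y)) x = ert (\<lambda>_. 0) (\<lambda>_. 0) a b c x"
proof -
  have r: "(\<lambda>y. cross3 y (q y) $ 1) = (\<lambda>y. y$2 * bpoly (c 1) (c 2) 0 (c 3) (c 4) (c 5) (c 6) 0 y
        - y$3 * bpoly (b 1) 0 (b 2) (b 3) (b 4) (b 5) (b 6) 0 y)"
    "(\<lambda>y. cross3 y (q y) $ 2) = (\<lambda>y. y$3 * bpoly 0 (a 1) (a 2) (a 3) (a 4) (a 5) (a 6) 0 y
        - y$1 * bpoly (c 1) (c 2) 0 (c 3) (c 4) (c 5) (c 6) 0 y)"
    "(\<lambda>y. cross3 y (q y) $ 3) = (\<lambda>y. y$1 * bpoly (b 1) 0 (b 2) (b 3) (b 4) (b 5) (b 6) 0 y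
        - y$2 * bpoly 0 (a 1) (a 2) (a 3) (a 4) (a 5) (a 6) 0 y)"
    by (simp_all add: cross3_def q)
  show ?thesis
    unfolding curl_def r partial_linear_diff[OF has_derivative_bpoly has_derivative_bpoly]
    by (simp add: ert_def bpoly_def axis_def vec_eq_iff forall_3 algebra_simps)
qed

text \<open>Eliminates the curl: from here on the space is handled through its 24 coefficients, six
  from \<open>RT0\<close> and eighteen from \<open>Bhat\<close>.\<close>

lemma ERT0_iff: "p \<in> ERT0 \<longleftrightarrow> (\<exists>d e a b c. p = ert d e a b c)"
proof -
  let ?q = "\<lambda>(a::nat\<Rightarrow>real) (b::nat\<Rightarrow>real) (c::nat\<Rightarrow>real) x::real^3. vector
     [bpoly 0 (a 1) (a 2) (a 3) (a 4) (a 5) (a 6) 0 x,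
      bpoly (b 1) 0 (b 2) (b 3) (b 4) (b 5) (b 6) 0 x,
      bpoly (c 1) (c 2) 0 (c 3) (c 4) (c 5) (c 6) 0 x] :: real^3"
  have q: "q \<in> Bhat \<longleftrightarrow> (\<exists>a b c. q = ?q a b c)" for q
    unfolding Bhat_def bpoly_def by simp
  have split: "vector [d 1 + e 1 * x $ 1, d 2 + e 2 * x $ 2, d 3 + e 3 * x $ 3] + ert (\<lambda>_. 0) (\<lambda>_. 0) a b c x = ert d e a b c x" for d e a b c x
    by (simp add: ert_def vec_eq_iff forall_3)
  show ?thesis
  proof
    assume "p \<in> ERT0"
    then obtain d e :: "nat \<Rightarrow> real" and a b c where "p = (\<lambda>x. vector [d 1 + e 1 * x $ 1, d 2 + e 2 * x $ 2, d 3 + e 3 * x $ 3] + curl (\<lambda>y. cross3 y (?q a b c y)) x)"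
      unfolding ERT0_def RT0_def mem_Collect_eq q by blast
    then have "p = ert d e a b c" unfolding curl_cross_bpoly[OF refl] split .
    then show "\<exists>d e a b c. p = ert d e a b c" by blast
  next
    assume "\<exists>d e a b c. p = ert d e a b c"
    then obtain d e a b c where "p = ert d e a b c" by blast
    then have "p = (\<lambda>x. vector [d 1 + e 1 * x $ 1, d 2 + e 2 * x $ 2, d 3 + e 3 * x $ 3] + curl (\<lambda>y. cross3 y (?q a b c y)) x)"
      unfolding curl_cross_bpoly[OF refl] split .
    moreover have "?q a b c \<in> Bhat" unfolding q by blast
    moreover have "(\<lambda>x. vector [d 1 + e 1 * x $ 1, d 2 + e 2 * x $ 2, d 3 + e 3 * x $ 3]) \<in> RT0"
      unfolding RT0_def by blast
    ultimately show "p \<in> ERT0" unfolding ERT0_def mem_Collect_eq by (intro exI conjI)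
  qed
qed

lemma continuous_ert: "continuous_on UNIV (ert d e a b c)"
proof -
  have "continuous_on UNIV (\<lambda>x. ert d e a b c x $ i)" for i
    using exhaust_3[of i] by (elim disjE) (auto simp: ert_def intro!: continuous_intros)
  then have "continuous_on UNIV (\<lambda>x. \<chi> i. ert d e a b c x $ i)" by (rule continuous_on_vec_lambda)
  then show ?thesis by simp
qed

lemma continuous_ERT0: "p \<in> ERT0 \<Longrightarrow> continuous_on UNIV p"
  using continuous_ert ERT0_iff by metis

lemma ERT0_lincomb:
  assumes "p \<in> ERT0" "q \<in> ERT0" shows "(\<lambda>x. p x + t *\<^sub>R q x) \<in> ERT0"
proof -
  obtain d e a b c d' e' a' b' c' where pq: "p = ert d e a b c" "q = ert d' e' a' b' c'" using assms ERT0_iff by metis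
  have "(\<lambda>x. p x + t *\<^sub>R q x) = ert (\<lambda>i. d i + t * d' i) (\<lambda>i. e i + t * e' i) (\<lambda>i. a i + t * a' i) (\<lambda>i. b i + t * b' i) (\<lambda>i. c i + t * c' i)"
    unfolding pq by (rule ext) (simp add: ert_def vec_eq_iff forall_3 algebra_simps)
  then show ?thesis using ERT0_iff by blast
qed

lemma ERT0_zero: "(\<lambda>x. 0) \<in> ERT0"
proof -
  have "(\<lambda>x. 0) = ert (\<lambda>i. 0) (\<lambda>i. 0) (\<lambda>i. 0) (\<lambda>i. 0) (\<lambda>i. 0)"
    by (rule ext) (simp add: ert_def vec_eq_iff forall_3)
  then show ?thesis using ERT0_iff by blast
qed

lemma rhat_nth:
  "rhat 1 = vector [0,0,0]" "rhat 2 = vector [1,0,0]" "rhat 3 = vector [1,1,0]" "rhat 4 = vector [0,1,0]"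
  "rhat 5 = vector [0,0,1]" "rhat 6 = vector [1,0,1]" "rhat 7 = vector [1,1,1]" "rhat 8 = vector [0,1,1]"
  by (simp_all add: rhat_def)

text \<open>24 coefficients face 24 vertex values. For component i, the four vertices with x_i = 0
  yield the constant term and the three coefficients that occur in no other component; the mixed
  difference over the vertices with x_i = 1 then yields the cubic coefficient. The rest splits into
  pairs governed by the invertible matrix with diagonal -3 and off-diagonal 1, except for the
  \<open>e i\<close>, which come last.\<close>

lemma ERT0_vertex_unisolvent:
  assumes p: "p \<in> ERT0" and z: "\<And>i. i \<in> {1..8} \<Longrightarrow> p (rhat i) = 0"
  shows "p = (\<lambda>x. 0)"
proof -
  obtain d e a b c where pe: "p = ert d e a b c" using p ERT0_iff by metis
  have eqs: "p (rhat k) $ i = 0" if "k \<in> {1..8}" for k i using z[OF that] by simp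
  have x1: "d 1 = 0" "d 1 - 3 * a 1 = 0" "d 1 - 3 * a 2 = 0" "d 1 - 3 * a 1 - 3 * a 2 - 4 * a 5 = 0"
      "d 1 + e 1 + b 3 + c 4 = 0" "d 1 + e 1 - 3 * a 1 - 3 * a 3 + b 3 + c 4 + c 5 + c 6 = 0"
      "d 1 + e 1 - 3 * a 2 - 3 * a 4 + b 3 + b 5 + b 6 + c 4 = 0"
      "d 1 + e 1 - 3 * a 1 - 3 * a 2 - 3 * a 3 - 3 * a 4 - 4 * a 5 - 4 * a 6 + b 3 + b 5 + b 6 + c 4 + c 5 + c 6 = 0"
    using eqs[of 1 1] eqs[of 4 1] eqs[of 5 1] eqs[of 8 1] eqs[of 2 1] eqs[of 3 1] eqs[of 6 1] eqs[of 7 1]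
    unfolding pe rhat_nth by (simp_all add: ert_def)
  have x2: "d 2 = 0" "d 2 - 3 * b 1 = 0" "d 2 - 3 * b 2 = 0" "d 2 - 3 * b 1 - 3 * b 2 - 4 * b 4 = 0"
      "d 2 + e 2 + a 3 + c 5 = 0" "d 2 + e 2 - 3 * b 1 - 3 * b 3 + a 3 + c 4 + c 5 + c 6 = 0"
      "d 2 + e 2 - 3 * b 2 - 3 * b 5 + a 3 + a 4 + a 6 + c 5 = 0"
      "d 2 + e 2 - 3 * b 1 - 3 * b 2 - 3 * b 3 - 4 * b 4 - 3 * b 5 - 4 * b 6 + a 3 + a 4 + a 6 + c 4 + c 5 + c 6 = 0"
    using eqs[of 1 2] eqs[of 2 2] eqs[of 5 2] eqs[of 6 2] eqs[of 4 2] eqs[of 3 2] eqs[of 8 2] eqs[of 7 2]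
    unfolding pe rhat_nth by (simp_all add: ert_def)
  have x3: "d 3 = 0" "d 3 - 3 * c 1 = 0" "d 3 - 3 * c 2 = 0" "d 3 - 3 * c 1 - 3 * c 2 - 4 * c 3 = 0"
      "d 3 + e 3 + a 4 + b 5 = 0" "d 3 + e 3 - 3 * c 1 - 3 * c 4 + a 4 + b 3 + b 5 + b 6 = 0"
      "d 3 + e 3 - 3 * c 2 - 3 * c 5 + a 3 + a 4 + a 6 + b 5 = 0"
      "d 3 + e 3 - 3 * c 1 - 3 * c 2 - 4 * c 3 - 3 * c 4 - 3 * c 5 - 4 * c 6 + a 3 + a 4 + a 6 + b 3 + b 5 + b 6 = 0"
    using eqs[of 1 3] eqs[of 2 3] eqs[of 4 3] eqs[of 3 3] eqs[of 5 3] eqs[of 6 3] eqs[of 8 3] eqs[of 7 3]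
    unfolding pe rhat_nth by (simp_all add: ert_def)
  have 1: "d 1 = 0" "d 2 = 0" "d 3 = 0" "a 1 = 0" "a 2 = 0" "a 5 = 0" "b 1 = 0" "b 2 = 0" "b 4 = 0" "c 1 = 0" "c 2 = 0" "c 3 = 0"
    using x1(1-4) x2(1-4) x3(1-4) by simp_all
  have 2: "a 6 = 0" using x1 by linarith
  have 3: "b 6 = 0" using x2 by linarith
  have 4: "c 6 = 0" using x3 by linarith
  have 5: "a 3 = 0" "c 5 = 0" using x1(5,6) x3(5,7) 1 2 4 by linarith+
  have 6: "a 4 = 0" "b 5 = 0" using x1(5,7) x2(5,7) 1 2 3 by linarith+
  have 7: "b 3 = 0" "c 4 = 0" using x2(5,6) x3(5,6) 1 3 4 by linarith+
  have 8: "e 1 = 0" "e 2 = 0" "e 3 = 0" using x1(5) x2(5) x3(5) 1 5 6 7 by linarith+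
  show ?thesis unfolding pe by (rule ext) (simp add: ert_def vec_eq_iff forall_3 1 2 3 4 5 6 7 8 del: One_nat_def)
qed

text \<open>The normal component on the face \<open>x\<^sub>j = s\<close> is the given affine function; the quadratic
  tangential components make the divergence constant.\<close>

definition ref_face_field :: "3 \<Rightarrow> real \<Rightarrow> real \<Rightarrow> real^3 \<Rightarrow> real^3 \<Rightarrow> real^3" where
  "ref_face_field j s g0 G x = (\<chi> k. if k = j
      then (1 + (2 * s - 1) * (x $ j - s)) * (g0 + (\<Sum>l\<in>UNIV - {j}. G $ l * x $ l))
      else (2 * s - 1) * G $ k * (x $ k - (x $ k)\<^sup>2) / 2)"

lemma ref_face_field_ERT0:
  assumes "s \<in> {0, 1}" shows "ref_face_field j s g0 G \<in> ERT0"
proof -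
  let ?g = "2 * s - 1"
  have U: "UNIV - {1::3} = {2, 3}" "UNIV - {2::3} = {1, 3}" "UNIV - {3::3} = {1, 2}"
    unfolding UNIV_3 by auto
  consider "j = 1" | "j = 2" | "j = 3" using exhaust_3[of j] by blast
  then show ?thesis
  proof cases
    case 1
    \<comment> \<open>Entry 0 of each list is a filler, as the coefficients are numbered from 1. Up
      to the factor \<open>?g * G$2\<close>, the values -3/8 and -1/8 of \<open>a 3\<close> and
      \<open>c 5\<close> solve -3 a + c = 1 and a - 3 c = 0: the first equation produces the product
      x1 x2 in the normal component, the second removes x2 x3 from the third component. The pair
      \<open>a 4\<close>, \<open>b 5\<close> does the same for \<open>G$3\<close>, and the other two
      cases are permutations.\<close>
    have "ref_face_field j s g0 G = ert (\<lambda>i. [0, (1 - s) * g0, 0, 0] ! i) (\<lambda>i. [0, ?g * g0, ?g * G$2 / 2, ?g * G$3 / 2] ! i)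
      (\<lambda>i. [0, (s - 1) * G$2 / 3, (s - 1) * G$3 / 3, - 3 / 8 * ?g * G$2, - 3 / 8 * ?g * G$3, 0, 0] ! i)
      (\<lambda>i. [0, 0, 0, 0, 0, - 1 / 8 * ?g * G$3, 0] ! i) (\<lambda>i. [0, 0, 0, 0, 0, - 1 / 8 * ?g * G$2, 0] ! i)"
      using assms 1 unfolding ref_face_field_def ert_def
      by (intro ext) (elim insertE emptyE; simp add: vec_eq_iff forall_3 U field_simps power2_eq_square)
    then show ?thesis using ERT0_iff by blast
  next
    case 2
    have "ref_face_field j s g0 G = ert (\<lambda>i. [0, 0, (1 - s) * g0, 0] ! i) (\<lambda>i. [0, ?g * G$1 / 2, ?g * g0, ?g * G$3 / 2] ! i)
      (\<lambda>i. [0, 0, 0, 0, - 1 / 8 * ?g * G$3, 0, 0] ! i)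
      (\<lambda>i. [0, (s - 1) * G$1 / 3, (s - 1) * G$3 / 3, - 3 / 8 * ?g * G$1, 0, - 3 / 8 * ?g * G$3, 0] ! i)
      (\<lambda>i. [0, 0, 0, 0, - 1 / 8 * ?g * G$1, 0, 0] ! i)"
      using assms 2 unfolding ref_face_field_def ert_def
      by (intro ext) (elim insertE emptyE; simp add: vec_eq_iff forall_3 U field_simps power2_eq_square)
    then show ?thesis using ERT0_iff by blast
  next
    case 3
    have "ref_face_field j s g0 G = ert (\<lambda>i. [0, 0, 0, (1 - s) * g0] ! i) (\<lambda>i. [0, ?g * G$1 / 2, ?g * G$2 / 2, ?g * g0] ! i)
      (\<lambda>i. [0, 0, 0, - 1 / 8 * ?g * G$2, 0, 0, 0] ! i)
      (\<lambda>i. [0, 0, 0, - 1 / 8 * ?g * G$1, 0, 0, 0] ! i)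
      (\<lambda>i. [0, (s - 1) * G$1 / 3, (s - 1) * G$2 / 3, 0, - 3 / 8 * ?g * G$1, - 3 / 8 * ?g * G$2, 0] ! i)"
      using assms 3 unfolding ref_face_field_def ert_def
      by (intro ext) (elim insertE emptyE; simp add: vec_eq_iff forall_3 U field_simps power2_eq_square)
    then show ?thesis using ERT0_iff by blast
  qed
qed

section \<open>Faces of the mesh\<close>

definition cell_face :: "(real^3) set \<Rightarrow> (nat \<Rightarrow> real^3) \<Rightarrow> 3 \<Rightarrow> real \<Rightarrow> (real^3) set" where
  "cell_face E v j s = {x \<in> E. height v j s x = 0}"

lemma aff_dim_cuboid: "cuboid E v \<Longrightarrow> aff_dim E = 3"
  using cuboid_center[of E v] aff_dim_nonempty_interior[of E] by auto

context
  fixes E v s and j :: 3 assumes c: "cuboid E v" and s: "s \<in> {0, 1::real}"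
begin

text \<open>\<open>height\<close> is affine and at most 0 on the cell, so its zero set is a
  supporting hyperplane.\<close>

lemma cell_face_face_of: "cell_face E v j s face_of E"
proof -
  let ?o = "outward v j s"
  define p where "p = face_proj v j s 0"
  have hp: "height v j s p = 0" unfolding p_def by (rule height_face_proj[OF c s])
  have oo: "?o \<bullet> ?o > 0" using outward_nonzero[OF c s, of j] by simp
  have h: "height v j s x = (?o \<bullet> x - ?o \<bullet> p) / (?o \<bullet> ?o)" for x
    unfolding height_inner[OF c s hp] inner_diff_left by (simp add: inner_commute)
  have "?o \<bullet> x \<le> ?o \<bullet> p" if "x \<in> E" for x
    using mem_cuboid_iff_height[OF c s, of x j] that oo unfolding h by (simp add: divide_le_0_iff)
  then have "(E \<inter> {x. ?o \<bullet> x = ?o \<bullet> p}) face_of E"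
    by (intro face_of_Int_supporting_hyperplane_le cuboid_compact_convex(2)[OF c])
  moreover have "E \<inter> {x. ?o \<bullet> x = ?o \<bullet> p} = cell_face E v j s"
    unfolding cell_face_def h using oo by auto
  ultimately show ?thesis by simp
qed

lemma cell_face_ne: "cell_face E v j s \<noteq> E"
proof
  assume "cell_face E v j s = E"
  then have "height v j s (cell_map v (\<chi> k. 1/2)) = 0"
    using cuboid_center[OF c] interior_subset[of E] unfolding cell_face_def by blast
  then show False using mem_interior_height[OF c s cuboid_center[OF c], of j] by simp
qed

text \<open>Together with one point on the inward normal the face has the whole cell in its affine
  hull, so it loses at most one dimension; being a proper face, it loses at least one.\<close>

lemma aff_dim_cell_face: "aff_dim (cell_face E v j s) = 2"
proof -
  let ?F = "cell_face E v j s" and ?o = "outward v j s"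
  define p where "p = face_proj v j s (cell_map v (\<chi> k. 1/2))"
  have "p \<in> E" unfolding p_def using cuboid_center[OF c] interior_subset[of E] mem_cuboid_iff_height[OF c s] by blast
  then have pF: "p \<in> ?F" unfolding cell_face_def using height_face_proj[OF c s] by (simp add: p_def)
  have "E \<subseteq> affine hull (insert (p - ?o) ?F)" (is "_ \<subseteq> ?A")
  proof
    fix x assume x: "x \<in> E"
    have "face_proj v j s x \<in> ?F" unfolding cell_face_def
      using x mem_cuboid_iff_height[OF c s, of x j] height_face_proj[OF c s] by simp
    then have "face_proj v j s x \<in> ?A" "p \<in> ?A" "p - ?o \<in> ?A" using pF by (auto intro: hull_inc)
    then have "face_proj v j s x + height v j s x *\<^sub>R (p - (p - ?o)) \<in> ?A"
      by (intro mem_affine_3_minus affine_affine_hull)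
    then show "x \<in> ?A" by (simp add: face_proj_def)
  qed
  then have "aff_dim E \<le> aff_dim (insert (p - ?o) ?F)" by (metis aff_dim_affine_hull aff_dim_subset)
  also have "\<dots> \<le> aff_dim ?F + 1" by (simp add: aff_dim_insert)
  finally have "2 \<le> aff_dim ?F" by (simp add: aff_dim_cuboid[OF c])
  moreover have "aff_dim ?F < aff_dim E"
    by (rule face_of_aff_dim_lt[OF cuboid_compact_convex(2)[OF c] cell_face_face_of cell_face_ne])
  ultimately show ?thesis by (simp add: aff_dim_cuboid[OF c])
qed

text \<open>The point \<open>z\<close> is relatively interior to the cell face, so a segment from
  any \<open>x\<close> of the cell face to \<open>z\<close> can be prolonged beyond \<open>z\<close>
  within the cell face. Then \<open>z\<close> is an inner point of the longer segment, and the
  definition of a face puts \<open>x\<close> into \<open>W\<close>.\<close>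

lemma cell_face_subset_face:
  assumes z: "z \<in> cell_face E v j s" "\<And>k. k \<noteq> j \<Longrightarrow> 0 < loc v k z \<and> loc v k z < 1"
    and W: "W face_of S" "cell_face E v j s \<subseteq> S" "z \<in> W"
  shows "cell_face E v j s \<subseteq> W"
proof
  fix x assume x: "x \<in> cell_face E v j s"
  show "x \<in> W"
  proof (cases "x = z")
    case False
    have lj: "loc v j y = s" if "y \<in> cell_face E v j s" for y
      using that s by (auto simp: cell_face_def height_def)
    \<comment> \<open>A lower bound for the distances of the tangential coordinates of
      \<open>z\<close> from 0 and 1, with filler 1 at index \<open>j\<close>. As coordinates in the
      cell differ by at most 1, prolonging the segment by this fraction keeps them in
      [0, 1].\<close>
    define \<delta> where "\<delta> = Min (range (\<lambda>k. if k = j then 1 else min (loc v k z) (1 - loc v k z)))"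
    have d: "\<delta> > 0" unfolding \<delta>_def by (subst Min_gr_iff) (use z(2) in auto)
    have dk: "\<delta> \<le> loc v k z" "\<delta> \<le> 1 - loc v k z" if "k \<noteq> j" for k
    proof -
      have "\<delta> \<le> (if k = j then 1 else min (loc v k z) (1 - loc v k z))" unfolding \<delta>_def by (intro Min_le) auto
      then show "\<delta> \<le> loc v k z" "\<delta> \<le> 1 - loc v k z" using that by auto
    qed
    define y where "y = z + \<delta> *\<^sub>R (z - x)"
    have ly: "loc v k y = loc v k z + \<delta> * (loc v k z - loc v k x)" for k
      unfolding y_def loc_def by (simp add: inner_diff_left inner_add_left algebra_simps flip: add_divide_distrib diff_divide_distrib)
    have "0 \<le> loc v k y \<and> loc v k y \<le> 1" for k
    proof (cases "k = j")
      case True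
      then show ?thesis unfolding ly using lj[OF x] lj[OF z(1)] s by auto
    next
      case False
      have "0 \<le> loc v k x" "loc v k x \<le> 1" using x mem_cuboid_iff[OF c, of x] by (auto simp: cell_face_def)
      then have "\<delta> * loc v k x \<le> \<delta>" "0 \<le> \<delta> * loc v k x" using d by (auto simp: mult_left_le)
      moreover have "0 \<le> \<delta> * loc v k z" "\<delta> * loc v k z \<le> \<delta>" using d z(2)[OF False] by (auto simp: mult_left_le)
      ultimately show ?thesis using dk[OF False] unfolding ly right_diff_distrib by linarith
    qed
    then have "y \<in> cell_face E v j s"
      using ly[of j] lj[OF x] lj[OF z(1)] by (simp add: cell_face_def mem_cuboid_iff[OF c] height_def)
    moreover have "z \<in> open_segment x y"
    proof -
      have "(1 - u) *\<^sub>R x + u *\<^sub>R y = (1 - u * (1 + \<delta>)) *\<^sub>R x + (u * (1 + \<delta>)) *\<^sub>R z" for u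
        unfolding y_def by (simp add: algebra_simps)
      from this[of "1 / (1 + \<delta>)"] have "z = (1 - 1 / (1 + \<delta>)) *\<^sub>R x + (1 / (1 + \<delta>)) *\<^sub>R y"
        using d by simp
      moreover have "0 < 1 / (1 + \<delta>)" "1 / (1 + \<delta>) < 1" using d by simp_all
      moreover have "x \<noteq> y" 
      proof
        assume "x = y"
        then have "(1 + \<delta>) *\<^sub>R (z - x) = 0" unfolding y_def by (simp add: algebra_simps)
        then show False using d False by simp
      qed
      ultimately show ?thesis unfolding in_segment by blast
    qed
    ultimately show ?thesis using W x unfolding face_of_def by blast
  qed (use W in simp)
qed

end

text \<open>A relatively interior point of a facet is not interior to the cell, so one of its
  coordinates is 0 or 1. The corresponding cell face then contains the whole facet, and both have
  dimension 2.\<close>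

lemma cuboid_facet:
  assumes c: "cuboid E v" and e: "e facet_of E"
  obtains j s where "s \<in> {0, 1}" "e = cell_face E v j s"
proof -
  have f: "e face_of E" "e \<noteq> {}" "aff_dim e = 2" using e aff_dim_cuboid[OF c] by (auto simp: facet_of_def)
  have cv: "convex e" using f(1) face_of_imp_convex by blast
  then obtain x where x: "x \<in> rel_interior e" using f(2) rel_interior_eq_empty by blast
  have ne: "e \<noteq> E" using f(3) aff_dim_cuboid[OF c] by auto
  have xe: "x \<in> e" "x \<in> E" using x f(1) rel_interior_subset face_of_imp_subset by blast+
  then have "x \<notin> interior E" using face_of_disjoint_interior[OF f(1) ne] by blast
  then obtain j where j: "\<not> (0 < loc v j x \<and> loc v j x < 1)" by (auto simp: mem_interior_cuboid_iff[OF c])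
  have "0 \<le> loc v j x" "loc v j x \<le> 1" using xe(2) by (auto simp: mem_cuboid_iff[OF c])
  with j obtain s where s: "s \<in> {0, 1}" "loc v j x = s" by force
  have F: "cell_face E v j s face_of E" by (rule cell_face_face_of[OF c s(1)])
  have "x \<in> cell_face E v j s" using xe s(2) by (simp add: cell_face_def height_def)
  then have sub: "e \<subseteq> cell_face E v j s"
    using subset_of_face_of[OF F face_of_imp_subset[OF f(1)]] x by blast
  then have "e face_of cell_face E v j s"
    using face_of_subset[OF f(1)] face_of_imp_subset[OF F] by blast
  then have "e = cell_face E v j s"
    using face_of_aff_dim_lt[OF face_of_imp_convex[OF F]] f(3) aff_dim_cell_face[OF c s(1), of j] by force
  then show ?thesis using that s(1) by blast
qed

section \<open>Consequences of conformity: cells, boundary faces and the domain\<close>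

locale meshed_domain =
  fixes \<Omega> \<Gamma>D \<Gamma>N :: "(real^3) set" and T :: "(real^3) set set"
    and r :: "(real^3) set \<Rightarrow> nat \<Rightarrow> real^3" and \<kappa> :: real
  assumes open_dom: "open \<Omega>" and connected_dom: "connected \<Omega>" and ne_dom: "\<Omega> \<noteq> {}" and bounded_dom: "bounded \<Omega>"
    and mesh: "cuboid_mesh \<Omega> T r \<kappa>"
    and bdry: "boundary_partition \<Omega> T \<Gamma>D \<Gamma>N" and ne_D: "\<Gamma>D \<noteq> {}"
begin

lemma finite_T: "finite T" and cells: "E \<in> T \<Longrightarrow> cuboid E (r E)"
  and Union_T: "\<Union>T = closure \<Omega>"
  and conforming: "E \<in> T \<Longrightarrow> E' \<in> T \<Longrightarrow> (E \<inter> E') face_of E" "E \<in> T \<Longrightarrow> E' \<in> T \<Longrightarrow> (E \<inter> E') face_of E'"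
  using mesh unfolding cuboid_mesh_def by blast+

lemma lmeasurable_dom: "\<Omega> \<in> lmeasurable"
  using open_dom bounded_dom by (rule lmeasurable_open[rotated])

text \<open>The intersection is a face of \<open>E\<close> that meets the interior, hence all of
  \<open>E\<close>. So \<open>E\<close> is a face of \<open>E'\<close> of full dimension.\<close>

lemma cells_eq_of_interior:
  assumes "E \<in> T" "E' \<in> T" "x \<in> interior E" "x \<in> E'" shows "E = E'"
proof -
  have "E \<inter> E' = E"
    using face_of_disjoint_interior[OF conforming(1)[OF assms(1,2)]] assms(3,4) interior_subset[of E] by blast
  then have "E face_of E'" using conforming(2)[OF assms(1,2)] by simp
  then show ?thesis
    using face_of_aff_dim_lt[of E' E] cuboid_compact_convex(2) cells assms(1,2) by (metis aff_dim_cuboid less_irrefl)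
qed

text \<open>The cells cover the closure of \<Omega>, so a crack running through a cell has to be
  excluded. A boundary point lies on a facet of some cell; if it were interior to \<open>E\<close>,
  that cell would be \<open>E\<close>, but a facet avoids the interior.\<close>

lemma interior_subset_dom:
  assumes E: "E \<in> T" shows "interior E \<subseteq> \<Omega>"
proof
  fix x assume x: "x \<in> interior E"
  show "x \<in> \<Omega>"
  proof (rule ccontr)
    assume "x \<notin> \<Omega>"
    moreover have "x \<in> closure \<Omega>" using x E interior_subset[of E] Union_T by blast
    ultimately have "x \<in> frontier \<Omega>" using open_dom by (simp add: frontier_def interior_open)
    then obtain e where "e \<in> mesh_faces T" "x \<in> e" using bdry unfolding boundary_partition_def by blast
    then obtain E' where E': "E' \<in> T" "e facet_of E'" "x \<in> e" unfolding mesh_faces_def by blast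
    then have e: "e face_of E'" "aff_dim e = aff_dim E' - 1" by (auto simp: facet_of_def)
    have "E = E'" using cells_eq_of_interior[OF E E'(1) x] E'(3) face_of_imp_subset[OF e(1)] by blast
    then have "e = E'" using face_of_disjoint_interior[OF e(1)] x E'(3) by blast
    then show False using e(2) by simp
  qed
qed

lemma negligible_skeleton: "negligible (\<Omega> - (\<Union>E\<in>T. interior E))"
proof (rule negligible_subset)
  show "negligible (\<Union>E\<in>T. frontier E)"
    using finite_T cells cuboid_compact_convex(2) negligible_convex_frontier by (intro negligible_Union) blast+
  show "\<Omega> - (\<Union>E\<in>T. interior E) \<subseteq> (\<Union>E\<in>T. frontier E)"
  proof
    fix x assume x: "x \<in> \<Omega> - (\<Union>E\<in>T. interior E)"
    then have "x \<in> \<Union>T" using Union_T closure_subset by blast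
    then show "x \<in> (\<Union>E\<in>T. frontier E)" using x closure_subset unfolding frontier_def by blast
  qed
qed

lemma T_nonempty: "T \<noteq> {}" using Union_T ne_dom closure_subset[of \<Omega>] by auto

text \<open>The normal condition is imposed on every facet contained in the point set \<Gamma>N, so
  one must know that Neumann faces do not cover a Dirichlet face. Otherwise the midpoint of the
  latter would lie on a Neumann face, and conformity would make the two faces equal, against
  disjointness of the two families.\<close>

lemma dirichlet_face:
  obtains E j s where "E \<in> T" "s \<in> {0, 1}" "cell_face E (r E) j s \<subseteq> frontier \<Omega>" "\<not> cell_face E (r E) j s \<subseteq> \<Gamma>N"
proof -
  obtain FD FN where F: "FD \<subseteq> mesh_faces T" "FN \<subseteq> mesh_faces T" "FD \<inter> FN = {}" "\<Gamma>D = \<Union>FD" "\<Gamma>N = \<Union>FN"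
    and fr: "frontier \<Omega> = \<Gamma>D \<union> \<Gamma>N"
    using bdry unfolding boundary_partition_def by blast
  obtain e where e: "e \<in> FD" using ne_D F(4) by blast
  then obtain E where E: "E \<in> T" "e facet_of E" using F(1) unfolding mesh_faces_def by blast
  note c = cells[OF E(1)]
  obtain j s where s: "s \<in> {0, 1}" and ej: "e = cell_face E (r E) j s" using cuboid_facet[OF c E(2)] by blast
  have "\<not> e \<subseteq> \<Gamma>N"
  proof
    assume sub: "e \<subseteq> \<Gamma>N"
    define m where "m = cell_map (r E) (\<chi> k. if k = j then s else 1/2)"
    have lm: "loc (r E) k m = (if k = j then s else 1/2)" for k by (simp add: m_def loc_cell_map[OF c])
    have me: "m \<in> e" unfolding ej using s by (auto simp: cell_face_def mem_cuboid_iff[OF c] lm height_def)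
    have lm': "0 < loc (r E) k m \<and> loc (r E) k m < 1" if "k \<noteq> j" for k using that by (simp add: lm)
    obtain e' where e': "e' \<in> FN" "m \<in> e'" using sub me F(5) by blast
    then obtain E' where E': "E' \<in> T" "e' facet_of E'" using F(2) unfolding mesh_faces_def by blast
    note c' = cells[OF E'(1)]
    have fe': "e' face_of E'" "aff_dim e' = 2" using E'(2) aff_dim_cuboid[OF c'] by (auto simp: facet_of_def)
    have fe: "e face_of E" "aff_dim e = 2" using E(2) aff_dim_cuboid[OF c] by (auto simp: facet_of_def)
    have "m \<in> E \<inter> E'" using me e'(2) face_of_imp_subset[OF fe(1)] face_of_imp_subset[OF fe'(1)] by blast
    from cell_face_subset_face[OF c s me[unfolded ej] lm' conforming(1)[OF E(1) E'(1)] _ this]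
    have eK: "e \<subseteq> E \<inter> E'" using face_of_imp_subset[OF fe(1)] unfolding ej by blast
    from cell_face_subset_face[OF c s me[unfolded ej] lm' fe'(1) _ e'(2)]
    have ee': "e \<subseteq> e'" using eK unfolding ej by blast
    have "e face_of (E \<inter> E')" using face_of_subset[OF fe(1) eK] by blast
    then have "e face_of E'" using conforming(2)[OF E(1) E'(1)] face_of_trans by blast
    then have "e face_of e'" using face_of_subset ee' face_of_imp_subset[OF fe'(1)] by blast
    then have "e = e'" using face_of_aff_dim_lt[of e' e] face_of_imp_convex[OF fe'(1)] fe fe' by force
    then show False using e e'(1) F(3) by blast
  qed
  then show ?thesis using that E(1) s ej fr F(4) e by blast
qed

end

text \<open>The normal \<open>w\<close> is the combination of edges \<open>j\<close> and
  \<open>k\<close> whose inner products with them are \<open>a\<close> and \<open>b\<close>; hence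
  it is nonzero and the set is a hyperplane.\<close>

lemma negligible_loc_plane:
  assumes c: "cuboid E v" and ne: "a \<noteq> 0 \<or> b \<noteq> 0" and jk: "j \<noteq> k"
  shows "negligible {y. a * (loc v j y - s) + b * (loc v k y - t) = 0}"
proof -
  define w where "w = (a / (edge v j \<bullet> edge v j)) *\<^sub>R edge v j + (b / (edge v k \<bullet> edge v k)) *\<^sub>R edge v k"
  have "w \<bullet> edge v j = a" "w \<bullet> edge v k = b"
    using edge_inner_pos[OF c, of j] edge_inner_pos[OF c, of k] edge_orthogonal[OF c jk] edge_orthogonal[OF c jk[symmetric]]
    by (simp_all add: w_def inner_add_left)
  then have "w \<noteq> 0" using ne by auto
  moreover have "a * (loc v j y - s) + b * (loc v k y - t) = w \<bullet> y - (w \<bullet> v 1 + a * s + b * t)" for y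
  proof -
    have "a * loc v j y + b * loc v k y = w \<bullet> y - w \<bullet> v 1"
      by (simp add: w_def loc_def inner_add_left inner_diff_left inner_commute[of y] inner_commute[of "v 1"] algebra_simps diff_divide_distrib del: One_nat_def)
    then show ?thesis unfolding right_diff_distrib by linarith
  qed
  then have "{y. a * (loc v j y - s) + b * (loc v k y - t) = 0} = {y. w \<bullet> y = w \<bullet> v 1 + a * s + b * t}"
    by (simp only: right_minus_eq)
  ultimately show ?thesis using negligible_hyperplane[of w] by simp
qed

lemma open_not_subset_negligible:
  assumes "open U" "U \<noteq> {}" "negligible N" obtains x :: "'a::euclidean_space" where "x \<in> U" "x \<notin> N"
  using assms open_not_negligible negligible_subset by blast

context meshed_domain
begin

text \<open>By \<open>off\<close> the point \<open>z\<close> is relatively interior to one face of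
  the cell, and the intersection of the cells, being a face, contains that face entirely. Its
  dimension is less than 3, so it is no larger.\<close>

lemma adjacent_cells_common_face:
  assumes E: "E \<in> T" and E': "E' \<in> T" and ne: "E \<noteq> E'" and z: "z \<in> E \<inter> E'"
    and off: "\<And>j k. j \<noteq> k \<Longrightarrow> \<not> (loc (r E) j z \<in> {0, 1} \<and> loc (r E) k z \<in> {0, 1})"
  obtains j s where "s \<in> {0, 1}" "E \<inter> E' = cell_face E (r E) j s"
proof -
  note c = cells[OF E]
  let ?K = "E \<inter> E'"
  have "z \<notin> interior E" using cells_eq_of_interior[OF E E'] z ne by blast
  then obtain j where j: "\<not> (0 < loc (r E) j z \<and> loc (r E) j z < 1)" by (auto simp: mem_interior_cuboid_iff[OF c])
  have b: "0 \<le> loc (r E) k z" "loc (r E) k z \<le> 1" for k using z by (auto simp: mem_cuboid_iff[OF c])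
  obtain s where s: "s \<in> {0, 1}" "loc (r E) j z = s" using j b[of j] by force
  have lt: "0 < loc (r E) k z \<and> loc (r E) k z < 1" if "k \<noteq> j" for k
    using off[OF that] b[of k] s by auto
  have zF: "z \<in> cell_face E (r E) j s" using z s by (simp add: cell_face_def height_def)
  have F: "cell_face E (r E) j s face_of E" by (rule cell_face_face_of[OF c s(1)])
  have sub: "cell_face E (r E) j s \<subseteq> ?K"
    by (rule cell_face_subset_face[OF c s(1) zF lt conforming(1)[OF E E'] face_of_imp_subset[OF F] z])
  have KE: "?K \<noteq> E"
  proof
    assume "?K = E"
    then have "cell_map (r E) (\<chi> k. 1/2) \<in> E'" using cuboid_center[OF c] interior_subset[of E] by blast
    then show False using cells_eq_of_interior[OF E E' cuboid_center[OF c]] ne by blast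
  qed
  have K2: "aff_dim ?K < 3"
    using face_of_aff_dim_lt[OF cuboid_compact_convex(2)[OF c] conforming(1)[OF E E'] KE] aff_dim_cuboid[OF c] by simp
  have "cell_face E (r E) j s face_of ?K" using face_of_subset[OF F sub] by blast
  then have "cell_face E (r E) j s = ?K"
    using face_of_aff_dim_lt[of ?K "cell_face E (r E) j s"] face_of_imp_convex[OF conforming(1)[OF E E']] K2
      aff_dim_cell_face[OF c s(1), of j] by linarith
  then show ?thesis using that s(1) by metis
qed

lemma finite_cell_subset_closed: "C \<subseteq> T \<Longrightarrow> closed (\<Union>C)"
  using finite_T finite_subset cells cuboid_compact_convex(3) by (intro closed_Union) blast+

text \<open>A tuple names the line on which two reference coordinates of a cell are fixed at 0 or 1,
  that is, the line carrying an edge of the mesh.\<close>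

definition edge_index :: "((real^3) set \<times> 3 \<times> 3 \<times> real \<times> real) set" where
  "edge_index = {(E, j, k, s, t). E \<in> T \<and> j \<noteq> k \<and> s \<in> {0, 1} \<and> t \<in> {0, 1}}"

lemma finite_edge_index: "finite edge_index"
  by (rule finite_subset[of _ "T \<times> UNIV \<times> UNIV \<times> {0, 1} \<times> {0, 1}"])
     (auto simp: edge_index_def finite_T)

text \<open>A generic segment joining two cells inside a ball of the domain misses all mesh edges,
  so it has to pass from one class of cells to the other through a relatively open face.\<close>

lemma adjacent_across:
  assumes C: "C \<subseteq> T" "C \<noteq> {}" "C \<noteq> T"
  obtains E E' j s j' s' z where "E \<in> C" "E' \<in> T - C" "s \<in> {0, 1}" "s' \<in> {0, 1}"
    "E \<inter> E' = cell_face E (r E) j s" "E \<inter> E' = cell_face E' (r E') j' s'" "z \<in> E \<inter> E'" "z \<in> \<Omega>"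
proof -
  let ?S = "\<Union>C" and ?S' = "\<Union>(T - C)"
  have cl: "closed ?S" "closed ?S'" using C(1) finite_cell_subset_closed by blast+
  have cover: "\<Omega> \<subseteq> ?S \<union> ?S'" using Union_T closure_subset C(1) by blast
  obtain E1 E1' where "E1 \<in> C" "E1' \<in> T - C" using C by blast
  then have "?S \<inter> \<Omega> \<noteq> {}" "?S' \<inter> \<Omega> \<noteq> {}"
    using interior_subset_dom[of E1] interior_subset_dom[of E1'] cuboid_center[OF cells, of E1] cuboid_center[OF cells, of E1']
      interior_subset[of E1] interior_subset[of E1'] C(1) by blast+
  \<comment> \<open>Connectedness of the domain gives a point common to both closed unions. It may
    lie on a mesh edge, so it only serves to find a ball in which both classes have interior
    points.\<close>
  then obtain p where p: "p \<in> \<Omega>" "p \<in> ?S" "p \<in> ?S'"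
    using connected_closedD[OF connected_dom _ cover cl] by blast
  then obtain E0 E0' where E0: "E0 \<in> C" "p \<in> E0" and E0': "E0' \<in> T - C" "p \<in> E0'" by blast
  obtain \<epsilon> where e: "\<epsilon> > 0" "ball p \<epsilon> \<subseteq> \<Omega>" using open_dom p(1) open_contains_ball by blast
  let ?B = "ball p \<epsilon>"
  have ne: "?B \<inter> interior E \<noteq> {}" if "E \<in> T" "p \<in> E" for E
  proof -
    have "p \<in> closure (interior E)" using that closure_interior_cuboid[OF cells] by blast
    moreover have "p \<in> ?B" using e(1) by simp
    ultimately show ?thesis using open_Int_closure_eq_empty[of ?B "interior E"] by blast
  qed
  have U: "open (?B \<inter> interior E0)" "?B \<inter> interior E0 \<noteq> {}" "open (?B \<inter> interior E0')" "?B \<inter> interior E0' \<noteq> {}"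
    using ne[of E0] ne[of E0'] E0 E0' C(1) by auto
  define L where "L = (\<lambda>(E, j, k, s, t). {x. loc (r E) j x = s \<and> loc (r E) k x = t})"
  have "negligible (L i)" if "i \<in> edge_index" for i
  proof -
    obtain E j k s t where i: "i = (E, j, k, s, t)" by (cases i) auto
    with that have E: "E \<in> T" "j \<noteq> k" by (auto simp: edge_index_def)
    have "L i \<subseteq> {y. 1 * (loc (r E) j y - s) + 0 * (loc (r E) k y - t) = 0}" by (auto simp: L_def i)
    moreover have "negligible {y. 1 * (loc (r E) j y - s) + 0 * (loc (r E) k y - t) = 0}"
      by (rule negligible_loc_plane[OF cells[OF E(1)] _ E(2)]) simp
    ultimately show ?thesis using negligible_subset by blast
  qed
  then have "negligible (\<Union>(L ` edge_index))" using finite_edge_index by (intro negligible_Union) auto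
  then obtain x where x: "x \<in> ?B \<inter> interior E0" "x \<notin> \<Union>(L ` edge_index)"
    using open_not_subset_negligible[OF U(1,2)] by blast
  \<comment> \<open>For \<open>x\<close> off the line this is the plane through \<open>x\<close> and
    the line. Its equation vanishes at \<open>x\<close> and on the line but not at \<open>y\<close>,
    and it is affine along the segment; a point of the segment on the line could therefore only be
    \<open>x\<close>, which was chosen off all these lines.\<close>
  define P where "P = (\<lambda>(E, j, k, s, t).
    {y. (loc (r E) k x - t) * (loc (r E) j y - s) + (- (loc (r E) j x - s)) * (loc (r E) k y - t) = 0})"
  have "negligible (P i)" if "i \<in> edge_index" for i
  proof -
    obtain E j k s t where i: "i = (E, j, k, s, t)" by (cases i) auto
    with that have E: "E \<in> T" "j \<noteq> k" by (auto simp: edge_index_def)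
    have "x \<notin> L i" using x(2) that by blast
    then have "loc (r E) k x - t \<noteq> 0 \<or> - (loc (r E) j x - s) \<noteq> 0" by (auto simp: L_def i)
    from negligible_loc_plane[OF cells[OF E(1)] this E(2)] show ?thesis by (simp add: P_def i)
  qed
  then have "negligible (\<Union>(P ` edge_index))" using finite_edge_index by (intro negligible_Union) auto
  then obtain y where y: "y \<in> ?B \<inter> interior E0'" "y \<notin> \<Union>(P ` edge_index)"
    using open_not_subset_negligible[OF U(3,4)] by blast
  have seg: "closed_segment x y \<subseteq> ?B" using x(1) y(1) by (intro closed_segment_subset) auto
  have "?S \<inter> closed_segment x y \<noteq> {}" "?S' \<inter> closed_segment x y \<noteq> {}"
    using x(1) y(1) E0(1) E0'(1) interior_subset[of E0] interior_subset[of E0'] by auto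
  moreover have "closed_segment x y \<subseteq> ?S \<union> ?S'" using seg e(2) cover by blast
  ultimately obtain z where z: "z \<in> closed_segment x y" "z \<in> ?S" "z \<in> ?S'"
    using connected_closedD[OF connected_segment(1)[of x y] _ _ cl] by blast
  obtain E E' where E: "E \<in> C" "z \<in> E" and E': "E' \<in> T - C" "z \<in> E'" using z by blast
  have off: "\<not> (loc (r F) j z \<in> {0, 1} \<and> loc (r F) k z \<in> {0, 1})" if F: "F \<in> T" and jk: "j \<noteq> k" for F j k
  proof
    assume a: "loc (r F) j z \<in> {0, 1} \<and> loc (r F) k z \<in> {0, 1}"
    define s where "s = loc (r F) j z"
    define t where "t = loc (r F) k z"
    have i: "(F, j, k, s, t) \<in> edge_index" using a F jk by (auto simp: edge_index_def s_def t_def)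
    obtain \<theta> where th: "0 \<le> \<theta>" "\<theta> \<le> 1" "z = (1 - \<theta>) *\<^sub>R x + \<theta> *\<^sub>R y" using z(1) by (auto simp: in_segment)
    have lz: "loc (r F) l z = (1 - \<theta>) * loc (r F) l x + \<theta> * loc (r F) l y" for l
      unfolding th(3) loc_affine by (simp add: inner_add_right algebra_simps add_divide_distrib diff_divide_distrib)
    define q where "q w = (loc (r F) k x - t) * (loc (r F) j w - s) + (- (loc (r F) j x - s)) * (loc (r F) k w - t)" for w
    have "q z = (1 - \<theta>) * q x + \<theta> * q y" unfolding q_def lz by (simp add: algebra_simps)
    moreover have "q z = 0" by (simp add: q_def s_def t_def)
    moreover have "q x = 0" unfolding q_def minus_mult_left[symmetric] by simp
    moreover have "q y \<noteq> 0" using y(2) i unfolding P_def q_def by force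
    ultimately have "\<theta> = 0" by simp
    then have "z = x" using th(3) by simp
    then have "x \<in> L (F, j, k, s, t)" by (simp add: L_def s_def t_def)
    with i have "x \<in> \<Union>(L ` edge_index)" by (rule UN_I)
    with x(2) show False by (rule notE)
  qed
  have ET: "E \<in> T" "E' \<in> T" "E \<noteq> E'" using E E' C(1) by auto
  have zE: "z \<in> E \<inter> E'" "z \<in> E' \<inter> E" using E(2) E'(2) by simp_all
  obtain j s where 1: "s \<in> {0, 1}" "E \<inter> E' = cell_face E (r E) j s"
    by (rule adjacent_cells_common_face[OF ET zE(1) off[OF ET(1)]])
  obtain j' s' where 2: "s' \<in> {0, 1}" "E' \<inter> E = cell_face E' (r E') j' s'"
    by (rule adjacent_cells_common_face[OF ET(2,1) ET(3)[symmetric] zE(2) off[OF ET(2)]])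
  have 3: "E \<inter> E' = cell_face E' (r E') j' s'" using 2(2) by (simp add: Int_commute)
  have "z \<in> \<Omega>" using z(1) seg e(2) by blast
  then show ?thesis by (rule that[OF E(1) E'(1) 1(1) 2(1) 1(2) 3 zE(1)])
qed

end

section \<open>Square integrable fields and local stresses\<close>

lemma borel_measurable_lebesgue_spike:
  fixes f :: "'a::euclidean_space \<Rightarrow> 'b::topological_space"
  assumes f: "f \<in> borel_measurable lebesgue" and N: "negligible N" and eq: "\<And>x. x \<notin> N \<Longrightarrow> g x = f x"
  shows "g \<in> borel_measurable lebesgue"
proof (rule measurableI)
  fix B :: "'b set" assume B: "B \<in> sets borel"
  have "f -` B \<inter> space lebesgue \<in> sets lebesgue" using f B by (rule measurable_sets)
  moreover have N': "N \<in> sets lebesgue" using N by (rule negligible_imp_sets)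
  moreover have "g -` B \<inter> N \<in> sets lebesgue"
    using N by (intro negligible_imp_sets negligible_subset[OF N]) auto
  moreover have eq': "g -` B \<inter> space lebesgue = ((f -` B \<inter> space lebesgue) - N) \<union> (g -` B \<inter> N)"
    using eq by auto
  ultimately show "g -` B \<inter> space lebesgue \<in> sets lebesgue"
    by (subst eq') (intro sets.Un sets.Diff)
qed simp

lemma integrable_lebesgue_on_subset:
  fixes h :: "'a::euclidean_space \<Rightarrow> 'b::euclidean_space"
  assumes "integrable (lebesgue_on S) h" "S \<in> sets lebesgue" "U \<in> sets lebesgue" "U \<subseteq> S"
  shows "integrable (lebesgue_on U) h"
proof -
  have "integrable lebesgue (\<lambda>x. indicator S x *\<^sub>R h x)"
    using assms(1,2) by (subst (asm) integrable_restrict_space) auto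
  from integrable_mult_indicator[OF assms(3) this]
  have "integrable lebesgue (\<lambda>x. indicator U x *\<^sub>R indicator S x *\<^sub>R h x)" .
  also have "(\<lambda>x. indicator U x *\<^sub>R indicator S x *\<^sub>R h x) = (\<lambda>x. indicator U x *\<^sub>R h x)"
    using assms(4) by (auto simp: indicator_def fun_eq_iff)
  finally show ?thesis using assms(3) by (subst integrable_restrict_space) auto
qed

lemma L2_on_lincomb:
  fixes f g :: "real^3 \<Rightarrow> 'b::euclidean_space"
  assumes f: "L2_on \<Omega> f" and g: "L2_on \<Omega> g"
  shows "L2_on \<Omega> (\<lambda>x. f x + a *\<^sub>R g x)"
proof -
  let ?M = "lebesgue_on \<Omega>"
  have m: "(\<lambda>x. f x + a *\<^sub>R g x) \<in> borel_measurable ?M"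
    using f g by (auto simp: L2_on_def)
  have "integrable ?M (\<lambda>x. 2 * (norm (f x))\<^sup>2 + 2 * a\<^sup>2 * (norm (g x))\<^sup>2)"
    using f g by (auto simp: L2_on_def)
  then have "integrable ?M (\<lambda>x. (norm (f x + a *\<^sub>R g x))\<^sup>2)"
  proof (rule Bochner_Integration.integrable_bound)
    show "(\<lambda>x. (norm (f x + a *\<^sub>R g x))\<^sup>2) \<in> borel_measurable ?M" using m by measurable
    have "(norm (f x + a *\<^sub>R g x))\<^sup>2 \<le> 2 * (norm (f x))\<^sup>2 + 2 * a\<^sup>2 * (norm (g x))\<^sup>2" for x
    proof -
      have "(norm (f x + a *\<^sub>R g x))\<^sup>2 \<le> (norm (f x) + norm (a *\<^sub>R g x))\<^sup>2"
        by (intro power_mono norm_triangle_ineq norm_ge_zero)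
      also have "\<dots> \<le> 2 * (norm (f x))\<^sup>2 + 2 * (norm (a *\<^sub>R g x))\<^sup>2"
        using zero_le_power2[of "norm (f x) - norm (a *\<^sub>R g x)"] by (simp add: power2_eq_square algebra_simps)
      finally show ?thesis by (simp add: power_mult_distrib)
    qed
    then show "AE x in ?M. norm ((norm (f x + a *\<^sub>R g x))\<^sup>2) \<le> norm (2 * (norm (f x))\<^sup>2 + 2 * a\<^sup>2 * (norm (g x))\<^sup>2)"
      by (intro AE_I2) (simp add: order_trans[OF _ abs_ge_self])
  qed
  then show ?thesis using m by (simp add: L2_on_def)
qed

lemma bounded_continuous_times_integrable:
  fixes h :: "real^3 \<Rightarrow> 'b::euclidean_space" and \<psi> :: "real^3 \<Rightarrow> 'b"
  assumes h: "integrable (lebesgue_on \<Omega>) h" and \<Omega>: "bounded \<Omega>" "\<Omega> \<in> sets lebesgue"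
    and \<psi>: "continuous_on UNIV \<psi>"
  shows "integrable (lebesgue_on \<Omega>) (\<lambda>x. h x \<bullet> \<psi> x)"
proof -
  have "compact (\<psi> ` closure \<Omega>)" using \<Omega>(1)
    by (intro compact_continuous_image continuous_on_subset[OF \<psi>]) auto
  then obtain K where K: "\<And>x. x \<in> closure \<Omega> \<Longrightarrow> norm (\<psi> x) \<le> K"
    using compact_imp_bounded[of "\<psi> ` closure \<Omega>"] by (auto simp: bounded_iff)
  have m: "\<psi> \<in> borel_measurable (lebesgue_on \<Omega>)"
    using \<psi> by (intro measurable_restrict_space1 measurable_completion) (simp add: borel_measurable_continuous_onI)
  have "integrable (lebesgue_on \<Omega>) (\<lambda>x. K *\<^sub>R h x)" using h by auto
  then show ?thesis
  proof (rule Bochner_Integration.integrable_bound)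
    show "(\<lambda>x. h x \<bullet> \<psi> x) \<in> borel_measurable (lebesgue_on \<Omega>)"
      using borel_measurable_integrable[OF h] m by (rule borel_measurable_inner)
    have "norm (h x \<bullet> \<psi> x) \<le> norm (K *\<^sub>R h x)" if "x \<in> \<Omega>" for x
    proof -
      have "\<bar>h x \<bullet> \<psi> x\<bar> \<le> norm (h x) * norm (\<psi> x)" by (rule Cauchy_Schwarz_ineq2)
      also have "\<dots> \<le> norm (h x) * \<bar>K\<bar>" using K[of x] that closure_subset
        by (intro mult_left_mono) force+
      finally show ?thesis by (simp add: mult.commute)
    qed
    then show "AE x in lebesgue_on \<Omega>. norm (h x \<bullet> \<psi> x) \<le> norm (K *\<^sub>R h x)" by (intro AE_I2) simp
  qed
qed

lemma continuous_test_function: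
  assumes "test_function \<Omega> \<phi>"
  shows "continuous_on UNIV \<phi>" "continuous_on UNIV (grad \<phi>)" "\<phi> differentiable (at x)"
proof -
  have C: "C_k 0 \<phi>" "C_k (Suc 0) \<phi>" using assms unfolding test_function_def by blast+
  show "continuous_on UNIV \<phi>" using C(1) by simp
  show "\<phi> differentiable (at x)" using C(2) by simp
  have "continuous_on UNIV (partial j \<phi>)" for j using C(2) by simp
  then show "continuous_on UNIV (grad \<phi>)" unfolding grad_def by (intro continuous_on_vec_lambda) simp
qed

lemma has_L2_div_lincomb:
  assumes \<Omega>: "bounded \<Omega>" "\<Omega> \<in> lmeasurable" and \<tau>: "L2_on \<Omega> \<tau>" "L2_on \<Omega> \<sigma>"
    and g: "has_L2_div \<Omega> \<tau> g" "has_L2_div \<Omega> \<sigma> h"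
  shows "has_L2_div \<Omega> (\<lambda>x. \<tau> x + a *\<^sub>R \<sigma> x) (\<lambda>x. g x + a *\<^sub>R h x)"
  unfolding has_L2_div_def
proof (intro conjI allI impI)
  show "L2_on \<Omega> (\<lambda>x. g x + a *\<^sub>R h x)" using g by (intro L2_on_lincomb) (auto simp: has_L2_div_def)
  fix i \<phi> assume \<phi>: "test_function \<Omega> \<phi>"
  have i1: "integrable (lebesgue_on \<Omega>) (\<lambda>x. f x $ i * \<phi> x)" if "L2_on \<Omega> f" for f :: "real^3 \<Rightarrow> real^3"
    using bounded_continuous_times_integrable[OF integrable_bounded_linear[OF bounded_linear_vec_nth L2_on_integrable[OF that \<Omega>(2)]]
        \<Omega>(1) fmeasurableD[OF \<Omega>(2)] continuous_test_function(1)[OF \<phi>]] by simp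
  have i2: "integrable (lebesgue_on \<Omega>) (\<lambda>x. f x $ i \<bullet> grad \<phi> x)" if "L2_on \<Omega> f" for f :: "real^3 \<Rightarrow> real^3^3"
    using bounded_continuous_times_integrable[OF integrable_bounded_linear[OF bounded_linear_vec_nth L2_on_integrable[OF that \<Omega>(2)]]
        \<Omega>(1) fmeasurableD[OF \<Omega>(2)] continuous_test_function(2)[OF \<phi>]] by simp
  have gh: "L2_on \<Omega> g" "L2_on \<Omega> h" using g by (auto simp: has_L2_div_def)
  have "(\<integral>x. (g x + a *\<^sub>R h x) $ i * \<phi> x \<partial>lebesgue_on \<Omega>) = (\<integral>x. g x $ i * \<phi> x + a * (h x $ i * \<phi> x) \<partial>lebesgue_on \<Omega>)"
    by (intro Bochner_Integration.integral_cong) (auto simp: algebra_simps)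
  also have "\<dots> = (\<integral>x. g x $ i * \<phi> x \<partial>lebesgue_on \<Omega>) + a * (\<integral>x. h x $ i * \<phi> x \<partial>lebesgue_on \<Omega>)"
    using i1[OF gh(1)] i1[OF gh(2)] by simp
  also have "\<dots> = - ((\<integral>x. \<tau> x $ i \<bullet> grad \<phi> x \<partial>lebesgue_on \<Omega>) + a * (\<integral>x. \<sigma> x $ i \<bullet> grad \<phi> x \<partial>lebesgue_on \<Omega>))"
    using g \<phi> unfolding has_L2_div_def by simp
  also have "(\<integral>x. \<tau> x $ i \<bullet> grad \<phi> x \<partial>lebesgue_on \<Omega>) + a * (\<integral>x. \<sigma> x $ i \<bullet> grad \<phi> x \<partial>lebesgue_on \<Omega>)
      = (\<integral>x. \<tau> x $ i \<bullet> grad \<phi> x + a * (\<sigma> x $ i \<bullet> grad \<phi> x) \<partial>lebesgue_on \<Omega>)"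
    using i2[OF \<tau>(1)] i2[OF \<tau>(2)] by simp
  also have "\<dots> = (\<integral>x. (\<tau> x + a *\<^sub>R \<sigma> x) $ i \<bullet> grad \<phi> x \<partial>lebesgue_on \<Omega>)"
    by (intro Bochner_Integration.integral_cong) (auto simp: inner_add_left)
  finally show "(\<integral>x. (g x + a *\<^sub>R h x) $ i * \<phi> x \<partial>lebesgue_on \<Omega>) = - (\<integral>x. (\<tau> x + a *\<^sub>R \<sigma> x) $ i \<bullet> grad \<phi> x \<partial>lebesgue_on \<Omega>)" .
qed

text \<open>The Piola transform of one row without the Jacobian factor, which is constant on a cell
  and is absorbed by the linear space \<open>ERT0\<close> (\<open>local_stress_iff\<close>).\<close>

definition piola_vec :: "(nat \<Rightarrow> real^3) \<Rightarrow> (real^3 \<Rightarrow> real^3) \<Rightarrow> real^3 \<Rightarrow> real^3" where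
  "piola_vec v p x = (\<Sum>k\<in>UNIV. p (\<chi> l. loc v l x) $ k *\<^sub>R edge v k)"

definition local_stress :: "(real^3) set \<Rightarrow> (nat \<Rightarrow> real^3) \<Rightarrow> (real^3 \<Rightarrow> real^3^3) \<Rightarrow> (3 \<Rightarrow> real^3 \<Rightarrow> real^3) \<Rightarrow> bool" where
  "local_stress E v \<tau> P \<longleftrightarrow> (\<forall>i. P i \<in> ERT0) \<and> (\<forall>x\<in>interior E. \<tau> x = (\<chi> i. piola_vec v (P i) x))"

lemma ERT0_scale: "p \<in> ERT0 \<Longrightarrow> (\<lambda>x. t *\<^sub>R p x) \<in> ERT0"
  using ERT0_lincomb[OF ERT0_zero, of p t] by simp

lemma local_stress_iff:
  assumes c: "cuboid E v"
  shows "(\<exists>\<tau>h. (\<forall>i. (\<lambda>x. \<tau>h x $ i) \<in> ERT0) \<and> (\<forall>x\<in>interior E. piola_at (cell_map v) \<tau>h \<tau> x)) \<longleftrightarrow>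
    (\<exists>P. local_stress E v \<tau> P)"
proof
  let ?J = "cell_jac v"
  have J: "?J > 0" by (rule cell_jac_pos[OF c])
  assume "\<exists>\<tau>h. (\<forall>i. (\<lambda>x. \<tau>h x $ i) \<in> ERT0) \<and> (\<forall>x\<in>interior E. piola_at (cell_map v) \<tau>h \<tau> x)"
  then obtain \<tau>h where h: "\<And>i. (\<lambda>x. \<tau>h x $ i) \<in> ERT0" "\<And>x. x \<in> interior E \<Longrightarrow> piola_at (cell_map v) \<tau>h \<tau> x" by blast
  have "local_stress E v \<tau> (\<lambda>i x. (1 / ?J) *\<^sub>R \<tau>h x $ i)"
    unfolding local_stress_def
  proof (intro conjI allI ballI)
    show "(\<lambda>x. (1 / ?J) *\<^sub>R \<tau>h x $ i) \<in> ERT0" for i by (rule ERT0_scale[OF h(1)])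
    fix x assume "x \<in> interior E"
    from h(2)[OF this] show "\<tau> x = (\<chi> i. piola_vec v (\<lambda>x. (1 / ?J) *\<^sub>R \<tau>h x $ i) x)"
      unfolding piola_at_iff[OF c] by (subst vec_eq_iff) (simp add: piola_vec_def scaleR_sum_right)
  qed
  then show "\<exists>P. local_stress E v \<tau> P" by blast
next
  let ?J = "cell_jac v"
  have J: "?J > 0" by (rule cell_jac_pos[OF c])
  assume "\<exists>P. local_stress E v \<tau> P"
  then obtain P where P: "\<And>i. P i \<in> ERT0" "\<And>x. x \<in> interior E \<Longrightarrow> \<tau> x = (\<chi> i. piola_vec v (P i) x)"
    unfolding local_stress_def by blast
  show "\<exists>\<tau>h. (\<forall>i. (\<lambda>x. \<tau>h x $ i) \<in> ERT0) \<and> (\<forall>x\<in>interior E. piola_at (cell_map v) \<tau>h \<tau> x)"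
  proof (intro exI[of _ "\<lambda>x. \<chi> i. ?J *\<^sub>R P i x"] conjI allI ballI)
    show "(\<lambda>x. (\<chi> i. ?J *\<^sub>R P i x) $ i) \<in> ERT0" for i using ERT0_scale[OF P(1)] by simp
    fix x assume "x \<in> interior E"
    from P(2)[OF this] show "piola_at (cell_map v) (\<lambda>x. \<chi> i. ?J *\<^sub>R P i x) \<tau> x"
      unfolding piola_at_iff[OF c] using J by (simp add: piola_vec_def scaleR_sum_right)
  qed
qed

lemma continuous_piola_vec:
  assumes "p \<in> ERT0" shows "continuous_on UNIV (piola_vec v p)"
proof -
  have "continuous_on UNIV (\<lambda>x. p (\<chi> l. loc v l x))"
    by (rule continuous_on_compose2[OF continuous_ERT0[OF assms]])
       (auto intro!: continuous_on_vec_lambda continuous_intros)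
  then show ?thesis unfolding piola_vec_def by (intro continuous_intros)
qed

lemma continuous_local_stress:
  "local_stress E v \<tau> P \<Longrightarrow> continuous_on UNIV (\<lambda>x. \<chi> i. piola_vec v (P i) x)"
  unfolding local_stress_def by (intro continuous_on_vec_lambda continuous_piola_vec) blast

lemma piola_vec_lincomb: "piola_vec v (\<lambda>x. p x + t *\<^sub>R q x) x = piola_vec v p x + t *\<^sub>R piola_vec v q x"
  by (simp add: piola_vec_def scaleR_add_left sum.distrib scaleR_sum_right)

lemma local_stress_lincomb:
  assumes "local_stress E v \<tau> P" "local_stress E v \<sigma> Q"
  shows "local_stress E v (\<lambda>x. \<tau> x + t *\<^sub>R \<sigma> x) (\<lambda>i x. P i x + t *\<^sub>R Q i x)"
  using assms unfolding local_stress_def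
  by (auto intro!: ERT0_lincomb simp: piola_vec_lincomb vec_eq_iff)

text \<open>Interior points accumulate at every point of the cell, so the limit from within is
  unique and is the value of the continuous extension.\<close>

lemma trace_from_eq:
  assumes c: "cuboid E v" and M: "continuous_on E M" and eq: "\<And>x. x \<in> interior E \<Longrightarrow> g x = M x" and x: "x \<in> E"
  shows "trace_from E g x = M x"
proof -
  have "x islimpt interior E"
  proof (cases "x \<in> interior E")
    case True
    then show ?thesis using interior_limit_point[of x "interior E"] by simp
  next
    case False
    then show ?thesis using x closure_interior_cuboid[OF c] by (simp add: closure_def) (metis UnE mem_Collect_eq closure_def)
  qed
  then have nt: "\<not> trivial_limit (at x within interior E)" by (simp add: trivial_limit_within)
  have "(M \<longlongrightarrow> M x) (at x within interior E)"
    using M x interior_subset unfolding continuous_on_def by (blast intro: tendsto_within_subset)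
  moreover have "\<forall>\<^sub>F y in at x within interior E. M y = g y"
    by (simp add: eventually_at_filter eq)
  ultimately have "(g \<longlongrightarrow> M x) (at x within interior E)" by (rule Lim_transform_eventually)
  then show ?thesis unfolding trace_from_def by (intro tendsto_Lim nt)
qed

lemma trace_from_local_stress:
  assumes "cuboid E v" "local_stress E v \<tau> P" "x \<in> E"
  shows "trace_from E \<tau> x = (\<chi> i. piola_vec v (P i) x)"
  using assms(2) by (intro trace_from_eq[OF assms(1) continuous_on_subset[OF continuous_local_stress[OF assms(2)] subset_UNIV] _ assms(3)])
    (simp add: local_stress_def)

section \<open>Piecewise fields on the mesh\<close>

context meshed_domain
begin

definition cell_center :: "(real^3) set \<Rightarrow> real^3" where "cell_center E = cell_map (r E) (\<chi> k. 1/2)"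

lemma cell_center: "E \<in> T \<Longrightarrow> cell_center E \<in> interior E"
  unfolding cell_center_def by (rule cuboid_center[OF cells])

text \<open>The skeleton is a null set, and every other point of the domain is interior to exactly
  one cell. Measurability of \<open>h\<close> on \<Omega> is also obtained from the cells, by
  completeness of Lebesgue measure.\<close>

lemma integral_over_cells:
  fixes h :: "real^3 \<Rightarrow> 'b::euclidean_space"
  assumes h: "\<And>E. E \<in> T \<Longrightarrow> integrable (lebesgue_on (interior E)) h"
  shows "integrable (lebesgue_on \<Omega>) h"
    and "(\<integral>x. h x \<partial>lebesgue_on \<Omega>) = (\<Sum>E\<in>T. \<integral>x. h x \<partial>lebesgue_on (interior E))"
proof -
  define F where "F x = (\<Sum>E\<in>T. indicator (interior E) x *\<^sub>R h x)" for x
  define g where "g x = indicator \<Omega> x *\<^sub>R h x" for x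
  have i: "integrable lebesgue (\<lambda>x. indicator (interior E) x *\<^sub>R h x)" if "E \<in> T" for E
    using h[OF that] by (subst (asm) integrable_restrict_space) auto
  have F: "integrable lebesgue F" unfolding F_def by (intro Bochner_Integration.integrable_sum i)
  have gF: "g x = F x" if n: "x \<notin> \<Omega> - (\<Union>E\<in>T. interior E)" for x
  proof (cases "x \<in> \<Omega>")
    case False
    then have "x \<notin> interior E" if "E \<in> T" for E using interior_subset_dom[OF that] by blast
    then show ?thesis using False by (simp add: F_def g_def)
  next
    case True
    then obtain E where E: "E \<in> T" "x \<in> interior E" using n by blast
    have "F x = (\<Sum>E'\<in>T. if E' = E then h x else 0)" unfolding F_def
    proof (intro sum.cong refl)
      fix E' assume E': "E' \<in> T"
      show "indicator (interior E') x *\<^sub>R h x = (if E' = E then h x else 0)"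
        using cells_eq_of_interior[OF E(1) E' E(2)] E(2) interior_subset[of E'] by (auto simp: indicator_def)
    qed
    then show ?thesis using True E(1) finite_T by (simp add: g_def)
  qed
  have gm: "g \<in> borel_measurable lebesgue"
    by (rule borel_measurable_lebesgue_spike[OF borel_measurable_integrable[OF F] negligible_skeleton gF])
  have "\<Omega> - (\<Union>E\<in>T. interior E) \<in> null_sets lebesgue"
    using negligible_skeleton by (simp add: negligible_iff_null_sets)
  then have ae: "AE x in lebesgue. F x = g x" by (rule AE_not_in[THEN AE_mp]) (auto simp: gF)
  have "integrable lebesgue g" using Bochner_Integration.integrable_cong_AE_imp[OF F gm] ae by simp
  then show "integrable (lebesgue_on \<Omega>) h"
    using open_dom unfolding g_def[abs_def] by (subst integrable_restrict_space) auto
  have "(\<integral>x. h x \<partial>lebesgue_on \<Omega>) = integral\<^sup>L lebesgue g"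
    unfolding g_def using open_dom by (intro integral_restrict_space) auto
  also have "\<dots> = integral\<^sup>L lebesgue F"
    using gm F ae by (intro integral_cong_AE) auto
  also have "\<dots> = (\<Sum>E\<in>T. \<integral>x. indicator (interior E) x *\<^sub>R h x \<partial>lebesgue)"
    unfolding F_def by (intro Bochner_Integration.integral_sum i)
  also have "\<dots> = (\<Sum>E\<in>T. \<integral>x. h x \<partial>lebesgue_on (interior E))"
    by (intro sum.cong refl integral_restrict_space[symmetric]) simp
  finally show "(\<integral>x. h x \<partial>lebesgue_on \<Omega>) = (\<Sum>E\<in>T. \<integral>x. h x \<partial>lebesgue_on (interior E))" .
qed

lemma integrable_on_interior:
  fixes h :: "real^3 \<Rightarrow> 'b::euclidean_space"
  assumes "integrable (lebesgue_on \<Omega>) h" "E \<in> T" shows "integrable (lebesgue_on (interior E)) h"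
  using integrable_lebesgue_on_subset[OF assms(1)] open_dom interior_subset_dom[OF assms(2)] by simp

definition cell_integral :: "(real^3) set \<Rightarrow> (real^3 \<Rightarrow> 'b) \<Rightarrow> 'b::euclidean_space" where
  "cell_integral E h = (\<integral>x. h x \<partial>lebesgue_on (interior E))"

lemma piecewise_value: "u constant_on interior E \<Longrightarrow> E \<in> T \<Longrightarrow> x \<in> interior E \<Longrightarrow> u x = u (cell_center E)"
  using cell_center[of E] unfolding constant_on_def by metis

text \<open>Reduces a pairing to finitely many numbers, one value of \<open>u\<close> and one
  integral of \<open>h\<close> per cell; in this way the variational equations become a finite
  system.\<close>

lemma l2_inner_piecewise:
  fixes h :: "real^3 \<Rightarrow> 'b::euclidean_space"
  assumes u: "\<And>E. E \<in> T \<Longrightarrow> u constant_on interior E" and h: "integrable (lebesgue_on \<Omega>) h"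
  shows "l2_inner \<Omega> u h = (\<Sum>E\<in>T. u (cell_center E) \<bullet> cell_integral E h)"
proof -
  have eq: "u x \<bullet> h x = u (cell_center E) \<bullet> h x" if "E \<in> T" "x \<in> interior E" for E x
    using piecewise_value[OF u[OF that(1)] that] by simp
  have i: "integrable (lebesgue_on (interior E)) (\<lambda>x. u (cell_center E) \<bullet> h x)" if "E \<in> T" for E
    using integrable_on_interior[OF h that] by auto
  have "l2_inner \<Omega> u h = (\<Sum>E\<in>T. \<integral>x. u x \<bullet> h x \<partial>lebesgue_on (interior E))"
    unfolding l2_inner_def
  proof (rule integral_over_cells(2))
    fix E assume E: "E \<in> T"
    show "integrable (lebesgue_on (interior E)) (\<lambda>x. u x \<bullet> h x)"
      using i[OF E] by (subst Bochner_Integration.integrable_cong[OF refl eq[OF E]]) auto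
  qed
  also have "\<dots> = (\<Sum>E\<in>T. u (cell_center E) \<bullet> cell_integral E h)"
  proof (rule sum.cong[OF refl])
    fix E assume E: "E \<in> T"
    have "(\<integral>x. u x \<bullet> h x \<partial>lebesgue_on (interior E)) = (\<integral>x. u (cell_center E) \<bullet> h x \<partial>lebesgue_on (interior E))"
      using eq[OF E] by (intro Bochner_Integration.integral_cong) auto
    also have "\<dots> = u (cell_center E) \<bullet> cell_integral E h"
      unfolding cell_integral_def using integrable_on_interior[OF h E] by (intro integral_inner_right) auto
    finally show "(\<integral>x. u x \<bullet> h x \<partial>lebesgue_on (interior E)) = u (cell_center E) \<bullet> cell_integral E h" .
  qed
  finally show ?thesis .
qed

lemma cell_integral_lincomb:
  fixes f h :: "real^3 \<Rightarrow> 'b::euclidean_space"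
  assumes "integrable (lebesgue_on \<Omega>) f" "integrable (lebesgue_on \<Omega>) h" "E \<in> T"
  shows "cell_integral E (\<lambda>x. f x + a *\<^sub>R h x) = cell_integral E f + a *\<^sub>R cell_integral E h"
  unfolding cell_integral_def using assms by (simp add: integrable_on_interior)

lemma cell_integral_nth:
  fixes h :: "real^3 \<Rightarrow> real^3"
  assumes "integrable (lebesgue_on \<Omega>) h" "E \<in> T"
  shows "cell_integral E h $ i = cell_int E (\<lambda>x. h x $ i)"
  unfolding cell_integral_def cell_int_def
  by (rule integral_bounded_linear[OF bounded_linear_vec_nth integrable_on_interior[OF assms], symmetric])

lemmas L2_integrable = L2_on_integrable[OF _ lmeasurable_dom]

abbreviation X where "X \<equiv> Xh \<Omega> T r \<Gamma>N"

lemma X_iff: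
  "\<tau> \<in> X \<longleftrightarrow> L2_on \<Omega> \<tau> \<and> (\<exists>g. has_L2_div \<Omega> \<tau> g) \<and> (\<forall>E\<in>T. \<exists>P. local_stress E (r E) \<tau> P) \<and>
     (\<forall>E\<in>T. \<forall>e n. e facet_of E \<and> e \<subseteq> \<Gamma>N \<and> outward_unit_normal E e n \<longrightarrow> (\<forall>x\<in>e. trace_from E \<tau> x *v n = 0))"
proof -
  have eq: "(\<forall>E\<in>T. \<exists>\<tau>h. (\<forall>i. (\<lambda>x. \<tau>h x $ i) \<in> ERT0) \<and> (\<forall>x\<in>interior E. piola_at (cell_map (r E)) \<tau>h \<tau> x))
      \<longleftrightarrow> (\<forall>E\<in>T. \<exists>P. local_stress E (r E) \<tau> P)"
    by (rule ball_cong[OF refl]) (rule local_stress_iff[OF cells])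
  show ?thesis unfolding Xh_def mem_Collect_eq by (subst eq) (rule refl)
qed

lemma X_L2: "\<tau> \<in> X \<Longrightarrow> L2_on \<Omega> \<tau>"
  by (simp only: X_iff)

lemma X_local: "\<tau> \<in> X \<Longrightarrow> E \<in> T \<Longrightarrow> \<exists>P. local_stress E (r E) \<tau> P"
  by (simp only: X_iff)

lemma X_normal:
  "\<tau> \<in> X \<Longrightarrow> E \<in> T \<Longrightarrow> e facet_of E \<Longrightarrow> e \<subseteq> \<Gamma>N \<Longrightarrow> outward_unit_normal E e n \<Longrightarrow> x \<in> e \<Longrightarrow>
    trace_from E \<tau> x *v n = 0"
  by (simp only: X_iff)

lemma X_wdiv: "\<tau> \<in> X \<Longrightarrow> has_L2_div \<Omega> \<tau> (wdiv \<Omega> \<tau>)"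
  unfolding wdiv_def by (rule someI_ex[where P = "has_L2_div \<Omega> \<tau>"]) (simp only: X_iff)

lemma wdiv_integrable: "\<tau> \<in> X \<Longrightarrow> integrable (lebesgue_on \<Omega>) (wdiv \<Omega> \<tau>)"
  using X_wdiv L2_integrable unfolding has_L2_div_def by blast

text \<open>Lets any explicitly known weak divergence stand in for the chosen
  representative.\<close>

lemma cell_integral_wdiv:
  assumes "\<tau> \<in> X" "has_L2_div \<Omega> \<tau> g" "E \<in> T"
  shows "cell_integral E (wdiv \<Omega> \<tau>) = cell_integral E g"
proof -
  have "integrable (lebesgue_on \<Omega>) g" using assms(2) L2_integrable unfolding has_L2_div_def by blast
  then show ?thesis using assms wdiv_integrable
    by (simp add: vec_eq_iff cell_integral_nth weak_div_cell_int_unique[OF lmeasurable_dom cells[OF assms(3)] interior_subset_dom[OF assms(3)] X_wdiv assms(2)])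
qed

lemma trace_lincomb:
  assumes "\<tau> \<in> X" "\<sigma> \<in> X" "E \<in> T" "x \<in> E"
  shows "trace_from E (\<lambda>x. \<tau> x + a *\<^sub>R \<sigma> x) x = trace_from E \<tau> x + a *\<^sub>R trace_from E \<sigma> x"
proof -
  obtain P Q where PQ: "local_stress E (r E) \<tau> P" "local_stress E (r E) \<sigma> Q" using assms X_local by blast
  show ?thesis
    unfolding trace_from_local_stress[OF cells[OF assms(3)] PQ(1) assms(4)] trace_from_local_stress[OF cells[OF assms(3)] PQ(2) assms(4)]
      trace_from_local_stress[OF cells[OF assms(3)] local_stress_lincomb[OF PQ] assms(4)]
    by (simp add: vec_eq_iff piola_vec_lincomb)
qed

lemma X_lincomb:
  assumes "\<tau> \<in> X" "\<sigma> \<in> X" shows "(\<lambda>x. \<tau> x + a *\<^sub>R \<sigma> x) \<in> X"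
  unfolding X_iff
proof (intro conjI ballI allI impI)
  show "L2_on \<Omega> (\<lambda>x. \<tau> x + a *\<^sub>R \<sigma> x)" using assms X_L2 by (intro L2_on_lincomb)
  show "\<exists>g. has_L2_div \<Omega> (\<lambda>x. \<tau> x + a *\<^sub>R \<sigma> x) g"
    using has_L2_div_lincomb[OF bounded_dom lmeasurable_dom X_L2[OF assms(1)] X_L2[OF assms(2)] X_wdiv[OF assms(1)] X_wdiv[OF assms(2)]] by blast
  show "\<exists>P. local_stress E (r E) (\<lambda>x. \<tau> x + a *\<^sub>R \<sigma> x) P" if "E \<in> T" for E
    using X_local[OF assms(1) that] X_local[OF assms(2) that] local_stress_lincomb by blast
  fix E e n x
  assume E: "E \<in> T" and e: "e facet_of E \<and> e \<subseteq> \<Gamma>N \<and> outward_unit_normal E e n" and x: "x \<in> e"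
  have xE: "x \<in> E" using e x facet_of_imp_subset by blast
  have "trace_from E \<tau> x *v n = 0" "trace_from E \<sigma> x *v n = 0"
    using X_normal[OF assms(1) E _ _ _ x] X_normal[OF assms(2) E _ _ _ x] e by blast+
  then show "trace_from E (\<lambda>x. \<tau> x + a *\<^sub>R \<sigma> x) x *v n = 0"
    unfolding trace_lincomb[OF assms E xE]
    by (simp add: matrix_vector_mult_add_rdistrib scaleR_matrix_vector_assoc[symmetric])
qed

lemma wdiv_lincomb:
  assumes "\<tau> \<in> X" "\<sigma> \<in> X" "E \<in> T"
  shows "cell_integral E (wdiv \<Omega> (\<lambda>x. \<tau> x + a *\<^sub>R \<sigma> x)) = cell_integral E (wdiv \<Omega> \<tau>) + a *\<^sub>R cell_integral E (wdiv \<Omega> \<sigma>)"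
proof -
  have "cell_integral E (wdiv \<Omega> (\<lambda>x. \<tau> x + a *\<^sub>R \<sigma> x)) = cell_integral E (\<lambda>x. wdiv \<Omega> \<tau> x + a *\<^sub>R wdiv \<Omega> \<sigma> x)"
    using assms by (intro cell_integral_wdiv X_lincomb has_L2_div_lincomb[OF bounded_dom lmeasurable_dom] X_L2 X_wdiv)
  then show ?thesis using assms by (simp add: cell_integral_lincomb wdiv_integrable)
qed

lemma vertex_mem: "E \<in> T \<Longrightarrow> i \<in> {1..8} \<Longrightarrow> r E i \<in> E"
proof -
  assume E: "E \<in> T" and i: "i \<in> {1..8}"
  have "i = 1 \<or> i = 2 \<or> i = 3 \<or> i = 4 \<or> i = 5 \<or> i = 6 \<or> i = 7 \<or> i = 8" using i by auto
  then have "rhat i \<in> Ehat" by (elim disjE) (simp_all add: rhat_nth[simplified] Ehat_def forall_3)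
  then show ?thesis using cuboidD(7,8)[OF cells[OF E]] i by blast
qed

text \<open>The enhanced Raviart-Thomas stress is determined by its vertex values, which is what makes the
  quadrature form definite.\<close>

lemma stress_zero_of_vertices:
  assumes \<tau>: "\<tau> \<in> X" and E: "E \<in> T" and z: "\<And>i. i \<in> {1..8} \<Longrightarrow> trace_from E \<tau> (r E i) = 0"
  shows "x \<in> interior E \<Longrightarrow> \<tau> x = 0" "x \<in> E \<Longrightarrow> trace_from E \<tau> x = 0"
proof -
  note c = cells[OF E]
  obtain P where P: "local_stress E (r E) \<tau> P" using X_local[OF \<tau> E] by blast
  have "P m = (\<lambda>x. 0)" for m
  proof (rule ERT0_vertex_unisolvent)
    show "P m \<in> ERT0" using P by (simp add: local_stress_def)
    fix i :: nat assume i: "i \<in> {1..8}"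
    have "(\<chi> l. loc (r E) l (r E i)) = rhat i"
      by (subst cuboidD(7)[OF c i]) (simp add: vec_eq_iff loc_cell_map[OF c])
    then have "piola_vec (r E) (P m) (r E i) = (\<Sum>k\<in>UNIV. P m (rhat i) $ k *\<^sub>R edge (r E) k)"
      by (simp add: piola_vec_def)
    \<comment> \<open>Adding the base vertex turns the combination of edges into a value of
      \<open>cell_map\<close>; injectivity of that map then plays the role of linear independence of
      the edges.\<close>
    also have "\<dots> + r E 1 = cell_map (r E) (P m (rhat i))" by (simp add: cell_map_eq)
    finally have "cell_map (r E) (P m (rhat i)) = r E 1 + piola_vec (r E) (P m) (r E i)" by (simp only: add.commute)
    also have "piola_vec (r E) (P m) (r E i) = 0"
      using z[OF i] trace_from_local_stress[OF c P vertex_mem[OF E i]] by (simp add: vec_eq_iff)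
    finally have "cell_map (r E) (P m (rhat i)) = cell_map (r E) 0" by (simp add: cell_map_eq)
    then show "P m (rhat i) = 0" using bij_is_inj[OF bij_cell_map[OF c]] by (metis injD)
  qed
  then have "piola_vec (r E) (P m) y = 0" for m y by (simp add: piola_vec_def)
  then show "x \<in> interior E \<Longrightarrow> \<tau> x = 0" "x \<in> E \<Longrightarrow> trace_from E \<tau> x = 0"
    using P trace_from_local_stress[OF c P] by (simp_all add: local_stress_def vec_eq_iff)
qed

end

section \<open>Face fields\<close>

lemma cell_int_cong: "(\<And>x. x \<in> interior E \<Longrightarrow> f x = g x) \<Longrightarrow> cell_int E f = cell_int E g"
  unfolding cell_int_def by (intro Bochner_Integration.integral_cong) auto

lemma cell_int_add:
  assumes "cuboid E v" "continuous_on UNIV f" "continuous_on UNIV g"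
  shows "cell_int E (\<lambda>x. f x + g x) = cell_int E f + cell_int E g"
  unfolding cell_int_def using assms by (intro Bochner_Integration.integral_add integrable_on_cell)

lemma cell_int_mult: "cell_int E (\<lambda>x. c * f x) = c * cell_int E f"
  unfolding cell_int_def by simp

lemma cell_int_sum:
  assumes "cuboid E v" "finite K" "\<And>k. k \<in> K \<Longrightarrow> continuous_on UNIV (f k)"
  shows "cell_int E (\<lambda>x. \<Sum>k\<in>K. f k x) = (\<Sum>k\<in>K. cell_int E (f k))"
  unfolding cell_int_def using assms by (intro Bochner_Integration.integral_sum integrable_on_cell)

text \<open>The square is nonnegative with zero integral, hence zero almost everywhere; by
  continuity the exceptional set is open, and a nonempty open set is not negligible.\<close>

lemma cell_int_square_zero:
  assumes c: "cuboid E v" and g: "continuous_on UNIV g" and z: "cell_int E (\<lambda>x. g x * g x) = 0"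
    and x: "x \<in> interior E"
  shows "g x = 0"
proof -
  have "integrable (lebesgue_on (interior E)) (\<lambda>x. g x * g x)"
    using g by (intro integrable_on_cell[OF c] continuous_intros)
  then have "AE x in lebesgue_on (interior E). g x * g x = 0"
    using integral_nonneg_eq_0_iff_AE[of "lebesgue_on (interior E)" "\<lambda>x. g x * g x"] z
    unfolding cell_int_def by simp
  then have "AE x in lebesgue. x \<in> interior E \<longrightarrow> g x * g x = 0"
    by (subst (asm) AE_restrict_space_iff) auto
  then have ae: "AE x in lebesgue. x \<notin> {x \<in> interior E. g x \<noteq> 0}" by (rule AE_mp) auto
  have op: "open {x \<in> interior E. g x \<noteq> 0}"
  proof -
    have "open (interior E \<inter> {x. g x \<noteq> 0})" using g by (intro open_Int open_interior open_Collect_neq) auto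
    then show ?thesis by (simp add: Int_def)
  qed
  then have "{x \<in> interior E. g x \<noteq> 0} \<in> null_sets lebesgue" using ae by (subst AE_iff_null_sets) auto
  then have "negligible {x \<in> interior E. g x \<noteq> 0}" by (simp add: negligible_iff_null_sets)
  then have "{x \<in> interior E. g x \<noteq> 0} = {}" using open_not_negligible[OF op] by blast
  then show ?thesis using x by blast
qed

text \<open>\<open>ref_face_field\<close> transported to the cell (\<open>face_field_piola\<close>).
  The first term has the affine normal trace on its own face and vanishes on the opposite one; each
  further term points along an edge and vanishes on both faces normal to that edge.\<close>

definition face_field :: "(nat \<Rightarrow> real^3) \<Rightarrow> 3 \<Rightarrow> real \<Rightarrow> real \<Rightarrow> real^3 \<Rightarrow> real^3 \<Rightarrow> real^3" where
  "face_field v j s g0 G x = ((1 + height v j s x) * (g0 + G \<bullet> x)) *\<^sub>R outward v j s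
     + (\<Sum>k\<in>UNIV - {j}. ((G \<bullet> edge v k) * (loc v k x - (loc v k x)\<^sup>2) / 2) *\<^sub>R edge v k)"

text \<open>The divergence of \<open>face_field\<close> for tangential \<open>G\<close>: the first
  term contributes g0 + G x and the others (G e_k) (1 / 2 - loc_k), so that the coordinates cancel
  by \<open>affine_loc\<close>.\<close>

definition face_div :: "(nat \<Rightarrow> real^3) \<Rightarrow> 3 \<Rightarrow> real \<Rightarrow> real^3 \<Rightarrow> real" where
  "face_div v j g0 G = g0 + G \<bullet> v 1 + (\<Sum>k\<in>UNIV - {j}. (G \<bullet> edge v k) / 2)"

context
  fixes E v s and j :: 3 and G :: "real^3" and g0 :: real
  assumes c: "cuboid E v" and s: "s \<in> {0, 1::real}" and G: "G \<bullet> edge v j = 0"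
begin

lemma affine_loc: "g0 + G \<bullet> x = g0 + G \<bullet> v 1 + (\<Sum>k\<in>UNIV - {j}. (G \<bullet> edge v k) * loc v k x)"
proof -
  have "G \<bullet> x = G \<bullet> (v 1 + (\<Sum>k\<in>UNIV. loc v k x *\<^sub>R edge v k))"
    using edge_expansion[OF c, of x] by (rule arg_cong)
  also have "\<dots> = G \<bullet> v 1 + (\<Sum>k\<in>UNIV. (G \<bullet> edge v k) * loc v k x)"
    unfolding inner_add_right inner_sum_right by (simp only: inner_scaleR_right mult.commute)
  also have "(\<Sum>k\<in>UNIV. (G \<bullet> edge v k) * loc v k x) = (\<Sum>k\<in>UNIV - {j}. (G \<bullet> edge v k) * loc v k x)"
    using G by (intro sum.mono_neutral_right) auto
  finally show ?thesis by simp
qed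

lemma face_field_piola:
  "face_field v j s g0 G = piola_vec v (ref_face_field j s ((2 * s - 1) * (g0 + G \<bullet> v 1)) (\<chi> k. (2 * s - 1) * (G \<bullet> edge v k)))"
    (is "_ = piola_vec v ?p")
proof
  fix x
  \<comment> \<open>The sign 2 s - 1 occurs both in the reference data and in the outward vector,
    and its square is 1.\<close>
  have sq: "(2 * s - 1) * ((2 * s - 1) * a) = a" for a using s by auto
  let ?h = "1 + height v j s x"
  have "piola_vec v ?p x = ?p (\<chi> l. loc v l x) $ j *\<^sub>R edge v j + (\<Sum>k\<in>UNIV - {j}. ?p (\<chi> l. loc v l x) $ k *\<^sub>R edge v k)"
    unfolding piola_vec_def by (subst sum.remove[of _ j]) auto
  also have "(\<Sum>k\<in>UNIV - {j}. ?p (\<chi> l. loc v l x) $ k *\<^sub>R edge v k)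
      = (\<Sum>k\<in>UNIV - {j}. ((G \<bullet> edge v k) * (loc v k x - (loc v k x)\<^sup>2) / 2) *\<^sub>R edge v k)"
    by (intro sum.cong refl) (simp add: ref_face_field_def mult.assoc[symmetric] sq[simplified mult.assoc[symmetric]])
  also have "?p (\<chi> l. loc v l x) $ j *\<^sub>R edge v j = (?h * (g0 + G \<bullet> x)) *\<^sub>R outward v j s"
  proof -
    have "?p (\<chi> l. loc v l x) $ j = ?h * ((2 * s - 1) * (g0 + G \<bullet> v 1) + (\<Sum>k\<in>UNIV - {j}. (2 * s - 1) * (G \<bullet> edge v k) * loc v k x))"
      by (simp add: ref_face_field_def height_def)
    also have "\<dots> = ?h * ((2 * s - 1) * (g0 + G \<bullet> x))"
      unfolding affine_loc[of x] by (simp only: distrib_left sum_distrib_left mult.assoc)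
    finally show ?thesis unfolding outward_def by (simp only: scaleR_scaleR mult.commute mult.left_commute)
  qed
  finally show "face_field v j s g0 G x = piola_vec v ?p x" by (simp add: face_field_def)
qed

lemma continuous_face_field: "continuous_on UNIV (face_field v j s g0 G)"
  unfolding face_field_piola by (rule continuous_piola_vec[OF ref_face_field_ERT0[OF s]])

text \<open>The tangential parts of a face field vanish on the faces they are normal to, so only the flux
  through the face itself survives, tested against the values of \<open>\<psi>\<close> there.\<close>

lemma face_field_flux:
  assumes co: "continuous_on UNIV \<psi>" "continuous_on UNIV \<Psi>"
    and der: "\<And>x d. ((\<lambda>t. \<psi> (x + t *\<^sub>R d)) has_real_derivative (\<Psi> x \<bullet> d)) (at 0)"
  shows "cell_int E (\<lambda>x. face_div v j g0 G * \<psi> x + face_field v j s g0 G x \<bullet> \<Psi> x)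
    = cell_int E (\<lambda>x. (g0 + G \<bullet> x) * \<psi> (face_proj v j s x))"
proof -
  let ?o = "outward v j s"
  define g where "g x = g0 + G \<bullet> x" for x
  have cg: "continuous_on UNIV g" unfolding g_def by (intro continuous_intros)
  have Go: "G \<bullet> ?o = 0" using G by (simp add: outward_def)
  \<comment> \<open>\<open>N\<close> is the derivative of (1 + height) g \<psi> along the outward
    vector, and \<open>t k\<close> that of \<open>q k\<close> \<psi> along edge \<open>k\<close>.
    Together they form the divergence of the field multiplied by \<psi>.\<close>
  define N where "N x = g x * \<psi> x + (1 + height v j s x) * (g x * (\<Psi> x \<bullet> ?o))" for x
  define q where "q k x = (G \<bullet> edge v k) * (loc v k x - (loc v k x)\<^sup>2) / 2" for k x
  define t where "t k x = (G \<bullet> edge v k) * (1 / 2 - loc v k x) * \<psi> x + q k x * (\<Psi> x \<bullet> edge v k)" for k x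
  have cq: "continuous_on UNIV (q k)" for k unfolding q_def by (intro continuous_intros) auto
  have cN: "continuous_on UNIV N" unfolding N_def by (intro continuous_intros cg co)
  have ct: "continuous_on UNIV (t k)" for k unfolding t_def by (intro continuous_intros cq co)
  have t0: "cell_int E (t k) = 0" for k
  proof (rule cell_int_edge_derivative_zero[OF c])
    show "continuous_on UNIV (\<lambda>x. q k x * \<psi> x)" by (intro continuous_intros cq co)
    show "continuous_on UNIV (t k)" by (rule ct)
    fix x
    have "((\<lambda>h. q k (x + h *\<^sub>R edge v k)) has_real_derivative (G \<bullet> edge v k) * (1 / 2 - loc v k x)) (at 0)"
      unfolding q_def loc_add_edge[OF c] by (auto intro!: derivative_eq_intros simp: field_simps)
    from DERIV_mult[OF this der[of x "edge v k"]]
    show "((\<lambda>h. q k (x + h *\<^sub>R edge v k) * \<psi> (x + h *\<^sub>R edge v k)) has_real_derivative t k x) (at 0)"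
      by (simp add: t_def add.commute mult.commute)
    show "loc v k x = 0 \<or> loc v k x = 1 \<Longrightarrow> q k x * \<psi> x = 0" by (auto simp: q_def)
  qed
  have N: "cell_int E N = cell_int E (\<lambda>x. g (face_proj v j s x) * \<psi> (face_proj v j s x))"
    unfolding N_def
  proof (rule cell_int_flux[OF c s])
    show "continuous_on UNIV (\<lambda>x. g x * \<psi> x)" "continuous_on UNIV (\<lambda>x. g x * (\<Psi> x \<bullet> ?o))"
      by (intro continuous_intros cg co)+
    fix x
    have "g (x + h *\<^sub>R ?o) = g x" for h using Go by (simp add: g_def inner_add_right)
    then show "((\<lambda>h. g (x + h *\<^sub>R ?o) * \<psi> (x + h *\<^sub>R ?o)) has_real_derivative g x * (\<Psi> x \<bullet> ?o)) (at 0)"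
      using DERIV_cmult[OF der[of x ?o], of "g x"] by simp
  qed
  have "face_div v j g0 G * \<psi> x + face_field v j s g0 G x \<bullet> \<Psi> x = N x + (\<Sum>k\<in>UNIV - {j}. t k x)" for x
  proof -
    have "face_div v j g0 G = g x + (\<Sum>k\<in>UNIV - {j}. (G \<bullet> edge v k) * (1 / 2 - loc v k x))"
      unfolding face_div_def g_def affine_loc[of x] by (simp add: right_diff_distrib sum_subtractf)
    moreover have "face_field v j s g0 G x \<bullet> \<Psi> x = (1 + height v j s x) * (g x * (\<Psi> x \<bullet> ?o)) + (\<Sum>k\<in>UNIV - {j}. q k x * (\<Psi> x \<bullet> edge v k))"
      unfolding face_field_def inner_add_left inner_sum_left inner_scaleR_left q_def g_def
      by (simp only: inner_commute[of "\<Psi> x"] mult.assoc)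
    ultimately show ?thesis
      unfolding N_def t_def by (simp only: distrib_right sum.distrib sum_distrib_right add_ac)
  qed
  then have "cell_int E (\<lambda>x. face_div v j g0 G * \<psi> x + face_field v j s g0 G x \<bullet> \<Psi> x)
      = cell_int E N + cell_int E (\<lambda>x. \<Sum>k\<in>UNIV - {j}. t k x)"
    using cell_int_add[OF c cN continuous_on_sum[of "UNIV - {j}" UNIV t]] ct by simp
  also have "cell_int E (\<lambda>x. \<Sum>k\<in>UNIV - {j}. t k x) = 0"
    using cell_int_sum[OF c, of "UNIV - {j}" t] ct t0 by simp
  also have "cell_int E N = cell_int E (\<lambda>x. g x * \<psi> (face_proj v j s x))"
    unfolding N using Go by (simp add: g_def face_proj_def inner_diff_right)
  finally show ?thesis by (simp add: g_def)
qed

text \<open>At \<open>x\<close> the normal is orthogonal to every edge along which one can move both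
  ways, and the quadratic factors vanish in the other directions. If the first term had a normal
  component, \<open>n\<close> would have a positive component along the outward vector; no point of
  the facet could then be moved outwards within the cell, so the facet would be the face excluded by
  assumption.\<close>

lemma face_field_other_normal:
  assumes e: "e facet_of E" "e \<noteq> cell_face E v j s" and n: "outward_unit_normal E e n" and x: "x \<in> e"
  shows "face_field v j s g0 G x \<bullet> n = 0"
proof -
  let ?o = "outward v j s"
  have nle: "n \<bullet> (y - x') \<le> 0" if "x' \<in> e" "y \<in> E" for x' y using n that by (auto simp: outward_unit_normal_def)
  have eE: "e \<subseteq> E" using e(1) facet_of_imp_subset by blast
  have move: "x' + t *\<^sub>R edge v k \<in> E" if "x' \<in> E" "0 \<le> loc v k x' + t" "loc v k x' + t \<le> 1" for x' t k
    using that unfolding mem_cuboid_iff[OF c] loc_add_edge[OF c] by auto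
  have tang: "n \<bullet> edge v k = 0" if "0 < loc v k x" "loc v k x < 1" for k
  proof -
    have "x + (1 - loc v k x) *\<^sub>R edge v k \<in> E" by (rule move) (use x eE that in auto)
    moreover have "x + (- loc v k x) *\<^sub>R edge v k \<in> E" by (rule move) (use x eE that in auto)
    ultimately have "(1 - loc v k x) * (n \<bullet> edge v k) \<le> 0" "loc v k x * (n \<bullet> edge v k) \<ge> 0"
      using nle[OF x] by force+
    then have "n \<bullet> edge v k \<le> 0" "n \<bullet> edge v k \<ge> 0"
      using that by (auto simp: mult_le_0_iff zero_le_mult_iff)
    then show ?thesis by simp
  qed
  have "((G \<bullet> edge v k) * (loc v k x - (loc v k x)\<^sup>2) / 2) * (edge v k \<bullet> n) = 0" for k
  proof (cases "0 < loc v k x \<and> loc v k x < 1")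
    case True
    then show ?thesis using tang[of k] by (simp add: inner_commute)
  next
    case False
    have "0 \<le> loc v k x" "loc v k x \<le> 1" using iffD1[OF mem_cuboid_iff[OF c] subsetD[OF eE x]] by simp_all
    with False have "loc v k x = 0 \<or> loc v k x = 1" by linarith
    then show ?thesis by (elim disjE) simp_all
  qed
  then have 1: "(\<Sum>k\<in>UNIV - {j}. (((G \<bullet> edge v k) * (loc v k x - (loc v k x)\<^sup>2) / 2) *\<^sub>R edge v k) \<bullet> n) = 0"
    by (intro sum.neutral ballI) (simp only: inner_scaleR_left)
  have "(1 + height v j s x) * (?o \<bullet> n) = 0"
  proof (rule ccontr)
    assume a: "(1 + height v j s x) * (?o \<bullet> n) \<noteq> 0"
    have hE: "- 1 \<le> height v j s x'" "height v j s x' \<le> 0" if "x' \<in> e" for x'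
      using iffD1[OF mem_cuboid_iff_height[OF c s] subsetD[OF eE that]] by blast+
    have mo: "x' + t *\<^sub>R ?o \<in> E" if "x' \<in> E" "- 1 \<le> height v j s x' + t" "height v j s x' + t \<le> 0" for x' t
    proof (rule iffD2[OF mem_cuboid_iff_height[OF c s]])
      show "face_proj v j s (x' + t *\<^sub>R ?o) \<in> E \<and> - 1 \<le> height v j s (x' + t *\<^sub>R ?o) \<and> height v j s (x' + t *\<^sub>R ?o) \<le> 0"
        unfolding height_add_outward[OF c s] face_proj_add_outward[OF c s]
        using iffD1[OF mem_cuboid_iff_height[OF c s] that(1)] that(2,3) by blast
    qed
    have "x + (- 1 - height v j s x) *\<^sub>R ?o \<in> E" by (rule mo[OF subsetD[OF eE x]]) (use hE[OF x] in auto)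
    from nle[OF x this] have "0 \<le> (1 + height v j s x) * (n \<bullet> ?o)" by (simp add: algebra_simps)
    moreover have "1 + height v j s x > 0" using a hE[OF x] by (cases "1 + height v j s x = 0") auto
    ultimately have "0 \<le> n \<bullet> ?o" by (simp add: zero_le_mult_iff)
    moreover have "n \<bullet> ?o \<noteq> 0" using a by (simp add: inner_commute)
    ultimately have pos: "n \<bullet> ?o > 0" by simp
    have sub: "e \<subseteq> cell_face E v j s"
    proof
      fix x' assume x': "x' \<in> e"
      have "x' + (- height v j s x') *\<^sub>R ?o \<in> E" by (rule mo[OF subsetD[OF eE x']]) simp_all
      from nle[OF x' this] have "0 \<le> height v j s x' * (n \<bullet> ?o)" by simp
      then have "height v j s x' = 0" using pos hE[OF x'] by (simp add: zero_le_mult_iff)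
      then show "x' \<in> cell_face E v j s" using x' eE by (auto simp: cell_face_def)
    qed
    have ef: "e face_of E" "aff_dim e = 2" using e(1) aff_dim_cuboid[OF c] by (auto simp: facet_of_def)
    have "cell_face E v j s \<subseteq> E" by (auto simp: cell_face_def)
    then have "e face_of cell_face E v j s" by (rule face_of_subset[OF ef(1) sub])
    from face_of_aff_dim_lt[OF face_of_imp_convex[OF cell_face_face_of[OF c s]] this e(2)]
    show False unfolding ef(2) aff_dim_cell_face[OF c s] by simp
  qed
  then have 2: "((1 + height v j s x) * (g0 + G \<bullet> x)) * (?o \<bullet> n) = 0" by auto
  show ?thesis unfolding face_field_def inner_add_left inner_sum_left using 1 2 by simp
qed

end

text \<open>Differences along the face show that \<open>W\<close> annihilates the two tangential
  edges. By skew symmetry the image of the third edge is orthogonal to all three edges, so it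
  vanishes as well.\<close>

lemma skew_zero_on_face:
  fixes W :: "real^3^3"
  assumes c: "cuboid E v" and s: "s \<in> {0, 1}" and W: "transpose W = - W"
    and z: "\<And>x. u + W *v (face_proj v j s x - b) = 0"
  shows "W = 0" "u = 0"
proof -
  have ip: "(W *v x) \<bullet> y = - (x \<bullet> (W *v y))" for x y
  proof -
    have "(W *v x) \<bullet> y = x \<bullet> (transpose W *v y)" using dot_lmul_matrix[of x "transpose W" y] by (simp only: vector_transpose_matrix)
    moreover have "(- W) *v y = - (W *v y)" by (simp add: matrix_vector_mult_def vec_eq_iff sum_negf)
    ultimately show ?thesis unfolding W by simp
  qed
  have W0: "W *v edge v k = 0" if "k \<noteq> j" for k
  proof -
    have h: "height v j s (x + 1 *\<^sub>R edge v k) = height v j s x" for x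
      unfolding height_def loc_add_edge[OF c] using that by simp
    have "face_proj v j s (0 + 1 *\<^sub>R edge v k) = face_proj v j s 0 + edge v k"
      unfolding face_proj_def h by simp
    then have "u + W *v (face_proj v j s 0 - b + edge v k) = 0" using z[of "0 + 1 *\<^sub>R edge v k"] by (simp add: algebra_simps)
    then have "(u + W *v (face_proj v j s 0 - b)) + W *v edge v k = 0"
      by (simp only: matrix_vector_right_distrib add.assoc)
    then show ?thesis unfolding z by simp
  qed
  have "(W *v edge v j) \<bullet> edge v k = 0" for k
    using W0[of k] ip[of "edge v j" "edge v k"] by (cases "k = j") (auto simp: inner_commute)
  then have "W *v edge v j = 0" using orthogonal_to_edges_zero[OF c] by blast
  then have We: "W *v edge v k = 0" for k using W0 by (cases "k = j") auto
  have "(W *v x) \<bullet> edge v k = 0" for x k using ip[of x "edge v k"] We by simp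
  then have "W *v x = 0" for x using orthogonal_to_edges_zero[OF c] by blast
  then show "W = 0" by (simp add: matrix_eq)
  then show "u = 0" using z[of 0] by simp
qed

section \<open>The inf-sup condition\<close>

lemma test_function_directional_derivative:
  assumes "test_function \<Omega> \<phi>"
  shows "((\<lambda>t. \<phi> (x + t *\<^sub>R d)) has_real_derivative (grad \<phi> x \<bullet> d)) (at 0)"
proof -
  define f' where "f' = frechet_derivative \<phi> (at x)"
  have f': "(\<phi> has_derivative f') (at x)"
    using continuous_test_function(3)[OF assms] unfolding f'_def by (simp add: frechet_derivative_works)
  then have lin: "linear f'" by (rule has_derivative_linear)
  have "((\<lambda>t::real. x + t *\<^sub>R d) has_derivative (\<lambda>t. t *\<^sub>R d)) (at 0)" by (auto intro!: derivative_eq_intros)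
  moreover have "(\<phi> has_derivative f') (at (x + 0 *\<^sub>R d))" using f' by simp
  ultimately have "((\<lambda>t. \<phi> (x + t *\<^sub>R d)) has_derivative (\<lambda>t. f' (t *\<^sub>R d))) (at 0)"
    by (rule has_derivative_compose)
  moreover have "grad \<phi> x \<bullet> d = f' d"
  proof -
    have "f' d = f' (\<Sum>i\<in>UNIV. d $ i *\<^sub>R axis i 1)"
      using basis_expansion[of d] by (simp add: scalar_mult_eq_scaleR)
    also have "\<dots> = (\<Sum>i\<in>UNIV. d $ i * f' (axis i 1))"
      using lin by (simp add: linear_sum linear_cmul)
    finally show ?thesis by (simp add: inner_vec_def grad_def partial_def f'_def mult.commute)
  qed
  moreover have "(\<lambda>t. f' (t *\<^sub>R d)) = (\<lambda>t. f' d * t)" using lin by (simp add: linear_cmul mult.commute fun_eq_iff)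
  ultimately show ?thesis unfolding has_field_derivative_def by simp
qed

context meshed_domain
begin

lemma sum_indicator_cell:
  fixes M :: "(real^3) set \<Rightarrow> 'b::real_vector"
  assumes F: "F \<in> T" and x: "x \<in> interior F"
  shows "(\<Sum>F'\<in>T. indicator (interior F') x *\<^sub>R M F') = M F"
proof -
  have "(\<Sum>F'\<in>T. indicator (interior F') x *\<^sub>R M F') = (\<Sum>F'\<in>T. if F' = F then M F else 0)"
  proof (intro sum.cong refl)
    fix F' assume F': "F' \<in> T"
    show "indicator (interior F') x *\<^sub>R M F' = (if F' = F then M F else 0)"
      using cells_eq_of_interior[OF F F' x] x interior_subset[of F'] by (auto simp: indicator_def)
  qed
  then show ?thesis using F finite_T by simp
qed

lemma piecewise_L2:
  fixes M :: "(real^3) set \<Rightarrow> real^3 \<Rightarrow> 'b::euclidean_space"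
  assumes M: "\<And>F. F \<in> T \<Longrightarrow> continuous_on UNIV (M F)"
  shows "L2_on \<Omega> (\<lambda>x. \<Sum>F\<in>T. indicator (interior F) x *\<^sub>R M F x)" (is "L2_on \<Omega> ?f")
  unfolding L2_on_def
proof
  have "?f \<in> borel_measurable borel"
    using M by (intro borel_measurable_sum borel_measurable_scaleR borel_measurable_indicator borel_measurable_continuous_onI) auto
  then show "?f \<in> borel_measurable (lebesgue_on \<Omega>)"
    by (intro measurable_restrict_space1 measurable_completion) simp
  show "integrable (lebesgue_on \<Omega>) (\<lambda>x. (norm (?f x))\<^sup>2)"
  proof (rule integral_over_cells(1))
    fix F assume F: "F \<in> T"
    have "integrable (lebesgue_on (interior F)) (\<lambda>x. (norm (M F x))\<^sup>2)"
      by (rule integrable_on_cell[OF cells[OF F]]) (intro continuous_intros M[OF F])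
    moreover have "(norm (?f x))\<^sup>2 = (norm (M F x))\<^sup>2" if "x \<in> interior F" for x
      using sum_indicator_cell[OF F that, of "\<lambda>F. M F x"] by simp
    ultimately show "integrable (lebesgue_on (interior F)) (\<lambda>x. (norm (?f x))\<^sup>2)"
      by (subst Bochner_Integration.integrable_cong[OF refl]) auto
  qed
qed

definition single_row :: "3 \<Rightarrow> real^3 \<Rightarrow> real^3^3" where
  "single_row i0 a = (\<chi> i. if i = i0 then a else 0)"

lemma inner_single_row: "M \<bullet> single_row i0 a = M $ i0 \<bullet> a"
proof -
  have "M \<bullet> single_row i0 a = (\<Sum>i\<in>UNIV. if i = i0 then M $ i0 \<bullet> a else 0)"
    unfolding inner_vec_def[of M] by (intro sum.cong refl) (simp add: single_row_def)
  then show ?thesis by simp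
qed

lemma continuous_single_row [continuous_intros]: "continuous_on S f \<Longrightarrow> continuous_on S (\<lambda>x. single_row i0 (f x))"
proof -
  assume "continuous_on S f"
  then have "continuous_on S (\<lambda>x. if i = i0 then f x else 0)" for i by (cases "i = i0") auto
  then show ?thesis unfolding single_row_def by (rule continuous_on_vec_lambda)
qed

text \<open>Geometrically the same point as \<open>cell_center\<close>; the definition by integrals
  makes the vanishing mean in \<open>cell_int_barycenter\<close> immediate.\<close>

definition barycenter :: "(real^3) set \<Rightarrow> real^3" where
  "barycenter F = (\<chi> k. cell_int F (\<lambda>x. x $ k) / cell_int F (\<lambda>x. 1))"

definition rigid :: "(real^3 \<Rightarrow> real^3) \<Rightarrow> (real^3 \<Rightarrow> real^3^3) \<Rightarrow> (real^3) set \<Rightarrow> 3 \<Rightarrow> real^3 \<Rightarrow> real" where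
  "rigid u \<gamma> F i x = u (cell_center F) $ i + \<gamma> (cell_center F) $ i \<bullet> (x - barycenter F)"

lemma cell_int_barycenter:
  assumes F: "F \<in> T" shows "cell_int F (\<lambda>x. a \<bullet> (x - barycenter F)) = 0"
proof -
  note c = cells[OF F]
  have m: "cell_int F (\<lambda>x. 1) \<noteq> 0"
    using cell_int_square_zero[OF c, of "\<lambda>_. 1"] cell_center[OF F] by auto
  have "cell_int F (\<lambda>x. a $ k * (x $ k - barycenter F $ k)) = 0" for k
  proof -
    have "cell_int F (\<lambda>x. x $ k + (- barycenter F $ k) * 1) = cell_int F (\<lambda>x. x $ k) + cell_int F (\<lambda>x. (- barycenter F $ k) * 1)"
      by (rule cell_int_add[OF c]) (intro continuous_intros)+
    also have "\<dots> = cell_int F (\<lambda>x. x $ k) + (- barycenter F $ k) * cell_int F (\<lambda>x. 1)"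
      by (simp only: cell_int_mult)
    also have "\<dots> = 0" using m by (simp add: barycenter_def)
    finally show ?thesis unfolding cell_int_mult by simp
  qed
  moreover have "cell_int F (\<lambda>x. a \<bullet> (x - barycenter F)) = (\<Sum>k\<in>UNIV. cell_int F (\<lambda>x. a $ k * (x $ k - barycenter F $ k)))"
    unfolding inner_vec_def by (subst cell_int_sum[OF c, symmetric]) (auto intro!: continuous_intros)
  ultimately show ?thesis by simp
qed

section \<open>Test stresses assembled from weighted face fields\<close>

context
  fixes \<beta> :: "(real^3) set \<Rightarrow> real" and J :: "(real^3) set \<Rightarrow> 3" and S :: "(real^3) set \<Rightarrow> real"
    and g0 :: real and G :: "real^3" and i0 :: 3
  assumes S: "\<And>F. F \<in> T \<Longrightarrow> S F \<in> {0, 1}"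
    and G: "\<And>F. F \<in> T \<Longrightarrow> \<beta> F \<noteq> 0 \<Longrightarrow> G \<bullet> edge (r F) (J F) = 0"
    and flux: "\<And>\<phi>. test_function \<Omega> \<phi> \<Longrightarrow>
      (\<Sum>F\<in>T. \<beta> F * cell_int F (\<lambda>x. (g0 + G \<bullet> x) * \<phi> (face_proj (r F) (J F) (S F) x))) = 0"
    and free: "\<And>F. F \<in> T \<Longrightarrow> \<beta> F \<noteq> 0 \<Longrightarrow> \<not> cell_face F (r F) (J F) (S F) \<subseteq> \<Gamma>N"
begin

definition flux_field :: "(real^3) set \<Rightarrow> real^3 \<Rightarrow> real^3" where
  "flux_field F x = \<beta> F *\<^sub>R face_field (r F) (J F) (S F) g0 G x"

definition flux_div :: "(real^3) set \<Rightarrow> real" where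
  "flux_div F = \<beta> F * face_div (r F) (J F) g0 G"

text \<open>Only row \<open>i0\<close> is nonzero. The weights \<beta> will select either one cell
  at a Dirichlet face or two cells sharing a face; the assumption \<open>flux\<close> expresses,
  against test functions, that the normal component has no jump inside the domain.\<close>

definition patch_field :: "real^3 \<Rightarrow> real^3^3" where
  "patch_field x = (\<Sum>F\<in>T. indicator (interior F) x *\<^sub>R single_row i0 (flux_field F x))"

definition patch_div :: "real^3 \<Rightarrow> real^3" where
  "patch_div x = (\<Sum>F\<in>T. indicator (interior F) x *\<^sub>R axis i0 (flux_div F))"

lemma patch_field_cell: "F \<in> T \<Longrightarrow> x \<in> interior F \<Longrightarrow> patch_field x = single_row i0 (flux_field F x)"
  unfolding patch_field_def by (rule sum_indicator_cell)

lemma patch_div_cell: "F \<in> T \<Longrightarrow> x \<in> interior F \<Longrightarrow> patch_div x = axis i0 (flux_div F)"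
  unfolding patch_div_def by (rule sum_indicator_cell)

lemma continuous_flux_field: "F \<in> T \<Longrightarrow> continuous_on UNIV (flux_field F)"
  unfolding flux_field_def[abs_def]
  by (cases "\<beta> F = 0") (auto intro!: continuous_intros continuous_face_field[OF cells S G])

text \<open>The Green formula on one cell, applied below with a test function and with a rigid
  motion as \<psi>. Tangentiality of \<open>G\<close> is known only for cells of nonzero weight,
  hence the case distinction.\<close>

lemma flux_field_flux:
  assumes F: "F \<in> T" and co: "continuous_on UNIV \<psi>" "continuous_on UNIV \<Psi>"
    and der: "\<And>x d. ((\<lambda>t. \<psi> (x + t *\<^sub>R d)) has_real_derivative (\<Psi> x \<bullet> d)) (at 0)"
  shows "cell_int F (\<lambda>x. flux_div F * \<psi> x) + cell_int F (\<lambda>x. flux_field F x \<bullet> \<Psi> x)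
    = \<beta> F * cell_int F (\<lambda>x. (g0 + G \<bullet> x) * \<psi> (face_proj (r F) (J F) (S F) x))"
proof (cases "\<beta> F = 0")
  case True
  then show ?thesis by (simp add: flux_div_def flux_field_def cell_int_def)
next
  case False
  note c = cells[OF F]
  have "cell_int F (\<lambda>x. flux_div F * \<psi> x) + cell_int F (\<lambda>x. flux_field F x \<bullet> \<Psi> x) = cell_int F (\<lambda>x. flux_div F * \<psi> x + flux_field F x \<bullet> \<Psi> x)"
    by (rule cell_int_add[OF c, symmetric]) (intro continuous_intros co continuous_flux_field[OF F])+
  also have "\<dots> = cell_int F (\<lambda>x. \<beta> F * (face_div (r F) (J F) g0 G * \<psi> x + face_field (r F) (J F) (S F) g0 G x \<bullet> \<Psi> x))"
    by (simp add: flux_div_def flux_field_def distrib_left mult.assoc)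
  also have "\<dots> = \<beta> F * cell_int F (\<lambda>x. (g0 + G \<bullet> x) * \<psi> (face_proj (r F) (J F) (S F) x))"
    unfolding cell_int_mult face_field_flux[OF c S[OF F] G[OF F False] co der] ..
  finally show ?thesis .
qed

lemma patch_field_L2: "L2_on \<Omega> patch_field"
  unfolding patch_field_def[abs_def] by (intro piecewise_L2 continuous_intros continuous_flux_field)

lemma patch_div_L2: "L2_on \<Omega> patch_div"
  unfolding patch_div_def[abs_def] by (intro piecewise_L2 continuous_intros)

text \<open>Summing the Green formula over the cells leaves the face contributions, and these cancel
  by \<open>flux\<close>; so the piecewise divergence is the weak one.\<close>

lemma patch_field_div: "has_L2_div \<Omega> patch_field patch_div"
  unfolding has_L2_div_def
proof (intro conjI allI impI patch_div_L2)
  fix i \<phi> assume \<phi>: "test_function \<Omega> \<phi>"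
  note co = continuous_test_function(1,2)[OF \<phi>]
  have d: "patch_div x $ i * \<phi> x = (if i = i0 then flux_div F * \<phi> x else 0)" if "F \<in> T" "x \<in> interior F" for F x
    using patch_div_cell[OF that] by (simp add: axis_def)
  have f: "patch_field x $ i \<bullet> grad \<phi> x = (if i = i0 then flux_field F x \<bullet> grad \<phi> x else 0)" if "F \<in> T" "x \<in> interior F" for F x
    using patch_field_cell[OF that] by (simp add: single_row_def)
  have cd: "continuous_on UNIV (\<lambda>x. if i = i0 then flux_div F * \<phi> x else 0)" for F
    by (cases "i = i0") (auto intro!: continuous_intros co)
  have cf: "continuous_on UNIV (\<lambda>x. if i = i0 then flux_field F x \<bullet> grad \<phi> x else 0)" if "F \<in> T" for F
    by (cases "i = i0") (auto intro!: continuous_intros co continuous_flux_field[OF that])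
  have 1: "(\<integral>x. patch_div x $ i * \<phi> x \<partial>lebesgue_on \<Omega>) = (\<Sum>F\<in>T. cell_int F (\<lambda>x. if i = i0 then flux_div F * \<phi> x else 0))"
  proof -
    have "(\<integral>x. patch_div x $ i * \<phi> x \<partial>lebesgue_on \<Omega>) = (\<Sum>F\<in>T. \<integral>x. patch_div x $ i * \<phi> x \<partial>lebesgue_on (interior F))"
      by (rule integral_over_cells(2))
         (subst Bochner_Integration.integrable_cong[OF refl], rule d, auto intro!: integrable_on_cell[OF cells cd])
    also have "\<dots> = (\<Sum>F\<in>T. cell_int F (\<lambda>x. if i = i0 then flux_div F * \<phi> x else 0))"
      using cell_int_cong d unfolding cell_int_def by (intro sum.cong refl Bochner_Integration.integral_cong) auto
    finally show ?thesis .
  qed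
  have 2: "(\<integral>x. patch_field x $ i \<bullet> grad \<phi> x \<partial>lebesgue_on \<Omega>) = (\<Sum>F\<in>T. cell_int F (\<lambda>x. if i = i0 then flux_field F x \<bullet> grad \<phi> x else 0))"
  proof -
    have "(\<integral>x. patch_field x $ i \<bullet> grad \<phi> x \<partial>lebesgue_on \<Omega>) = (\<Sum>F\<in>T. \<integral>x. patch_field x $ i \<bullet> grad \<phi> x \<partial>lebesgue_on (interior F))"
      by (rule integral_over_cells(2))
         (subst Bochner_Integration.integrable_cong[OF refl], rule f, auto intro!: integrable_on_cell[OF cells cf])
    also have "\<dots> = (\<Sum>F\<in>T. cell_int F (\<lambda>x. if i = i0 then flux_field F x \<bullet> grad \<phi> x else 0))"
      unfolding cell_int_def using f by (intro sum.cong refl Bochner_Integration.integral_cong) auto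
    finally show ?thesis .
  qed
  show "(\<integral>x. patch_div x $ i * \<phi> x \<partial>lebesgue_on \<Omega>) = - (\<integral>x. patch_field x $ i \<bullet> grad \<phi> x \<partial>lebesgue_on \<Omega>)"
  proof (cases "i = i0")
    case True
    have "(\<Sum>F\<in>T. cell_int F (\<lambda>x. flux_div F * \<phi> x)) + (\<Sum>F\<in>T. cell_int F (\<lambda>x. flux_field F x \<bullet> grad \<phi> x)) =
       (\<Sum>F\<in>T. \<beta> F * cell_int F (\<lambda>x. (g0 + G \<bullet> x) * \<phi> (face_proj (r F) (J F) (S F) x)))"
      unfolding sum.distrib[symmetric]
      by (intro sum.cong refl flux_field_flux co test_function_directional_derivative[OF \<phi>])
    then show ?thesis unfolding 1 2 using True flux[OF \<phi>] by simp
  next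
    case False
    then show ?thesis unfolding 1 2 by (simp add: cell_int_def)
  qed
qed

lemma patch_field_local:
  assumes F: "F \<in> T"
  shows "\<exists>P. local_stress F (r F) patch_field P"
proof -
  define p where "p = (if \<beta> F = 0 then (\<lambda>x. 0) else (\<lambda>x. \<beta> F *\<^sub>R ref_face_field (J F) (S F)
     ((2 * S F - 1) * (g0 + G \<bullet> r F 1)) (\<chi> k. (2 * S F - 1) * (G \<bullet> edge (r F) k)) x))"
  have p: "p \<in> ERT0" unfolding p_def using ERT0_zero ERT0_scale[OF ref_face_field_ERT0[OF S[OF F]]] by auto
  have pf: "piola_vec (r F) p x = flux_field F x" for x
  proof (cases "\<beta> F = 0")
    case True then show ?thesis by (simp add: p_def flux_field_def piola_vec_def)
  next
    case False
    then show ?thesis using face_field_piola[OF cells[OF F] S[OF F] G[OF F False], of g0]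
      by (simp add: p_def flux_field_def piola_vec_def scaleR_sum_right)
  qed
  have "local_stress F (r F) patch_field (\<lambda>i. if i = i0 then p else (\<lambda>x. 0))"
    unfolding local_stress_def
  proof (intro conjI allI ballI)
    show "(if i = i0 then p else (\<lambda>x. 0)) \<in> ERT0" for i using p ERT0_zero by simp
    fix x assume "x \<in> interior F"
    then show "patch_field x = (\<chi> i. piola_vec (r F) (if i = i0 then p else (\<lambda>x. 0)) x)"
      using patch_field_cell[OF F] by (simp add: vec_eq_iff single_row_def pf) (simp add: piola_vec_def)
  qed
  then show ?thesis by blast
qed

text \<open>By \<open>free\<close> a facet within \<Gamma>N is never the face that carries the flux
  of a cell of nonzero weight, and on every other facet a face field has no normal
  component.\<close>

lemma patch_field_in_X: "patch_field \<in> X"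
  unfolding X_iff
proof (intro conjI ballI allI impI patch_field_L2 patch_field_local)
  show "\<exists>g. has_L2_div \<Omega> patch_field g" using patch_field_div by blast
  fix F e n x
  assume F: "F \<in> T" and e: "e facet_of F \<and> e \<subseteq> \<Gamma>N \<and> outward_unit_normal F e n" and x: "x \<in> e"
  note c = cells[OF F]
  have xF: "x \<in> F" using e x facet_of_imp_subset by blast
  have tr: "trace_from F patch_field x = single_row i0 (flux_field F x)"
    by (rule trace_from_eq[OF c continuous_on_subset[OF _ subset_UNIV] patch_field_cell[OF F] xF])
      (intro continuous_intros continuous_flux_field[OF F])
  have "flux_field F x \<bullet> n = 0"
  proof (cases "\<beta> F = 0")
    case False
    have "e \<noteq> cell_face F (r F) (J F) (S F)" using free[OF F False] e by blast
    then show ?thesis using face_field_other_normal[OF c S[OF F] G[OF F False] _ _ _ x, of n g0] e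
      by (simp add: flux_field_def)
  qed (simp add: flux_field_def)
  then show "trace_from F patch_field x *v n = 0"
    unfolding tr by (simp add: vec_eq_iff matrix_vector_mul_component single_row_def)
qed

text \<open>Up to a term of mean zero, the two pairings on a cell are the left side of
  \<open>flux_field_flux\<close> with \<open>rigid\<close> as \<psi>, whose gradient is row
  \<open>i0\<close> of \<gamma>.\<close>

lemma patch_field_test:
  assumes u: "\<And>F. F \<in> T \<Longrightarrow> u constant_on interior F" and \<gamma>: "\<And>F. F \<in> T \<Longrightarrow> \<gamma> constant_on interior F"
  shows "l2_inner \<Omega> u (wdiv \<Omega> patch_field) + l2_inner \<Omega> \<gamma> patch_field =
    (\<Sum>F\<in>T. \<beta> F * cell_int F (\<lambda>x. (g0 + G \<bullet> x) * rigid u \<gamma> F i0 (face_proj (r F) (J F) (S F) x)))"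
proof -
  have "l2_inner \<Omega> u (wdiv \<Omega> patch_field) = (\<Sum>F\<in>T. u (cell_center F) \<bullet> cell_integral F (wdiv \<Omega> patch_field))"
    by (rule l2_inner_piecewise[OF u wdiv_integrable[OF patch_field_in_X]])
  also have "\<dots> = (\<Sum>F\<in>T. u (cell_center F) \<bullet> cell_integral F patch_div)"
    by (intro sum.cong refl arg_cong2[where f = inner] cell_integral_wdiv patch_field_in_X patch_field_div)
  also have "\<dots> = (\<Sum>F\<in>T. cell_int F (\<lambda>x. flux_div F * u (cell_center F) $ i0))"
  proof (rule sum.cong[OF refl])
    fix F assume F: "F \<in> T"
    have "u (cell_center F) \<bullet> cell_integral F patch_div = cell_int F (\<lambda>x. u (cell_center F) \<bullet> patch_div x)"
      unfolding cell_integral_def cell_int_def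
      using integrable_on_interior[OF L2_integrable[OF patch_div_L2] F] by (intro integral_inner_right[symmetric]) auto
    also have "\<dots> = cell_int F (\<lambda>x. flux_div F * u (cell_center F) $ i0)"
      using patch_div_cell[OF F] by (intro cell_int_cong) (simp add: inner_axis)
    finally show "u (cell_center F) \<bullet> cell_integral F patch_div = cell_int F (\<lambda>x. flux_div F * u (cell_center F) $ i0)" .
  qed
  finally have 1: "l2_inner \<Omega> u (wdiv \<Omega> patch_field) = (\<Sum>F\<in>T. cell_int F (\<lambda>x. flux_div F * u (cell_center F) $ i0))" .
  have "l2_inner \<Omega> \<gamma> patch_field = (\<Sum>F\<in>T. \<gamma> (cell_center F) \<bullet> cell_integral F patch_field)"
    by (rule l2_inner_piecewise[OF \<gamma> L2_integrable[OF patch_field_L2]])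
  also have "\<dots> = (\<Sum>F\<in>T. cell_int F (\<lambda>x. flux_field F x \<bullet> \<gamma> (cell_center F) $ i0))"
  proof (rule sum.cong[OF refl])
    fix F assume F: "F \<in> T"
    have "\<gamma> (cell_center F) \<bullet> cell_integral F patch_field = cell_int F (\<lambda>x. \<gamma> (cell_center F) \<bullet> patch_field x)"
      unfolding cell_integral_def cell_int_def
      using integrable_on_interior[OF L2_integrable[OF patch_field_L2] F] by (intro integral_inner_right[symmetric]) auto
    also have "\<dots> = cell_int F (\<lambda>x. flux_field F x \<bullet> \<gamma> (cell_center F) $ i0)"
      using patch_field_cell[OF F] by (intro cell_int_cong) (simp add: inner_single_row inner_commute)
    finally show "\<gamma> (cell_center F) \<bullet> cell_integral F patch_field = cell_int F (\<lambda>x. flux_field F x \<bullet> \<gamma> (cell_center F) $ i0)" .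
  qed
  finally have 2: "l2_inner \<Omega> \<gamma> patch_field = (\<Sum>F\<in>T. cell_int F (\<lambda>x. flux_field F x \<bullet> \<gamma> (cell_center F) $ i0))" .
  show ?thesis unfolding 1 2 sum.distrib[symmetric]
  proof (rule sum.cong[OF refl])
    fix F assume F: "F \<in> T"
    note c = cells[OF F]
    let ?a = "\<gamma> (cell_center F) $ i0"
    have "cell_int F (\<lambda>x. flux_div F * rigid u \<gamma> F i0 x) = cell_int F (\<lambda>x. flux_div F * u (cell_center F) $ i0 + flux_div F * (?a \<bullet> (x - barycenter F)))"
      by (simp add: rigid_def distrib_left)
    also have "\<dots> = cell_int F (\<lambda>x. flux_div F * u (cell_center F) $ i0) + flux_div F * cell_int F (\<lambda>x. ?a \<bullet> (x - barycenter F))"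
      by (subst cell_int_add[OF c]) (auto intro!: continuous_intros simp: cell_int_mult)
    also have "cell_int F (\<lambda>x. ?a \<bullet> (x - barycenter F)) = 0" by (rule cell_int_barycenter[OF F])
    finally have "cell_int F (\<lambda>x. flux_div F * rigid u \<gamma> F i0 x) = cell_int F (\<lambda>x. flux_div F * u (cell_center F) $ i0)" by simp
    moreover have "cell_int F (\<lambda>x. flux_div F * rigid u \<gamma> F i0 x) + cell_int F (\<lambda>x. flux_field F x \<bullet> ?a)
      = \<beta> F * cell_int F (\<lambda>x. (g0 + G \<bullet> x) * rigid u \<gamma> F i0 (face_proj (r F) (J F) (S F) x))"
    proof (rule flux_field_flux[OF F])
      show "continuous_on UNIV (rigid u \<gamma> F i0)" unfolding rigid_def[abs_def] by (intro continuous_intros)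
      show "continuous_on UNIV (\<lambda>x::real^3. ?a)" by (rule continuous_on_const)
      show "((\<lambda>t. rigid u \<gamma> F i0 (x + t *\<^sub>R d)) has_real_derivative ?a \<bullet> d) (at 0)" for x d
        unfolding rigid_def by (auto intro!: derivative_eq_intros simp: inner_add_right inner_diff_right)
    qed
    ultimately show "cell_int F (\<lambda>x. flux_div F * u (cell_center F) $ i0) + cell_int F (\<lambda>x. flux_field F x \<bullet> ?a)
      = \<beta> F * cell_int F (\<lambda>x. (g0 + G \<bullet> x) * rigid u \<gamma> F i0 (face_proj (r F) (J F) (S F) x))" by simp
  qed
qed

end

text \<open>Supplies the data of a face field: an affine function composed with the projection onto
  the face is affine again, and its gradient \<open>G\<close> is the tangential part of the original
  gradient.\<close>

lemma affine_rigid_proj: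
  assumes F: "F \<in> T" and s: "s \<in> {0, 1}"
  obtains g0 G where "G \<bullet> outward (r F) j s = 0"
    "\<And>x. g0 + G \<bullet> x = rigid u \<gamma> F i (face_proj (r F) j s x)"
proof -
  note c = cells[OF F]
  let ?o = "outward (r F) j s" and ?a = "\<gamma> (cell_center F) $ i"
  have oo: "?o \<bullet> ?o \<noteq> 0" using outward_nonzero[OF c s, of j] by simp
  define p where "p = face_proj (r F) j s 0"
  have hp: "height (r F) j s p = 0" unfolding p_def by (rule height_face_proj[OF c s])
  define G where "G = ?a - (?a \<bullet> ?o / (?o \<bullet> ?o)) *\<^sub>R ?o"
  show ?thesis
  proof
    show "G \<bullet> ?o = 0" using oo by (simp add: G_def inner_diff_left)
    show "(rigid u \<gamma> F i p - G \<bullet> p) + G \<bullet> x = rigid u \<gamma> F i (face_proj (r F) j s x)" for x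
    proof -
      have "face_proj (r F) j s x = p + ((x - p) - ((x - p) \<bullet> ?o / (?o \<bullet> ?o)) *\<^sub>R ?o)"
        unfolding face_proj_def height_inner[OF c s hp] by simp
      then have "rigid u \<gamma> F i (face_proj (r F) j s x) = rigid u \<gamma> F i p + ?a \<bullet> ((x - p) - ((x - p) \<bullet> ?o / (?o \<bullet> ?o)) *\<^sub>R ?o)"
        by (simp add: rigid_def inner_diff_right inner_add_right)
      also have "?a \<bullet> ((x - p) - ((x - p) \<bullet> ?o / (?o \<bullet> ?o)) *\<^sub>R ?o) = G \<bullet> (x - p)"
        unfolding G_def inner_diff_left[of ?a] inner_diff_right[of ?a "x - p"] inner_scaleR_left inner_scaleR_right
          inner_commute[of "x - p" ?o] by simp
      finally show ?thesis by (simp add: inner_diff_right)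
    qed
  qed
qed

text \<open>A step of size \<open>t\<close> in direction \<open>G\<close> stays in the set and
  changes the value by \<open>t\<close> times the square of the norm of \<open>G\<close>, so
  \<open>G\<close> vanishes. The summand 1 in the denominator of \<open>t\<close> covers
  \<open>G\<close> = 0.\<close>

lemma affine_zero_on_open:
  assumes "open U" "x0 \<in> U" "\<And>x. x \<in> U \<Longrightarrow> g0 + G \<bullet> x = 0"
  shows "g0 + G \<bullet> (y::real^3) = 0"
proof -
  obtain e where e: "e > 0" "ball x0 e \<subseteq> U" using assms(1,2) open_contains_ball by blast
  define t where "t = e / (2 * (norm G + 1))"
  have t: "t > 0" using e(1) by (simp add: t_def add_nonneg_pos)
  have "norm (t *\<^sub>R G) < e"
  proof -
    have "norm G + 1 > 0" using norm_ge_zero[of G] by linarith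
    then have "t * (2 * (norm G + 1)) = e" unfolding t_def by simp
    then have "e = t * norm G + (t * norm G + 2 * t)" by (simp add: algebra_simps)
    moreover have "0 \<le> t * norm G" using t by simp
    ultimately have "t * norm G < e" using t by linarith
    then show ?thesis using t by simp
  qed
  then have "x0 + t *\<^sub>R G \<in> U" using e(2) by (auto simp: dist_norm subset_iff)
  then have "g0 + G \<bullet> (x0 + t *\<^sub>R G) = 0" "g0 + G \<bullet> x0 = 0" using assms(2,3) by blast+
  then have "t * (G \<bullet> G) = 0" unfolding inner_add_right inner_scaleR_right by linarith
  then have "G = 0" using t by simp
  then show ?thesis using \<open>g0 + G \<bullet> x0 = 0\<close> by simp
qed

lemma rigid_zero:
  assumes F: "F \<in> T" and s: "s \<in> {0, 1}" and skew: "transpose (\<gamma> (cell_center F)) = - \<gamma> (cell_center F)"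
    and z: "\<And>i x. rigid u \<gamma> F i (face_proj (r F) j s x) = 0"
  shows "u (cell_center F) = 0" "\<gamma> (cell_center F) = 0"
proof -
  have "u (cell_center F) + \<gamma> (cell_center F) *v (face_proj (r F) j s x - barycenter F) = 0" for x
    using z[of _ x] by (simp add: vec_eq_iff rigid_def matrix_vector_mul_component)
  from skew_zero_on_face[OF cells[OF F] s skew this]
  show "u (cell_center F) = 0" "\<gamma> (cell_center F) = 0" by blast+
qed

text \<open>A face field with data \<open>g\<close> pairs with \<open>(u, \<gamma>)\<close> to the integral of \<open>g\<close> against the jump of the
  piecewise rigid motion \<open>u + \<gamma> (x - b)\<close>; taking \<open>g\<close> to be that jump forces it to vanish.\<close>

lemma stress_pairing_injective:
  assumes u: "u \<in> Vh T" and \<gamma>: "\<gamma> \<in> Wh0 T"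
    and orth: "\<And>\<tau>. \<tau> \<in> X \<Longrightarrow> l2_inner \<Omega> u (wdiv \<Omega> \<tau>) + l2_inner \<Omega> \<gamma> \<tau> = 0"
    and F: "F \<in> T"
  shows "u (cell_center F) = 0 \<and> \<gamma> (cell_center F) = 0"
proof -
  have uc: "u constant_on interior F" if "F \<in> T" for F using u that by (simp add: Vh_def)
  have gc: "\<gamma> constant_on interior F" if "F \<in> T" for F using \<gamma> that by (simp add: Wh0_def)
  have skew: "transpose (\<gamma> (cell_center F)) = - \<gamma> (cell_center F)" if "F \<in> T" for F
    using \<gamma> that cell_center[OF that] by (simp add: Wh0_def)
  have aff: "rigid u \<gamma> F i (face_proj (r F) j s x) = 0"
    if F: "F \<in> T" and s: "s \<in> {0, 1}" and eq: "\<And>x. g0 + G \<bullet> x = rigid u \<gamma> F i (face_proj (r F) j s x)"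
      and z: "cell_int F (\<lambda>x. (g0 + G \<bullet> x) * (g0 + G \<bullet> x)) = 0" for F s j i g0 G x
  proof -
    have "continuous_on UNIV (\<lambda>x. g0 + G \<bullet> x)" by (intro continuous_intros)
    from cell_int_square_zero[OF cells[OF F] this z]
    have "g0 + G \<bullet> y = 0" if "y \<in> interior F" for y using that .
    from affine_zero_on_open[OF open_interior cell_center[OF F] this] show ?thesis unfolding eq[symmetric] .
  qed
  define C where "C = {F \<in> T. u (cell_center F) = 0 \<and> \<gamma> (cell_center F) = 0}"
  have CT: "C \<subseteq> T" by (auto simp: C_def)
  have rigid0: "rigid u \<gamma> F i x = 0" if "F \<in> C" for F i x using that by (simp add: C_def rigid_def)
  have "C \<noteq> {}"
  proof -
    obtain E j s where E: "E \<in> T" and s: "s \<in> {0, 1}" and fr: "cell_face E (r E) j s \<subseteq> frontier \<Omega>"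
      and nN: "\<not> cell_face E (r E) j s \<subseteq> \<Gamma>N" by (rule dirichlet_face)
    note c = cells[OF E]
    have "rigid u \<gamma> E i (face_proj (r E) j s x) = 0" for i x
    proof -
      obtain g0 G where G: "G \<bullet> outward (r E) j s = 0"
        and eq: "\<And>x. g0 + G \<bullet> x = rigid u \<gamma> E i (face_proj (r E) j s x)"
        using affine_rigid_proj[OF E s] by blast
      \<comment> \<open>The test stress lives on the Dirichlet cell alone. Its flux through the face
        needs no counterpart, because the face lies in the boundary, where test functions
        vanish.\<close>
      define \<beta> :: "(real^3) set \<Rightarrow> real" where "\<beta> F = (if F = E then 1 else 0)" for F
      have sum: "(\<Sum>F\<in>T. \<beta> F * f F) = f E" for f :: "(real^3) set \<Rightarrow> real"
      proof -
        have "(\<Sum>F\<in>T. \<beta> F * f F) = (\<Sum>F\<in>T. if F = E then f E else 0)" by (intro sum.cong) (auto simp: \<beta>_def)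
        then show ?thesis using E finite_T by simp
      qed
      have H1: "G \<bullet> edge (r F) j = 0" if "\<beta> F \<noteq> 0" for F
        using G s that by (auto simp: \<beta>_def outward_def split: if_splits)
      have H2: "(\<Sum>F\<in>T. \<beta> F * cell_int F (\<lambda>x. (g0 + G \<bullet> x) * \<phi> (face_proj (r F) j s x))) = 0"
        if "test_function \<Omega> \<phi>" for \<phi>
      proof -
        have "\<phi> (face_proj (r E) j s x) = 0" if x: "x \<in> interior E" for x
        proof -
          have "face_proj (r E) j s x \<in> cell_face E (r E) j s"
            using iffD1[OF mem_cuboid_iff_height[OF c s] subsetD[OF interior_subset x], of j]
            by (simp add: cell_face_def height_face_proj[OF c s])
          then have "face_proj (r E) j s x \<notin> \<Omega>" using fr open_dom by (auto simp: frontier_def interior_open)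
          then show ?thesis using \<open>test_function \<Omega> \<phi>\<close> closure_subset[of "{x. \<phi> x \<noteq> 0}"]
            unfolding test_function_def by blast
        qed
        then have "cell_int E (\<lambda>x. (g0 + G \<bullet> x) * \<phi> (face_proj (r E) j s x)) = cell_int E (\<lambda>x. 0)"
          by (intro cell_int_cong) simp
        then show ?thesis unfolding sum by (simp add: cell_int_def)
      qed
      have H3: "\<not> cell_face F (r F) j s \<subseteq> \<Gamma>N" if "\<beta> F \<noteq> 0" for F
        using nN that by (auto simp: \<beta>_def split: if_splits)
      note pf = patch_field_in_X[where \<beta> = \<beta> and J = "\<lambda>_. j" and S = "\<lambda>_. s" and ?g0.0 = g0 and G = G and ?i0.0 = i, OF s H1 H2 H3]
      note pt = patch_field_test[where \<beta> = \<beta> and J = "\<lambda>_. j" and S = "\<lambda>_. s" and ?g0.0 = g0 and G = G and ?i0.0 = i, OF s H1 H2 H3 uc gc]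
      have "cell_int E (\<lambda>x. (g0 + G \<bullet> x) * rigid u \<gamma> E i (face_proj (r E) j s x)) = 0"
        using pt orth[OF pf] unfolding sum by simp
      then show ?thesis unfolding eq[symmetric] by (intro aff[OF E s eq, unfolded eq[symmetric]]) simp
    qed
    from rigid_zero[OF E s skew[OF E] this] have "E \<in> C" using E by (simp add: C_def)
    then show ?thesis by blast
  qed
  have "C = T"
  proof (rule ccontr)
    assume "C \<noteq> T"
    then obtain E E' j s j' s' z where E: "E \<in> C" and E': "E' \<in> T - C" and s: "s \<in> {0, 1}" and s': "s' \<in> {0, 1}"
      and e: "E \<inter> E' = cell_face E (r E) j s" and e': "E \<inter> E' = cell_face E' (r E') j' s'"
      and z: "z \<in> E \<inter> E'" "z \<in> \<Omega>"
      using adjacent_across[OF CT \<open>C \<noteq> {}\<close>] by metis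
    have ET: "E \<in> T" "E' \<in> T" "E \<noteq> E'" using E E' CT by auto
    note c = cells[OF ET(1)] and c' = cells[OF ET(2)]
    obtain \<mu> where mu: "\<mu> > 0" and o': "outward (r E') j' s' = - \<mu> *\<^sub>R outward (r E) j s"
      and h': "\<And>x. height (r E') j' s' x = - height (r E) j s x / \<mu>"
      and pr: "\<And>x. face_proj (r E') j' s' x = face_proj (r E) j s x"
      using adjacent_cells[OF c c' s s' e[unfolded cell_face_def] e'[unfolded cell_face_def]] by metis
    have "rigid u \<gamma> E' i (face_proj (r E') j' s' x) = 0" for i x
    proof -
      obtain g0 G where G: "G \<bullet> outward (r E') j' s' = 0"
        and eq: "\<And>x. g0 + G \<bullet> x = rigid u \<gamma> E' i (face_proj (r E') j' s' x)"
        using affine_rigid_proj[OF ET(2) s'] by blast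
      \<comment> \<open>The weight \<open>- 1 / \<mu>\<close> balances the two fluxes: by
        \<open>adjacent_cell_int\<close> a function that is constant in the normal direction has
        \<open>\<mu>\<close> times as large an integral over \<open>E'\<close> as over
        \<open>E\<close>.\<close>
      define \<beta> :: "(real^3) set \<Rightarrow> real" where "\<beta> F = (if F = E then 1 else if F = E' then - 1 / \<mu> else 0)" for F
      define J where "J F = (if F = E then j else j')" for F
      define S where "S F = (if F = E then s else s')" for F
      have JS: "J E = j" "J E' = j'" "S E = s" "S E' = s'" using ET(3) by (simp_all add: J_def S_def)
      have sum: "(\<Sum>F\<in>T. \<beta> F * f F) = f E - f E' / \<mu>" for f :: "(real^3) set \<Rightarrow> real"
      proof -
        have "(\<Sum>F\<in>T. \<beta> F * f F) = (\<Sum>F\<in>T. (if F = E then f E else 0) + (if F = E' then - (f E' / \<mu>) else 0))"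
          using ET(3) by (intro sum.cong) (auto simp: \<beta>_def)
        then show ?thesis using ET finite_T by (simp add: sum.distrib)
      qed
      have Go: "G \<bullet> outward (r E) j s = 0" using G mu unfolding o' by simp
      have H0: "S F \<in> {0, 1}" for F using s s' by (simp add: S_def)
      have H1: "G \<bullet> edge (r F) (J F) = 0" if "\<beta> F \<noteq> 0" for F
      proof -
        have "F = E \<or> F = E'" using that by (auto simp: \<beta>_def split: if_splits)
        moreover have "G \<bullet> edge (r E) j = 0" "G \<bullet> edge (r E') j' = 0"
          unfolding edge_outward[OF c s] edge_outward[OF c' s'] using G Go by simp_all
        ultimately show ?thesis using JS by auto
      qed
      have gproj: "g0 + G \<bullet> face_proj (r E) j s x = g0 + G \<bullet> x" for x
        using Go by (simp add: face_proj_def inner_diff_right)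
      have pp: "face_proj (r E) j s (face_proj (r E) j s x) = face_proj (r E) j s x" for x
        using height_face_proj[OF c s, of j x] by (simp add: face_proj_def[of _ _ _ "face_proj (r E) j s x"])
      have H2: "(\<Sum>F\<in>T. \<beta> F * cell_int F (\<lambda>x. (g0 + G \<bullet> x) * \<phi> (face_proj (r F) (J F) (S F) x))) = 0"
        if \<phi>: "test_function \<Omega> \<phi>" for \<phi>
      proof -
        have "continuous_on UNIV (\<lambda>x. (g0 + G \<bullet> x) * \<phi> (face_proj (r E) j s x))"
          by (intro continuous_intros continuous_on_compose2[OF continuous_test_function(1)[OF \<phi>]]) auto
        from adjacent_cell_int[OF c c' s s' e[unfolded cell_face_def] e'[unfolded cell_face_def] mu h' pr this]
        have "\<mu> * cell_int E (\<lambda>x. (g0 + G \<bullet> x) * \<phi> (face_proj (r E) j s x)) = cell_int E' (\<lambda>x. (g0 + G \<bullet> x) * \<phi> (face_proj (r E) j s x))"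
          unfolding gproj pp by simp
        then show ?thesis unfolding sum JS pr using mu by (simp add: field_simps)
      qed
      have H3: "\<not> cell_face F (r F) (J F) (S F) \<subseteq> \<Gamma>N" if "\<beta> F \<noteq> 0" for F
      proof -
        have "F = E \<or> F = E'" using that by (auto simp: \<beta>_def split: if_splits)
        then have "cell_face F (r F) (J F) (S F) = E \<inter> E'" using JS e e' by auto
        \<comment> \<open>This point of the common face lies in the open domain, hence off its
          frontier; so the common face is not contained in \<Gamma>N.\<close>
        moreover have "z \<notin> \<Gamma>N"
          using z(2) bdry open_dom unfolding boundary_partition_def by (auto simp: frontier_def interior_open)
        ultimately show ?thesis using z(1) by blast
      qed
      note pf = patch_field_in_X[where \<beta> = \<beta> and J = J and S = S and ?g0.0 = g0 and G = G and ?i0.0 = i, OF H0 H1 H2 H3]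
      note pt = patch_field_test[where \<beta> = \<beta> and J = J and S = S and ?g0.0 = g0 and G = G and ?i0.0 = i, OF H0 H1 H2 H3 uc gc]
      \<comment> \<open>On \<open>E\<close> the rigid motion is already known to be zero, so the
        jump reduces to the trace from \<open>E'\<close>, which is the datum itself, and the pairing
        becomes the integral of a square.\<close>
      have "cell_int E (\<lambda>x. (g0 + G \<bullet> x) * 0) - cell_int E' (\<lambda>x. (g0 + G \<bullet> x) * rigid u \<gamma> E' i (face_proj (r E') j' s' x)) / \<mu> = 0"
        using pt orth[OF pf] unfolding sum JS rigid0[OF E] by simp
      then have "cell_int E' (\<lambda>x. (g0 + G \<bullet> x) * (g0 + G \<bullet> x)) = 0"
        unfolding eq using mu by (simp add: cell_int_def)
      then show ?thesis by (rule aff[OF ET(2) s' eq])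
    qed
    from rigid_zero[OF ET(2) s' skew[OF ET(2)] this] have "E' \<in> C" using ET by (simp add: C_def)
    then show False using E' by blast
  qed
  then show ?thesis using F by (auto simp: C_def)
qed

end

section \<open>Well-posedness\<close>

text \<open>Positivity is assumed inside \<Omega>; continuity up to the boundary of the cell carries
  the bound, with the same constant, to the traces.\<close>

lemma continuous_trace_coercive:
  assumes c: "cuboid E v" and sub: "interior E \<subseteq> \<Omega>" and E: "E \<in> T" and A: "compliance \<Omega> T A" and x: "x \<in> E"
  obtains c where "c > 0" "\<And>\<tau>. c * (norm \<tau>)\<^sup>2 \<le> blinfun_apply (trace_from E A x) \<tau> \<bullet> \<tau>"
proof -
  obtain k where k: "k > 0" "\<And>x \<tau>. x \<in> \<Omega> \<Longrightarrow> k * (norm \<tau>)\<^sup>2 \<le> blinfun_apply (A x) \<tau> \<bullet> \<tau>"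
    using A unfolding compliance_def by blast
  obtain g where g: "continuous_on E g" "\<And>x. x \<in> interior E \<Longrightarrow> g x = A x"
    using A E unfolding compliance_def by blast
  have tr: "trace_from E A x = g x" by (rule trace_from_eq[OF c g(1) g(2)[symmetric] x])
  have cl: "closure (interior E) = E" by (rule closure_interior_cuboid[OF c])
  have "k * (norm \<tau>)\<^sup>2 \<le> blinfun_apply (g x) \<tau> \<bullet> \<tau>" for \<tau>
  proof -
    have co: "continuous_on (closure (interior E)) (\<lambda>x. blinfun_apply (g x) \<tau> \<bullet> \<tau>)"
      unfolding cl by (intro continuous_on_inner continuous_on_const bounded_bilinear.continuous_on[OF bounded_bilinear_blinfun_apply] g(1))
    have xc: "x \<in> closure (interior E)" using x cl by simp
    have "k * (norm \<tau>)\<^sup>2 \<le> blinfun_apply (g y) \<tau> \<bullet> \<tau>" if "y \<in> interior E" for y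
      using k(2)[of y \<tau>] g(2)[OF that] sub that by auto
    from continuous_ge_on_closure[OF co xc this] show ?thesis .
  qed
  then show ?thesis using that k(1) tr by metis
qed

context meshed_domain
begin

definition div_pairing :: "(real^3 \<Rightarrow> real^3^3) \<Rightarrow> (real^3 \<Rightarrow> real^3) \<Rightarrow> real" where
  "div_pairing \<tau> u = (\<Sum>E\<in>T. u (cell_center E) \<bullet> cell_integral E (wdiv \<Omega> \<tau>))"

definition rot_pairing :: "(real^3 \<Rightarrow> real^3^3) \<Rightarrow> (real^3 \<Rightarrow> real^3^3) \<Rightarrow> real" where
  "rot_pairing \<tau> w = (\<Sum>E\<in>T. w (cell_center E) \<bullet> cell_integral E \<tau>)"

lemma l2_inner_commute: "l2_inner \<Omega> f g = l2_inner \<Omega> g f"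
  unfolding l2_inner_def by (simp add: inner_commute)

lemma Vh_const: "u \<in> Vh T \<Longrightarrow> E \<in> T \<Longrightarrow> u constant_on interior E" by (simp add: Vh_def)
lemma Wh0_const: "w \<in> Wh0 T \<Longrightarrow> E \<in> T \<Longrightarrow> w constant_on interior E" by (simp add: Wh0_def)

lemma l2_inner_wdiv: "u \<in> Vh T \<Longrightarrow> \<tau> \<in> X \<Longrightarrow> l2_inner \<Omega> u (wdiv \<Omega> \<tau>) = div_pairing \<tau> u"
  unfolding div_pairing_def by (rule l2_inner_piecewise[OF Vh_const wdiv_integrable])

lemma l2_inner_rot: "w \<in> Wh0 T \<Longrightarrow> \<tau> \<in> X \<Longrightarrow> l2_inner \<Omega> w \<tau> = rot_pairing \<tau> w"
  unfolding rot_pairing_def by (rule l2_inner_piecewise[OF Wh0_const L2_integrable[OF X_L2]])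

lemma piecewise_lincomb:
  fixes u v :: "real^3 \<Rightarrow> 'b::real_vector"
  shows "u constant_on S \<Longrightarrow> v constant_on S \<Longrightarrow> (\<lambda>x. u x + a *\<^sub>R v x) constant_on S"
  unfolding constant_on_def by (elim exE) (intro exI, auto)

lemma Vh_lincomb: "u \<in> Vh T \<Longrightarrow> v \<in> Vh T \<Longrightarrow> (\<lambda>x. u x + a *\<^sub>R v x) \<in> Vh T"
  unfolding Vh_def by (auto intro: piecewise_lincomb)

lemma Wh0_lincomb:
  assumes "u \<in> Wh0 T" "v \<in> Wh0 T" shows "(\<lambda>x. u x + a *\<^sub>R v x) \<in> Wh0 T"
  unfolding Wh0_def mem_Collect_eq
proof (intro ballI conjI)
  fix E assume E: "E \<in> T"
  show "(\<lambda>x. u x + a *\<^sub>R v x) constant_on interior E" using assms E by (intro piecewise_lincomb Wh0_const)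
  fix x assume x: "x \<in> interior E"
  have "transpose (u x + a *\<^sub>R v x) = transpose (u x) + a *\<^sub>R transpose (v x)"
    by (simp add: transpose_def vec_eq_iff)
  moreover have "transpose (u x) = - u x" "transpose (v x) = - v x" using assms E x unfolding Wh0_def by blast+
  ultimately show "transpose (u x + a *\<^sub>R v x) = - (u x + a *\<^sub>R v x)" by simp
qed

lemma zero_Vh: "(\<lambda>x. 0) \<in> Vh T" by (auto simp: Vh_def constant_on_def)
lemma zero_Wh0: "(\<lambda>x. 0) \<in> Wh0 T"
proof -
  have "transpose (0 :: real^3^3) = - 0" by (simp add: transpose_def vec_eq_iff)
  then show ?thesis by (auto simp: Wh0_def constant_on_def)
qed

lemma has_L2_div_zero:
  assumes "\<And>E x. E \<in> T \<Longrightarrow> x \<in> interior E \<Longrightarrow> \<tau> x = 0"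
  shows "has_L2_div \<Omega> \<tau> (\<lambda>x. 0)"
  unfolding has_L2_div_def
proof (intro conjI allI impI)
  show "L2_on \<Omega> (\<lambda>x. 0 :: real^3)" by (simp add: L2_on_def)
  fix i \<phi>
  have i0: "integrable (lebesgue_on (interior E)) (\<lambda>x. \<tau> x $ i \<bullet> grad \<phi> x)" if "E \<in> T" for E
    using assms[OF that] by (subst Bochner_Integration.integrable_cong[OF refl, where g = "\<lambda>_. 0"]) auto
  have "(\<integral>x. \<tau> x $ i \<bullet> grad \<phi> x \<partial>lebesgue_on \<Omega>) = (\<Sum>E\<in>T. \<integral>x. \<tau> x $ i \<bullet> grad \<phi> x \<partial>lebesgue_on (interior E))"
    by (rule integral_over_cells(2)[OF i0])
  also have "\<dots> = (\<Sum>E\<in>T. 0)"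
  proof (rule sum.cong[OF refl])
    fix E assume "E \<in> T"
    then have "(\<integral>x. \<tau> x $ i \<bullet> grad \<phi> x \<partial>lebesgue_on (interior E)) = (\<integral>x. 0 \<partial>lebesgue_on (interior E))"
      using assms by (intro Bochner_Integration.integral_cong) auto
    then show "(\<integral>x. \<tau> x $ i \<bullet> grad \<phi> x \<partial>lebesgue_on (interior E)) = 0" by simp
  qed
  finally show "(\<integral>x. 0 $ i * \<phi> x \<partial>lebesgue_on \<Omega>) = - (\<integral>x. \<tau> x $ i \<bullet> grad \<phi> x \<partial>lebesgue_on \<Omega>)"
    by simp
qed

lemma zero_X: "(\<lambda>x. 0) \<in> X"
  unfolding X_iff
proof (intro conjI ballI allI impI)
  show "L2_on \<Omega> (\<lambda>x. 0 :: real^3^3)" by (simp add: L2_on_def)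
  show "\<exists>g. has_L2_div \<Omega> (\<lambda>x. 0) g" using has_L2_div_zero[of "\<lambda>x. 0"] by auto
  show "\<exists>P. local_stress E (r E) (\<lambda>x. 0) P" if "E \<in> T" for E
    by (rule exI[of _ "\<lambda>i x. 0"]) (simp add: local_stress_def ERT0_zero piola_vec_def vec_eq_iff)
  fix E e n x assume E: "E \<in> T" and e: "e facet_of E \<and> e \<subseteq> \<Gamma>N \<and> outward_unit_normal E e n" and x: "x \<in> e"
  have "x \<in> E" using e x facet_of_imp_subset by blast
  then have "trace_from E (\<lambda>x. 0 :: real^3^3) x = 0"
    by (intro trace_from_eq[OF cells[OF E]]) auto
  then show "trace_from E (\<lambda>x. 0 :: real^3^3) x *v n = 0" by simp
qed

text \<open>For members of \<open>X\<close> this singles out the representatives of the zero stress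
  (\<open>vertex_free_zero\<close>).\<close>

definition vertex_free :: "(real^3 \<Rightarrow> real^3^3) \<Rightarrow> bool" where
  "vertex_free \<tau> \<longleftrightarrow> (\<forall>E\<in>T. \<forall>i\<in>{1..8}. trace_from E \<tau> (r E i) = 0)"

lemma vertex_free_zero: 
  assumes "\<tau> \<in> X" "vertex_free \<tau>" "E \<in> T"
  shows "x \<in> interior E \<Longrightarrow> \<tau> x = 0" "cell_integral E (wdiv \<Omega> \<tau>) = 0" "cell_integral E \<tau> = 0"
    "quad_inner T r A \<sigma> \<tau> = 0" "quad_inner T r A \<tau> \<sigma> = 0"
proof -
  have z: "\<tau> x = 0" if "E \<in> T" "x \<in> interior E" for E x
    using stress_zero_of_vertices(1)[OF assms(1) that(1) _ that(2)] assms(2) that(1) by (simp add: vertex_free_def)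
  show "x \<in> interior E \<Longrightarrow> \<tau> x = 0" using z assms(3) by blast
  show "cell_integral E (wdiv \<Omega> \<tau>) = 0"
    using cell_integral_wdiv[OF assms(1) has_L2_div_zero[OF z] assms(3)] by (simp add: cell_integral_def)
  have "cell_integral E \<tau> = (\<integral>x. 0 \<partial>lebesgue_on (interior E))"
    unfolding cell_integral_def using z[OF assms(3)] by (intro Bochner_Integration.integral_cong) auto
  then show "cell_integral E \<tau> = 0" by simp
  have "trace_from E \<tau> (r E i) = 0" if "E \<in> T" "i \<in> {1..8}" for E i using assms(2) that by (simp add: vertex_free_def)
  then show "quad_inner T r A \<sigma> \<tau> = 0" "quad_inner T r A \<tau> \<sigma> = 0"
    unfolding quad_inner_def by (auto intro!: sum.neutral simp: blinfun.zero_right)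
qed

lemma zero_vertex_free: "vertex_free (\<lambda>x. 0)"
  unfolding vertex_free_def using trace_from_eq[OF cells _ refl vertex_mem] continuous_on_const by blast

lemma quad_inner_lincomb:
  assumes "\<tau> \<in> X" "\<sigma> \<in> X"
  shows "quad_inner T r A (\<lambda>x. \<tau> x + a *\<^sub>R \<sigma> x) \<eta> = quad_inner T r A \<tau> \<eta> + a * quad_inner T r A \<sigma> \<eta>"
    "quad_inner T r A \<eta> (\<lambda>x. \<tau> x + a *\<^sub>R \<sigma> x) = quad_inner T r A \<eta> \<tau> + a * quad_inner T r A \<eta> \<sigma>"
proof -
  have tr: "trace_from E (\<lambda>x. \<tau> x + a *\<^sub>R \<sigma> x) (r E i) = trace_from E \<tau> (r E i) + a *\<^sub>R trace_from E \<sigma> (r E i)"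
    if "E \<in> T" "i \<in> {1..8}" for E i
    by (rule trace_lincomb[OF assms that(1) vertex_mem[OF that]])
  have "quad_inner T r A (\<lambda>x. \<tau> x + a *\<^sub>R \<sigma> x) \<eta> = (\<Sum>E\<in>T. measure lebesgue E / 8 *
        (\<Sum>i = 1..8. blinfun_apply (trace_from E A (r E i)) (trace_from E \<tau> (r E i)) \<bullet> trace_from E \<eta> (r E i)
           + a * (blinfun_apply (trace_from E A (r E i)) (trace_from E \<sigma> (r E i)) \<bullet> trace_from E \<eta> (r E i))))"
    unfolding quad_inner_def
    by (intro sum.cong refl arg_cong2[where f = "(*)"])
       (simp only: tr blinfun.add_right blinfun.scaleR_right inner_add_left inner_scaleR_left)
  then show "quad_inner T r A (\<lambda>x. \<tau> x + a *\<^sub>R \<sigma> x) \<eta> = quad_inner T r A \<tau> \<eta> + a * quad_inner T r A \<sigma> \<eta>"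
    unfolding quad_inner_def by (simp add: sum.distrib distrib_left sum_distrib_left mult.left_commute)
  have "quad_inner T r A \<eta> (\<lambda>x. \<tau> x + a *\<^sub>R \<sigma> x) = (\<Sum>E\<in>T. measure lebesgue E / 8 *
        (\<Sum>i = 1..8. blinfun_apply (trace_from E A (r E i)) (trace_from E \<eta> (r E i)) \<bullet> trace_from E \<tau> (r E i)
           + a * (blinfun_apply (trace_from E A (r E i)) (trace_from E \<eta> (r E i)) \<bullet> trace_from E \<sigma> (r E i))))"
    unfolding quad_inner_def
    by (intro sum.cong refl arg_cong2[where f = "(*)"])
       (simp only: tr inner_add_right inner_scaleR_right)
  then show "quad_inner T r A \<eta> (\<lambda>x. \<tau> x + a *\<^sub>R \<sigma> x) = quad_inner T r A \<eta> \<tau> + a * quad_inner T r A \<eta> \<sigma>"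
    unfolding quad_inner_def by (simp add: sum.distrib distrib_left sum_distrib_left mult.left_commute)
qed

text \<open>The form is a sum of nonnegative vertex terms with positive weights, so each term
  vanishes, and coercivity of the compliance traces gives zero vertex values.\<close>

lemma quad_inner_definite:
  assumes A: "compliance \<Omega> T A" and z: "quad_inner T r A \<sigma> \<sigma> = 0"
  shows "vertex_free \<sigma>"
  unfolding vertex_free_def
proof (intro ballI)
  let ?q = "\<lambda>E i. blinfun_apply (trace_from E A (r E i)) (trace_from E \<sigma> (r E i)) \<bullet> trace_from E \<sigma> (r E i)"
  have pos: "?q E i \<ge> 0" "?q E i = 0 \<Longrightarrow> trace_from E \<sigma> (r E i) = 0" if E: "E \<in> T" and i: "i \<in> {1..8}" for E i
  proof -
    obtain c where c: "c > 0" "\<And>\<tau>. c * (norm \<tau>)\<^sup>2 \<le> blinfun_apply (trace_from E A (r E i)) \<tau> \<bullet> \<tau>"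
      by (rule continuous_trace_coercive[OF cells[OF E] interior_subset_dom[OF E] E A vertex_mem[OF E i]]) blast
    have "0 \<le> c * (norm (trace_from E \<sigma> (r E i)))\<^sup>2" using c(1) by simp
    then show "?q E i \<ge> 0" using c(2) order_trans by blast
    assume "?q E i = 0"
    then have "c * (norm (trace_from E \<sigma> (r E i)))\<^sup>2 \<le> 0" using c(2)[of "trace_from E \<sigma> (r E i)"] by simp
    then show "trace_from E \<sigma> (r E i) = 0" using c(1) by (simp add: mult_le_0_iff)
  qed
  fix E i assume E: "E \<in> T" and i: "i \<in> {1..8::nat}"
  have m: "measure lebesgue E > 0" if "E \<in> T" for E using cuboid_measure_pos[OF cells[OF that]] .
  have s: "(\<Sum>i = 1..8. ?q E i) \<ge> 0" if "E \<in> T" for E using pos(1)[OF that] by (intro sum_nonneg)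
  have "\<forall>E\<in>T. measure lebesgue E / 8 * (\<Sum>i = 1..8. ?q E i) = 0"
    using z unfolding quad_inner_def
    by (subst (asm) sum_nonneg_eq_0_iff[OF finite_T]) (use m s in \<open>auto intro!: mult_nonneg_nonneg\<close>)
  then have "(\<Sum>i = 1..8. ?q E i) = 0" using m[OF E] E by fastforce
  then have "\<forall>i\<in>{1..8}. ?q E i = 0" by (subst (asm) sum_nonneg_eq_0_iff) (use pos(1)[OF E] in auto)
  then show "trace_from E \<sigma> (r E i) = 0" using pos(2)[OF E i] i by blast
qed

type_synonym triple = "(real^3 \<Rightarrow> real^3^3) \<times> (real^3 \<Rightarrow> real^3) \<times> (real^3 \<Rightarrow> real^3^3)"

definition trial_space :: "triple set" where "trial_space = X \<times> Vh T \<times> Wh0 T"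

definition triple_comb :: "triple \<Rightarrow> real \<Rightarrow> triple \<Rightarrow> triple" where
  "triple_comb = (\<lambda>(\<sigma>, u, \<gamma>) a (\<tau>, v, w). (\<lambda>x. \<sigma> x + a *\<^sub>R \<tau> x, \<lambda>x. u x + a *\<^sub>R v x, \<lambda>x. \<gamma> x + a *\<^sub>R w x))"

text \<open>The three equations added up into one symmetrically arranged saddle-point form;
  independent test components separate them again.\<close>

definition system :: "(real^3 \<Rightarrow> (real^3^3) \<Rightarrow>\<^sub>L (real^3^3)) \<Rightarrow> triple \<Rightarrow> triple \<Rightarrow> real" where
  "system A = (\<lambda>(\<sigma>, u, \<gamma>) (\<tau>, v, w). quad_inner T r A \<sigma> \<tau> + div_pairing \<tau> u + rot_pairing \<tau> \<gamma> + div_pairing \<sigma> v + rot_pairing \<sigma> w)"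

definition load :: "(real^3 \<Rightarrow> real^3) \<Rightarrow> triple \<Rightarrow> real" where
  "load f = (\<lambda>(\<tau>, v, w). \<Sum>E\<in>T. v (cell_center E) \<bullet> cell_integral E f)"

text \<open>One index type for three kinds of values: \<open>q\<close> selects vertex traces of the
  stress or centre values of \<open>u\<close> or \<gamma>. Repeated coordinates do no harm, since
  only linearity, finiteness and common zeros matter.\<close>

definition coord :: "nat \<times> (real^3) set \<times> nat \<times> 3 \<times> 3 \<Rightarrow> triple \<Rightarrow> real" where
  "coord = (\<lambda>(q, E, i, m, k) (\<sigma>, u, \<gamma>). if q = 0 then trace_from E \<sigma> (r E i) $ m $ k
     else if q = 1 then u (cell_center E) $ m else \<gamma> (cell_center E) $ m $ k)"

definition coords :: "(nat \<times> (real^3) set \<times> nat \<times> 3 \<times> 3) set" where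
  "coords = {0, 1, 2} \<times> T \<times> {1..8} \<times> UNIV \<times> UNIV"

lemma coords_zero_iff:
  "(\<forall>j\<in>coords. coord j (\<sigma>, u, \<gamma>) = 0) \<longleftrightarrow> vertex_free \<sigma> \<and> (\<forall>E\<in>T. u (cell_center E) = 0 \<and> \<gamma> (cell_center E) = 0)"
proof
  assume a: "\<forall>j\<in>coords. coord j (\<sigma>, u, \<gamma>) = 0"
  have b: "coord (q, E, i, m, k) (\<sigma>, u, \<gamma>) = 0" if "q \<in> {0, 1, 2}" "E \<in> T" "i \<in> {1..8}" for q E i m k
    by (rule bspec[OF a]) (use that in \<open>simp add: coords_def\<close>)
  have "trace_from E \<sigma> (r E i) = 0" if "E \<in> T" "i \<in> {1..8}" for E i
    using b[of 0 E i] that by (simp add: coord_def vec_eq_iff)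
  moreover have "u (cell_center E) = 0" "\<gamma> (cell_center E) = 0" if "E \<in> T" for E
    using b[of 1 E 1] b[of 2 E 1] that by (simp_all add: coord_def vec_eq_iff)
  ultimately show "vertex_free \<sigma> \<and> (\<forall>E\<in>T. u (cell_center E) = 0 \<and> \<gamma> (cell_center E) = 0)"
    by (simp add: vertex_free_def)
next
  assume "vertex_free \<sigma> \<and> (\<forall>E\<in>T. u (cell_center E) = 0 \<and> \<gamma> (cell_center E) = 0)"
  then show "\<forall>j\<in>coords. coord j (\<sigma>, u, \<gamma>) = 0"
    by (auto simp: coords_def coord_def vertex_free_def)
qed

lemma div_pairing_lincomb:
  "div_pairing \<tau> (\<lambda>x. u x + a *\<^sub>R v x) = div_pairing \<tau> u + a * div_pairing \<tau> v"
  "\<tau> \<in> X \<Longrightarrow> \<sigma> \<in> X \<Longrightarrow> div_pairing (\<lambda>x. \<tau> x + a *\<^sub>R \<sigma> x) u = div_pairing \<tau> u + a * div_pairing \<sigma> u"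
  unfolding div_pairing_def by (simp_all add: wdiv_lincomb inner_add_left inner_add_right sum.distrib sum_distrib_left)

lemma rot_pairing_lincomb:
  "rot_pairing \<tau> (\<lambda>x. u x + a *\<^sub>R v x) = rot_pairing \<tau> u + a * rot_pairing \<tau> v"
  "\<tau> \<in> X \<Longrightarrow> \<sigma> \<in> X \<Longrightarrow> rot_pairing (\<lambda>x. \<tau> x + a *\<^sub>R \<sigma> x) u = rot_pairing \<tau> u + a * rot_pairing \<sigma> u"
  unfolding rot_pairing_def by (simp_all add: cell_integral_lincomb L2_integrable[OF X_L2] inner_add_left inner_add_right sum.distrib sum_distrib_left)

lemma div_pairing_zero: "div_pairing \<tau> (\<lambda>x. 0) = 0" "\<tau> \<in> X \<Longrightarrow> vertex_free \<tau> \<Longrightarrow> div_pairing \<tau> u = 0"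
  and rot_pairing_zero: "rot_pairing \<tau> (\<lambda>x. 0) = 0" "\<tau> \<in> X \<Longrightarrow> vertex_free \<tau> \<Longrightarrow> rot_pairing \<tau> w = 0"
  by (simp_all add: div_pairing_def rot_pairing_def vertex_free_zero)

lemma triple_comb_mem: "z \<in> trial_space \<Longrightarrow> y \<in> trial_space \<Longrightarrow> triple_comb z a y \<in> trial_space"
  by (auto simp: trial_space_def triple_comb_def intro: X_lincomb Vh_lincomb Wh0_lincomb)

lemma coord_triple_comb: "j \<in> coords \<Longrightarrow> z \<in> trial_space \<Longrightarrow> y \<in> trial_space \<Longrightarrow> coord j (triple_comb z a y) = coord j z + a * coord j y"
  by (auto simp: trial_space_def triple_comb_def coord_def coords_def trace_lincomb vertex_mem)

lemma system_triple_comb: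
  assumes "w \<in> trial_space" "z \<in> trial_space" "y \<in> trial_space"
  shows "system A (triple_comb z a y) w = system A z w + a * system A y w" "system A w (triple_comb z a y) = system A w z + a * system A w y"
  using assms by (auto simp: trial_space_def triple_comb_def system_def quad_inner_lincomb div_pairing_lincomb rot_pairing_lincomb distrib_left)

lemma load_triple_comb: "load f (triple_comb z a y) = load f z + a * load f y"
  by (cases z, cases y) (simp add: load_def triple_comb_def inner_add_left sum.distrib sum_distrib_left)

lemma system_nondegenerate:
  assumes A: "compliance \<Omega> T A" and z: "z \<in> trial_space" and 0: "\<And>y. y \<in> trial_space \<Longrightarrow> system A z y = 0"
  shows "\<forall>j\<in>coords. coord j z = 0"
proof -
  obtain \<sigma> u \<gamma> where ze: "z = (\<sigma>, u, \<gamma>)" by (cases z)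
  have m: "\<sigma> \<in> X" "u \<in> Vh T" "\<gamma> \<in> Wh0 T" using z by (auto simp: trial_space_def ze)
  \<comment> \<open>Negatives are written as 0 + (-1) u so that the rules for linear combinations
    apply. The mixed terms cancel and leave the quadrature form of \<sigma>.\<close>
  let ?y = "(\<sigma>, \<lambda>x. 0 + (-1) *\<^sub>R u x, \<lambda>x. 0 + (-1) *\<^sub>R \<gamma> x)"
  have "?y \<in> trial_space" unfolding trial_space_def mem_Times_iff fst_conv snd_conv
    by (intro conjI m(1) Vh_lincomb[OF zero_Vh m(2)] Wh0_lincomb[OF zero_Wh0 m(3)])
  from 0[OF this] have "quad_inner T r A \<sigma> \<sigma> = 0"
    unfolding ze system_def prod.case div_pairing_lincomb(1) rot_pairing_lincomb(1) div_pairing_zero(1) rot_pairing_zero(1) by simp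
  then have v: "vertex_free \<sigma>" by (rule quad_inner_definite[OF A])
  \<comment> \<open>As \<sigma> is zero at the vertices, all terms containing it drop out, and only
    the pairing with the multipliers remains.\<close>
  have "div_pairing \<tau> u + rot_pairing \<tau> \<gamma> = 0" if "\<tau> \<in> X" for \<tau>
    using 0[of "(\<tau>, \<lambda>x. 0, \<lambda>x. 0)"] that zero_Vh zero_Wh0 T_nonempty vertex_free_zero(5)[OF m(1) v, of _ A \<tau>]
    by (auto simp: ze trial_space_def system_def div_pairing_zero rot_pairing_zero)
  then have "l2_inner \<Omega> u (wdiv \<Omega> \<tau>) + l2_inner \<Omega> \<gamma> \<tau> = 0" if "\<tau> \<in> X" for \<tau>
    using that m by (simp add: l2_inner_wdiv l2_inner_rot)
  from stress_pairing_injective[OF m(2,3) this]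
  show ?thesis unfolding ze coords_zero_iff using v by blast
qed

lemma system_null:
  assumes y: "y \<in> trial_space" and 0: "\<forall>j\<in>coords. coord j y = 0"
  shows "(\<forall>z\<in>trial_space. system A z y = 0) \<and> load f y = 0"
proof -
  obtain \<tau> v w where ye: "y = (\<tau>, v, w)" by (cases y)
  have t: "\<tau> \<in> X" "vertex_free \<tau>" and c: "\<And>E. E \<in> T \<Longrightarrow> v (cell_center E) = 0" "\<And>E. E \<in> T \<Longrightarrow> w (cell_center E) = 0"
    using y 0 unfolding ye coords_zero_iff by (auto simp: trial_space_def)
  obtain E where E: "E \<in> T" using T_nonempty by blast
  have "div_pairing \<sigma> v = 0" "rot_pairing \<sigma> w = 0" for \<sigma> using c by (simp_all add: div_pairing_def rot_pairing_def)
  then show ?thesis unfolding ye using c vertex_free_zero(4)[OF t E] div_pairing_zero(2)[OF t] rot_pairing_zero(2)[OF t]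
    by (auto simp: system_def load_def)
qed

text \<open>Setting two of the three test components to zero splits the single equation into the
  three equations of the method; conversely these are added.\<close>

lemma msmfe0_solution_iff:
  assumes f: "L2_on \<Omega> f"
  shows "msmfe0_solution \<Omega> T r \<Gamma>N A f \<sigma> u \<gamma> \<longleftrightarrow>
    (\<sigma>, u, \<gamma>) \<in> trial_space \<and> (\<forall>y\<in>trial_space. system A (\<sigma>, u, \<gamma>) y = load f y)"
proof (cases "\<sigma> \<in> X \<and> u \<in> Vh T \<and> \<gamma> \<in> Wh0 T")
  case False
  then show ?thesis unfolding msmfe0_solution_def trial_space_def by auto
next
  case True
  obtain E where E: "E \<in> T" using T_nonempty by blast
  note z = zero_X zero_vertex_free
  have fv: "l2_inner \<Omega> f v = load f (\<tau>, v, w)" if "v \<in> Vh T" for v \<tau> w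
    unfolding l2_inner_commute[of f] load_def prod.case by (rule l2_inner_piecewise[OF Vh_const[OF that] L2_integrable[OF f]])
  have sol: "msmfe0_solution \<Omega> T r \<Gamma>N A f \<sigma> u \<gamma> \<longleftrightarrow>
     (\<forall>\<tau>\<in>X. quad_inner T r A \<sigma> \<tau> + div_pairing \<tau> u + rot_pairing \<tau> \<gamma> = 0) \<and> (\<forall>v\<in>Vh T. div_pairing \<sigma> v = load f (\<sigma>, v, \<gamma>)) \<and> (\<forall>w\<in>Wh0 T. rot_pairing \<sigma> w = 0)"
    unfolding msmfe0_solution_def l2_inner_commute[of "wdiv \<Omega> \<sigma>"] l2_inner_commute[of \<sigma>]
    using True by (simp add: l2_inner_wdiv l2_inner_rot fv[where \<tau> = \<sigma> and w = \<gamma>])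
  have ld: "load f (\<tau>, v, w) = load f (\<sigma>, v, \<gamma>)" for \<tau> v w by (simp add: load_def)
  have ld0: "load f (\<sigma>, \<lambda>x. 0, \<gamma>) = 0" by (simp add: load_def)
  have q0: "quad_inner T r A \<sigma> (\<lambda>x. 0) = 0" by (rule vertex_free_zero(4)[OF z E])
  have sys: "(\<forall>y\<in>trial_space. system A (\<sigma>, u, \<gamma>) y = load f y) \<longleftrightarrow>
    (\<forall>\<tau>\<in>X. \<forall>v\<in>Vh T. \<forall>w\<in>Wh0 T. quad_inner T r A \<sigma> \<tau> + div_pairing \<tau> u + rot_pairing \<tau> \<gamma> + div_pairing \<sigma> v + rot_pairing \<sigma> w = load f (\<sigma>, v, \<gamma>))"
    unfolding trial_space_def system_def by (auto simp: load_def)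
  show ?thesis
  proof
    assume "msmfe0_solution \<Omega> T r \<Gamma>N A f \<sigma> u \<gamma>"
    then show "(\<sigma>, u, \<gamma>) \<in> trial_space \<and> (\<forall>y\<in>trial_space. system A (\<sigma>, u, \<gamma>) y = load f y)"
      unfolding sol sys using True by (simp add: trial_space_def)
  next
    assume "(\<sigma>, u, \<gamma>) \<in> trial_space \<and> (\<forall>y\<in>trial_space. system A (\<sigma>, u, \<gamma>) y = load f y)"
    then have s: "quad_inner T r A \<sigma> \<tau> + div_pairing \<tau> u + rot_pairing \<tau> \<gamma> + div_pairing \<sigma> v + rot_pairing \<sigma> w = load f (\<sigma>, v, \<gamma>)"
      if "\<tau> \<in> X" "v \<in> Vh T" "w \<in> Wh0 T" for \<tau> v w using that unfolding sys by blast
    show "msmfe0_solution \<Omega> T r \<Gamma>N A f \<sigma> u \<gamma>" unfolding sol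
    proof (intro conjI ballI)
      show "quad_inner T r A \<sigma> \<tau> + div_pairing \<tau> u + rot_pairing \<tau> \<gamma> = 0" if "\<tau> \<in> X" for \<tau>
        using s[OF that zero_Vh zero_Wh0] by (simp add: div_pairing_zero rot_pairing_zero ld0)
      show "div_pairing \<sigma> v = load f (\<sigma>, v, \<gamma>)" if "v \<in> Vh T" for v
        using s[OF zero_X that zero_Wh0] by (simp add: div_pairing_zero(2)[OF z] rot_pairing_zero(2)[OF z] rot_pairing_zero(1) q0)
      show "rot_pairing \<sigma> w = 0" if "w \<in> Wh0 T" for w
        using s[OF zero_X zero_Vh that] by (simp add: div_pairing_zero(2)[OF z] rot_pairing_zero(2)[OF z] div_pairing_zero(1) q0 ld0)
    qed
  qed
qed

lemma AE_in_cells: "AE x in lebesgue_on \<Omega>. x \<in> (\<Union>E\<in>T. interior E)"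
proof -
  have "\<Omega> - (\<Union>E\<in>T. interior E) \<in> null_sets lebesgue"
    using negligible_skeleton by (simp add: negligible_iff_null_sets)
  then have "AE x in lebesgue. x \<notin> \<Omega> - (\<Union>E\<in>T. interior E)" by (rule AE_not_in)
  then have "AE x in lebesgue. x \<in> \<Omega> \<longrightarrow> x \<in> (\<Union>E\<in>T. interior E)" by (rule AE_mp) auto
  then show ?thesis using open_dom by (subst AE_restrict_space_iff) auto
qed

lemma msmfe0_well_posed:
  assumes A: "compliance \<Omega> T A" and f: "L2_on \<Omega> f"
  shows "\<exists>\<sigma> u \<gamma>. msmfe0_solution \<Omega> T r \<Gamma>N A f \<sigma> u \<gamma> \<and>
       (\<forall>\<sigma>' u' \<gamma>'. msmfe0_solution \<Omega> T r \<Gamma>N A f \<sigma>' u' \<gamma>' \<longrightarrow>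
          (AE x in lebesgue_on \<Omega>. \<sigma>' x = \<sigma> x \<and> u' x = u x \<and> \<gamma>' x = \<gamma> x))"
proof -
  have "\<exists>z\<in>trial_space. \<forall>y\<in>trial_space. system A z y = load f y"
  proof (rule nondegenerate_form_solvable[where J = coords and c = coord and comb = triple_comb])
    show "finite coords" unfolding coords_def using finite_T by simp
    show "trial_space \<noteq> {}" using zero_X zero_Vh zero_Wh0 by (auto simp: trial_space_def)
    show "triple_comb z a y \<in> trial_space" if "z \<in> trial_space" "y \<in> trial_space" for z y a using that by (rule triple_comb_mem)
    show "coord j (triple_comb z a y) = coord j z + a * coord j y" if "j \<in> coords" "z \<in> trial_space" "y \<in> trial_space" for j z y a
      using that by (rule coord_triple_comb)
    show "system A (triple_comb z a y) w = system A z w + a * system A y w" if "w \<in> trial_space" "z \<in> trial_space" "y \<in> trial_space" for w z y a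
      using that by (rule system_triple_comb)
    show "system A w (triple_comb z a y) = system A w z + a * system A w y" if "w \<in> trial_space" "z \<in> trial_space" "y \<in> trial_space" for w z y a
      using that by (rule system_triple_comb)
    show "load f (triple_comb z a y) = load f z + a * load f y" for z y a by (rule load_triple_comb)
    show "\<forall>j\<in>coords. coord j z = 0" if "z \<in> trial_space" "\<And>y. y \<in> trial_space \<Longrightarrow> system A z y = 0" for z
      using that by (rule system_nondegenerate[OF A])
    show "(\<forall>z\<in>trial_space. system A z y = 0) \<and> load f y = 0" if "y \<in> trial_space" "\<forall>j\<in>coords. coord j y = 0" for y
      using that by (rule system_null)
  qed
  then obtain \<sigma> u \<gamma> where z: "(\<sigma>, u, \<gamma>) \<in> trial_space" "\<forall>y\<in>trial_space. system A (\<sigma>, u, \<gamma>) y = load f y" by auto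
  have uniq: "AE x in lebesgue_on \<Omega>. \<sigma>' x = \<sigma> x \<and> u' x = u x \<and> \<gamma>' x = \<gamma> x"
    if s: "msmfe0_solution \<Omega> T r \<Gamma>N A f \<sigma>' u' \<gamma>'" for \<sigma>' u' \<gamma>'
  proof -
    have z': "(\<sigma>', u', \<gamma>') \<in> trial_space" "\<forall>y\<in>trial_space. system A (\<sigma>', u', \<gamma>') y = load f y" using s unfolding msmfe0_solution_iff[OF f] by blast+
    \<comment> \<open>The difference of two solutions solves the homogeneous system, so its
      coordinates vanish. This means equality on all cell interiors, which fill the domain up to a
      null set.\<close>
    let ?d = "triple_comb (\<sigma>', u', \<gamma>') (-1) (\<sigma>, u, \<gamma>)"
    have d: "?d \<in> trial_space" by (rule triple_comb_mem[OF z'(1) z(1)])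
    have "system A ?d y = 0" if "y \<in> trial_space" for y
      unfolding system_triple_comb(1)[OF that z'(1) z(1)] using z(2) z'(2) that by simp
    from system_nondegenerate[OF A d this]
    have c: "vertex_free (\<lambda>x. \<sigma>' x + (-1) *\<^sub>R \<sigma> x)" and uc: "\<And>E. E \<in> T \<Longrightarrow> u' (cell_center E) = u (cell_center E) \<and> \<gamma>' (cell_center E) = \<gamma> (cell_center E)"
      unfolding triple_comb_def prod.case coords_zero_iff by auto
    have dX: "(\<lambda>x. \<sigma>' x + (-1) *\<^sub>R \<sigma> x) \<in> X" using d by (simp add: triple_comb_def trial_space_def)
    have m: "u \<in> Vh T" "u' \<in> Vh T" "\<gamma> \<in> Wh0 T" "\<gamma>' \<in> Wh0 T" using z(1) z'(1) by (simp_all add: trial_space_def)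
    show ?thesis using AE_in_cells
    proof eventually_elim
      case (elim x)
      then obtain E where E: "E \<in> T" "x \<in> interior E" by blast
      have "\<sigma>' x + (-1) *\<^sub>R \<sigma> x = 0" by (rule vertex_free_zero(1)[OF dX c E(1,2)])
      moreover have "u' x = u x"
        using piecewise_value[OF Vh_const[OF m(1) E(1)] E] piecewise_value[OF Vh_const[OF m(2) E(1)] E] uc[OF E(1)] by simp
      moreover have "\<gamma>' x = \<gamma> x"
        using piecewise_value[OF Wh0_const[OF m(3) E(1)] E] piecewise_value[OF Wh0_const[OF m(4) E(1)] E] uc[OF E(1)] by simp
      ultimately show ?case by simp
    qed
  qed
  have "msmfe0_solution \<Omega> T r \<Gamma>N A f \<sigma> u \<gamma>" unfolding msmfe0_solution_iff[OF f] using z by (rule conjI)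
  then show ?thesis by (intro exI conjI allI impI) (assumption | erule uniq)+
qed

end

theorem theorem3p1:
  fixes \<Omega> \<Gamma>D \<Gamma>N :: "(real^3) set"
    and T :: "(real^3) set set"
    and r :: "(real^3) set \<Rightarrow> nat \<Rightarrow> real^3"
    and \<kappa> :: real
    and A :: "real^3 \<Rightarrow> (real^3^3) \<Rightarrow>\<^sub>L (real^3^3)"
  assumes domain: "open \<Omega>" "connected \<Omega>" "\<Omega> \<noteq> {}" "bounded \<Omega>" "simply_connected \<Omega>"
    and mesh: "cuboid_mesh \<Omega> T r \<kappa>"
    and bdry: "boundary_partition \<Omega> T \<Gamma>D \<Gamma>N" "\<Gamma>D \<noteq> {}"
    and compl: "compliance \<Omega> T A"
  shows "\<forall>f :: real^3 \<Rightarrow> real^3. L2_on \<Omega> f \<longrightarrow>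
    (\<exists>\<sigma> u \<gamma>. msmfe0_solution \<Omega> T r \<Gamma>N A f \<sigma> u \<gamma> \<and>
       (\<forall>\<sigma>' u' \<gamma>'. msmfe0_solution \<Omega> T r \<Gamma>N A f \<sigma>' u' \<gamma>' \<longrightarrow>
          (AE x in lebesgue_on \<Omega>. \<sigma>' x = \<sigma> x \<and> u' x = u x \<and> \<gamma>' x = \<gamma> x)))"
proof (intro allI impI)
  fix f :: "real^3 \<Rightarrow> real^3" assume f: "L2_on \<Omega> f"
  interpret meshed_domain \<Omega> \<Gamma>D \<Gamma>N T r \<kappa>
    using domain mesh bdry by unfold_locales
  show "\<exists>\<sigma> u \<gamma>. msmfe0_solution \<Omega> T r \<Gamma>N A f \<sigma> u \<gamma> \<and>
       (\<forall>\<sigma>' u' \<gamma>'. msmfe0_solution \<Omega> T r \<Gamma>N A f \<sigma>' u' \<gamma>' \<longrightarrow>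
          (AE x in lebesgue_on \<Omega>. \<sigma>' x = \<sigma> x \<and> u' x = u x \<and> \<gamma>' x = \<gamma> x))"
    by (rule msmfe0_well_posed[OF compl f])
qed

end
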